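(* Let $\Omega\subset\mathbb{R}^n$ be a bounded domain with Lipschitz boundary. Then there exist $\varepsilon>0$ and a bounded linear operator $\mathscr{E}_\Omega\colon\mathrm{L}^1(\Omega;\mathbb{R}^n)\to\mathrm{L}^1(\Omega^\varepsilon;\mathbb{R}^n)$, where $\Omega^\varepsilon:=\{x\in\mathbb{R}^n\colon\operatorname{dist}(x,\Omega)<\varepsilon\}$, such that $(\mathscr{E}_\Omega u)|_\Omega=u$ $\mathscr{L}^n$-a.e. in $\Omega$ for every $u\in\mathrm{L}^1(\Omega;\mathbb{R}^n)$, and such that for every $u\in\mathrm{L}^1(\Omega;\mathbb{R}^n)$ with $\operatorname{div}u=0$ in $\mathscr{D}'(\Omega)$ one has $\operatorname{div}(\mathscr{E}_\Omega u)=0$ in $\mathscr{D}'(\Omega^\varepsilon)$.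
   Context: A domain is an open connected set. $\operatorname{div}u=0$ in $\mathscr{D}'(U)$ means $\int_U u\cdot\nabla\varphi\,dx=0$ for all $\varphi\in C^\infty_c(U)$. *)

theory Defs
  imports "HOL-Analysis.Analysis"
begin

fun Ck_fun :: "nat \<Rightarrow> ('a::euclidean_space \<Rightarrow> real) \<Rightarrow> bool" where
  "Ck_fun 0 f = continuous_on UNIV f"
| "Ck_fun (Suc k) f = (f differentiable_on UNIV \<and> continuous_on UNIV f \<and>
      (\<forall>v. Ck_fun k (\<lambda>x. frechet_derivative f (at x) v)))"

definition smooth_fun :: "('a::euclidean_space \<Rightarrow> real) \<Rightarrow> bool" where
  "smooth_fun f \<longleftrightarrow> (\<forall>k. Ck_fun k f)"

definition test_fun :: "'a::euclidean_space set \<Rightarrow> ('a \<Rightarrow> real) \<Rightarrow> bool" where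
  "test_fun U \<phi> \<longleftrightarrow> smooth_fun \<phi> \<and> compact (closure {x. \<phi> x \<noteq> 0})
       \<and> closure {x. \<phi> x \<noteq> 0} \<subseteq> U"

definition grad :: "('a::euclidean_space \<Rightarrow> real) \<Rightarrow> 'a \<Rightarrow> 'a" where
  "grad \<phi> x = (\<Sum>b\<in>Basis. frechet_derivative \<phi> (at x) b *\<^sub>R b)"

definition div_free :: "'a::euclidean_space set \<Rightarrow> ('a \<Rightarrow> 'a) \<Rightarrow> bool" where
  "div_free U u \<longleftrightarrow> (\<forall>\<phi>. test_fun U \<phi> \<longrightarrow>
       integral\<^sup>L (lebesgue_on U) (\<lambda>x. u x \<bullet> grad \<phi> x) = 0)"

definition domain :: "'a::topological_space set \<Rightarrow> bool" where
  "domain \<Omega> \<longleftrightarrow> open \<Omega> \<and> connected \<Omega>"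

text \<open>Lipschitz boundary: near every boundary point x, in a suitable orthonormal frame
  (unit direction \<nu>, hyperplane \<nu>^\<bottom>), \<Omega> is the subgraph of a Lipschitz function
  \<gamma> on \<nu>^\<bottom> inside a cylinder of radius r and half-height h.\<close>
definition lipschitz_boundary :: "'a::euclidean_space set \<Rightarrow> bool" where
  "lipschitz_boundary \<Omega> \<longleftrightarrow>
    (\<forall>x\<in>frontier \<Omega>. \<exists>\<nu> r h L \<gamma>. norm \<nu> = 1 \<and> r > 0 \<and> h > 0 \<and>
       L-lipschitz_on {z. z \<bullet> \<nu> = 0} \<gamma> \<and>
       (\<forall>z. z \<bullet> \<nu> = 0 \<and> norm z < r \<longrightarrow> \<bar>\<gamma> z\<bar> < h) \<and>
       \<Omega> \<inter> {x + z + t *\<^sub>R \<nu> | z t. z \<bullet> \<nu> = 0 \<and> norm z < r \<and> \<bar>t\<bar> < h}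
         = {x + z + t *\<^sub>R \<nu> | z t. z \<bullet> \<nu> = 0 \<and> norm z < r \<and> - h < t \<and> t < \<gamma> z})"

definition nbhd :: "'a::euclidean_space set \<Rightarrow> real \<Rightarrow> 'a set" where
  "nbhd \<Omega> \<epsilon> = {x. infdist x \<Omega> < \<epsilon>}"

end

theory Submission
  imports Defs
begin

text \<open>
  The extension is dual to an operation on test functions. Write \<open>\<delta>\<close> for the distance to the complement
  of \<open>\<Omega>\<close>, \<open>d\<close> for a \<open>C\<^sup>1\<close> substitute of \<open>\<delta>\<close> with bounded gradient, and \<open>\<nu>\<close> for a \<open>C\<^sup>1\<close> field of directions
  leading out of \<open>\<Omega>\<close>. For \<open>x\<close> in \<open>\<Omega>\<close> close to the boundary the points
  \<open>Y(x, y) = x + \<Lambda> d(x) (\<nu>(x) + \<kappa> y)\<close>, with \<open>y\<close> in the unit cube \<open>Q\<close>, lie outside \<open>\<Omega>\<close>, at distance at least \<open>\<delta>(x)\<close>.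
  Put \<open>A \<phi>(x) = \<integral>\<^sub>Q \<phi>(Y(x, y)) dy\<close>. Its gradient is an average of \<open>\<nabla>\<phi>\<close> over points outside \<open>\<Omega>\<close>, so
  \<open>\<integral>\<^sub>\<Omega> u \<bullet> \<nabla>(\<phi> - A \<phi>) = \<integral> E u \<bullet> \<nabla>\<phi>\<close> defines an \<open>L\<^sup>1\<close>-bounded \<open>E\<close> with \<open>E u = u\<close> on \<open>\<Omega>\<close>; averaging over
  \<open>Q\<close> makes the adjoint an integral operator by Fubini alone. If \<open>\<phi>\<close> is supported near \<open>\<Omega>\<close> then
  \<open>\<phi> - A \<phi>\<close> is \<open>C\<^sup>1\<close> in \<open>\<Omega>\<close> with bounded gradient and is \<open>O(\<delta>)\<close>, hence its gradient is orthogonal to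
  divergence-free fields by cutting off near the boundary and mollifying.
\<close>

section \<open>Smooth functions\<close>

text \<open>The pulled back test function may not be localised by a cutoff: where the cutoff is
  differentiated, \<open>\<phi>\<close> appears without derivative, and such a term is no pairing
  with the gradient of \<open>\<phi>\<close>. This is why \<open>Y(x, y)\<close> has to be at least
  as far from \<open>\<Omega>\<close> as \<open>x\<close> is from the complement: if
  \<open>\<phi>\<close> lives in a small neighbourhood of \<open>\<Omega>\<close>, its average
  vanishes by itself deep inside. That \<open>Y(x, y) - x\<close> is of order
  \<open>\<delta>(x)\<close> gives the decay at the boundary.

  For a single map \<open>x \<mapsto> Y(x, 0)\<close> the adjoint would require injectivity and a
  Jacobian bounded below. At fixed \<open>x\<close>, however, \<open>y \<mapsto> Y(x, y)\<close> is
  a translation after a scaling, whatever the dependence on \<open>x\<close>. The price is that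
  scale and direction must be differentiable in \<open>x\<close>: \<open>\<delta>\<close> is only
  Lipschitz and is replaced by \<open>d\<close>, and the directions of the charts are glued with C^1
  weights. The large factor \<open>\<Lambda>\<close> makes the step long compared with
  \<open>\<delta>\<close>, so that displacements of size \<open>\<delta>\<close> are absorbed by the
  opening of the exit cone.\<close>

lemma Ck_fun_SucI:
  assumes "\<And>x. (f has_derivative f' x) (at x)" and "\<And>v. Ck_fun k (\<lambda>x. f' x v)"
  shows "Ck_fun (Suc k) f"
proof -
  have "frechet_derivative f (at x) = f' x" for x
    using frechet_derivative_at[OF assms(1)[of x]] by simp
  moreover have "f differentiable_on UNIV"
    using assms(1) by (auto simp: differentiable_on_def differentiable_def)
  ultimately show ?thesis
    using assms(2) differentiable_imp_continuous_on by auto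
qed

lemma Ck_fun_SucD:
  assumes "Ck_fun (Suc k) f"
  shows "(f has_derivative frechet_derivative f (at x)) (at x)"
  using assms by (auto simp: differentiable_on_def frechet_derivative_works[symmetric])

lemma Ck_fun_lower: "Ck_fun (Suc k) f \<Longrightarrow> Ck_fun k f"
proof (induction k arbitrary: f)
  case (Suc k)
  then show ?case
    by (metis Ck_fun.simps(2))
qed auto

lemma Ck_fun_continuous: "Ck_fun k f \<Longrightarrow> continuous_on UNIV f"
  by (cases k) auto

lemma Ck_fun_const [simp]: "Ck_fun k (\<lambda>x. c)"
proof (induction k arbitrary: c)
  case (Suc k)
  show ?case
    by (rule Ck_fun_SucI[where f' = "\<lambda>x v. 0"]) (auto simp: Suc.IH)
qed auto

lemma Ck_fun_add: "Ck_fun k f \<Longrightarrow> Ck_fun k g \<Longrightarrow> Ck_fun k (\<lambda>x. f x + g x)"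
proof (induction k arbitrary: f g)
  case (Suc k)
  show ?case
    using Suc.IH Suc.prems
    by (intro Ck_fun_SucI[OF has_derivative_add[OF Ck_fun_SucD[OF Suc.prems(1)] Ck_fun_SucD[OF Suc.prems(2)]]]) auto
qed (auto intro: continuous_intros)

lemma Ck_fun_mult: "Ck_fun k f \<Longrightarrow> Ck_fun k g \<Longrightarrow> Ck_fun k (\<lambda>x. f x * g x)"
proof (induction k arbitrary: f g)
  case (Suc k)
  show ?case
  proof (rule Ck_fun_SucI[OF has_derivative_mult[OF Ck_fun_SucD[OF Suc.prems(1)] Ck_fun_SucD[OF Suc.prems(2)]]])
    fix v
    show "Ck_fun k (\<lambda>x. f x * frechet_derivative g (at x) v + frechet_derivative f (at x) v * g x)"
      using Suc.prems by (intro Ck_fun_add Suc.IH Ck_fun_lower[OF Suc.prems(1)] Ck_fun_lower[OF Suc.prems(2)]) auto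
  qed
qed (auto intro: continuous_intros)

lemma Ck_fun_inner: "Ck_fun k (\<lambda>x. x \<bullet> v)"
proof (cases k)
  case (Suc m)
  show ?thesis unfolding Suc
    by (rule Ck_fun_SucI[where f' = "\<lambda>x h. h \<bullet> v"]) (auto intro!: derivative_eq_intros)
qed (auto intro: continuous_intros)

section \<open>A flat exponential and the smooth bump built from it\<close>

definition flat_exp :: "real poly \<Rightarrow> real \<Rightarrow> real" where
  "flat_exp p x = (if x > 0 then poly p (inverse x) * exp (- inverse x) else 0)"

lemma poly_div_exp_tendsto_0: "((\<lambda>y. poly p y / exp y) \<longlongrightarrow> (0::real)) at_top"
proof -
  have "((\<lambda>y. \<Sum>i\<le>degree p. coeff p i * (y ^ i / exp y)) \<longlongrightarrow> (\<Sum>i\<le>degree p. coeff p i * 0)) at_top"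
    by (intro tendsto_intros tendsto_power_div_exp_0)
  then show ?thesis
    by (simp add: poly_altdef sum_divide_distrib)
qed

text \<open>With \<open>y = 1 / x\<close> the function is \<open>p(y) exp(- y)\<close>, and
  \<open>y\<close> has derivative \<open>- y^2\<close>, so the derivative is
  \<open>y^2 (p - p')(y) exp(- y)\<close>: the family is closed under differentiation. At 0 the
  exponential beats every polynomial in \<open>y\<close>.\<close>

lemma flat_exp_DERIV: "(flat_exp p has_real_derivative flat_exp (monom 1 2 * (p - pderiv p)) x) (at x)"
proof -
  consider "x > 0" | "x < 0" | "x = 0" by linarith
  then show ?thesis
  proof cases
    case 1
    have "((\<lambda>x. poly p (inverse x) * exp (- inverse x)) has_real_derivative
        flat_exp (monom 1 2 * (p - pderiv p)) x) (at x)"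
      using 1 unfolding flat_exp_def
      by (auto intro!: derivative_eq_intros simp: poly_monom field_simps power2_eq_square)
    then show ?thesis
    proof (rule DERIV_cong_ev[THEN iffD1, rotated -1])
      show "\<forall>\<^sub>F x in nhds x. poly p (inverse x) * exp (- inverse x) = flat_exp p x"
        using eventually_nhds_in_open[of "{0<..}" x] 1
        by (auto elim!: eventually_mono simp: flat_exp_def)
    qed auto
  next
    case 2
    have "((\<lambda>x. 0) has_real_derivative flat_exp (monom 1 2 * (p - pderiv p)) x) (at x)"
      using 2 by (auto simp: flat_exp_def)
    then show ?thesis
    proof (rule DERIV_cong_ev[THEN iffD1, rotated -1])
      show "\<forall>\<^sub>F x in nhds x. 0 = flat_exp p x"
        using eventually_nhds_in_open[of "{..<0}" x] 2
        by (auto elim!: eventually_mono simp: flat_exp_def)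
    qed auto
  next
    case 3
    have "((\<lambda>h. (flat_exp p (0 + h) - flat_exp p 0) / h) \<longlongrightarrow> 0) (at_right 0)"
    proof (rule Lim_transform_eventually)
      \<comment> \<open>Dividing by \<open>h\<close> multiplies by \<open>inverse h\<close>, a
        factor which \<open>pCons 0 p\<close> absorbs into the polynomial.\<close>
      show "((\<lambda>h. poly (pCons 0 p) (inverse h) / exp (inverse h)) \<longlongrightarrow> 0) (at_right 0)"
        by (rule filterlim_compose[OF poly_div_exp_tendsto_0 filterlim_inverse_at_top_right])
      show "\<forall>\<^sub>F h in at_right 0. poly (pCons 0 p) (inverse h) / exp (inverse h) = (flat_exp p (0 + h) - flat_exp p 0) / h"
        using eventually_at_right_less[of 0]
        by (auto elim!: eventually_mono simp: flat_exp_def field_simps exp_minus)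
    qed
    moreover have "((\<lambda>h. (flat_exp p (0 + h) - flat_exp p 0) / h) \<longlongrightarrow> 0) (at_left 0)"
    proof (rule tendsto_eventually)
      show "\<forall>\<^sub>F h in at_left 0. (flat_exp p (0 + h) - flat_exp p 0) / h = 0"
        by (auto simp: flat_exp_def eventually_at_filter)
    qed
    ultimately show ?thesis
      unfolding 3 DERIV_def by (simp add: filterlim_split_at flat_exp_def)
  qed
qed

text \<open>A directional derivative is a linear form times a function of the same shape with
  another polynomial, so the induction runs over all \<open>p\<close> at once. Using
  \<open>x \<bullet> x\<close> avoids the norm, which is not differentiable at 0.\<close>

lemma Ck_fun_flat_exp_ball: "Ck_fun k (\<lambda>x. flat_exp p (r - x \<bullet> x))"
proof (induction k arbitrary: p)
  case 0
  have "continuous_on UNIV (flat_exp p)"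
    using flat_exp_DERIV DERIV_isCont by (blast intro: continuous_at_imp_continuous_on)
  then show ?case
    by (auto intro!: continuous_on_compose2[of UNIV "flat_exp p"] continuous_intros)
next
  case (Suc k)
  define q where "q = monom 1 2 * (p - pderiv p)"
  have "((\<lambda>x. flat_exp p (r - x \<bullet> x)) has_derivative (\<lambda>h. (h \<bullet> x) * (flat_exp q (r - x \<bullet> x) * (- 2)))) (at x)" for x
  proof -
    have "((\<lambda>x. r - x \<bullet> x) has_derivative (\<lambda>h. - 2 * (h \<bullet> x))) (at x)"
      by (auto intro!: derivative_eq_intros simp: inner_commute)
    from has_derivative_compose[OF this flat_exp_DERIV[unfolded has_field_derivative_def], of p]
    show ?thesis
      by (auto simp: q_def algebra_simps)
  qed
  then show ?case
  proof (rule Ck_fun_SucI)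
    fix v :: 'a
    show "Ck_fun k (\<lambda>x. (v \<bullet> x) * (flat_exp q (r - x \<bullet> x) * (- 2)))"
      using Ck_fun_inner[of k v] by (intro Ck_fun_mult Suc.IH) (auto simp: inner_commute)
  qed
qed

section \<open>Differentiation under the integral sign and gradients as vectors\<close>

lemma has_derivative_integral_cbox:
  fixes F :: "'a::euclidean_space \<Rightarrow> 'b::euclidean_space \<Rightarrow> real" and G :: "'a \<Rightarrow> 'b \<Rightarrow> 'a"
  assumes "open U"
    and F: "\<And>x t. x \<in> U \<Longrightarrow> t \<in> cbox a b \<Longrightarrow> ((\<lambda>x. F x t) has_derivative (\<lambda>h. G x t \<bullet> h)) (at x)"
    and int: "\<And>x. x \<in> U \<Longrightarrow> F x integrable_on cbox a b"
    and G: "continuous_on (U \<times> cbox a b) (\<lambda>(x, t). G x t)"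
    and "x \<in> U"
  shows "((\<lambda>x. integral (cbox a b) (F x)) has_derivative (\<lambda>h. integral (cbox a b) (G x) \<bullet> h)) (at x)"
proof -
  obtain e where e: "e > 0" "ball x e \<subseteq> U"
    using assms openE by blast
  define J where "J = (\<lambda>g::'a. blinfun_inner_right g)"
  have "((\<lambda>x. integral (cbox a b) (F x)) has_derivative blinfun_apply (integral (cbox a b) (\<lambda>t. J (G x t)))) (at x within ball x e)"
  \<comment> \<open>Leibniz's rule wants a convex set and derivatives in operator form. The ball
    around \<open>x\<close> provides convexity, and as it is open the derivative within it is the
    full one.\<close>
  proof (rule leibniz_rule)
    show "((\<lambda>x. F x t) has_derivative blinfun_apply (J (G y t))) (at y within ball x e)"
      if "y \<in> ball x e" "t \<in> cbox a b" for y t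
    proof -
      have "((\<lambda>x. F x t) has_derivative (\<lambda>h. G y t \<bullet> h)) (at y)"
        using F e that by blast
      from has_derivative_at_withinI[OF this] show ?thesis
        unfolding J_def by simp
    qed
    show "continuous_on (ball x e \<times> cbox a b) (\<lambda>(x, t). J (G x t))"
      unfolding J_def split_beta'
      by (intro continuous_intros bounded_linear.continuous_on[OF bounded_linear_blinfun_inner_right])
         (use e in \<open>auto intro!: continuous_on_subset[OF G[unfolded split_beta']]\<close>)
  qed (use int e in auto)
  moreover have "blinfun_apply (integral (cbox a b) (\<lambda>t. J (G x t))) = (\<lambda>h. integral (cbox a b) (G x) \<bullet> h)"
  proof
    fix h
    have c: "continuous_on (cbox a b) (G x)"
      using continuous_on_compose2[OF G, of "cbox a b" "\<lambda>t. (x, t)"] \<open>x \<in> U\<close>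
      by (simp add: continuous_on_Pair image_subset_iff)
    then have i: "G x integrable_on cbox a b"
      by (rule integrable_continuous)
    have "integral (cbox a b) (\<lambda>t. J (G x t)) = J (integral (cbox a b) (G x))"
      using integral_linear[OF i, of J] bounded_linear_blinfun_inner_right
      by (simp add: J_def o_def)
    then show "blinfun_apply (integral (cbox a b) (\<lambda>t. J (G x t))) h = integral (cbox a b) (G x) \<bullet> h"
      by (simp add: J_def)
  qed
  moreover have "at x within ball x e = at x"
    using e by (intro at_within_open) auto
  ultimately show ?thesis by simp
qed

lemma grad_eqI:
  assumes "(f has_derivative (\<lambda>h. g \<bullet> h)) (at x)"
  shows "grad f x = g"
  unfolding grad_def frechet_derivative_at[OF assms, symmetric]
  by (simp add: euclidean_representation)

lemma Ck_fun_has_gradient: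
  assumes "Ck_fun (Suc k) f"
  shows "(f has_derivative (\<lambda>h. grad f x \<bullet> h)) (at x)"
proof -
  have d: "(f has_derivative frechet_derivative f (at x)) (at x)"
    by (rule Ck_fun_SucD[OF assms])
  then have "linear (frechet_derivative f (at x))"
    by (rule has_derivative_linear)
  then have "frechet_derivative f (at x) h = grad f x \<bullet> h" for h
    unfolding grad_def inner_sum_left
    by (subst euclidean_representation[of h, symmetric])
       (simp add: linear_sum linear_scale inner_commute mult.commute)
  then show ?thesis using d by presburger
qed

lemma Ck_fun_grad_continuous:
  assumes "Ck_fun (Suc k) f"
  shows "continuous_on UNIV (grad f)"
proof -
  have "continuous_on UNIV (\<lambda>x. frechet_derivative f (at x) v)" for v
    using assms Ck_fun_continuous by auto
  then show ?thesis
    unfolding grad_def[abs_def] by (intro continuous_intros)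
qed

section \<open>Mollification\<close>

text \<open>A bridge between two integrals: limits and Fubini belong to the Lebesgue integral,
  differentiation under the integral sign to the one over a box.\<close>

lemma integral_lborel_continuous_cbox:
  fixes g :: "'a::euclidean_space \<Rightarrow> 'b::euclidean_space"
  assumes "continuous_on UNIV g" and "\<And>x. x \<notin> cbox a b \<Longrightarrow> g x = 0"
  shows "integrable lborel g" and "integral\<^sup>L lborel g = integral (cbox a b) g"
proof -
  have eq: "(\<lambda>x. indicator (cbox a b) x *\<^sub>R g x) = g"
    using assms(2) by (auto simp: indicator_def)
  have s: "set_integrable lborel (cbox a b) g"
    unfolding set_integrable_def
    by (rule borel_integrable_compact) (auto intro: continuous_on_subset[OF assms(1)])
  show "integrable lborel g"
    using s by (simp add: set_integrable_def eq)
  show "integral\<^sup>L lborel g = integral (cbox a b) g"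
    using set_borel_integral_eq_integral(2)[OF s] by (simp add: set_lebesgue_integral_def eq)
qed

lemma nn_integral_lborel_affine:
  fixes f :: "'a::euclidean_space \<Rightarrow> ennreal"
  assumes "c \<noteq> 0" and [measurable]: "f \<in> borel_measurable borel"
  shows "(\<integral>\<^sup>+x. f x \<partial>lborel) = ennreal (\<bar>c\<bar> ^ DIM('a)) * (\<integral>\<^sup>+x. f (t + c *\<^sub>R x) \<partial>lborel)"
  by (subst lborel_affine[OF assms(1), of t])
     (simp add: nn_integral_density nn_integral_distr nn_integral_cmult)

lemma lborel_integral_affine:
  fixes f :: "'a::euclidean_space \<Rightarrow> 'b::euclidean_space"
  assumes "c \<noteq> 0" and [measurable]: "f \<in> borel_measurable borel"
  shows "(LINT x|lborel. f x) = \<bar>c\<bar> ^ DIM('a) *\<^sub>R (LINT x|lborel. f (t + c *\<^sub>R x))"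
  by (subst lborel_affine[OF assms(1), of t])
     (simp add: integral_density integral_distr)

text \<open>Along the direction \<open>g\<close> itself the difference quotient tends to
  \<open>g \<bullet> g\<close> and stays below \<open>K * norm g\<close>. With \<open>K = 0\<close>
  this shows that gradients vanish where a function is locally constant.\<close>

lemma norm_gradient_le:
  fixes f :: "'a::real_inner \<Rightarrow> real"
  assumes f: "(f has_derivative (\<lambda>h. g \<bullet> h)) (at x)" and "open S" "x \<in> S" "0 \<le> K"
    and lip: "\<And>y. y \<in> S \<Longrightarrow> \<bar>f y - f x\<bar> \<le> K * norm (y - x)"
  shows "norm g \<le> K"
proof (cases "g = 0")
  case False
  have "((\<lambda>s. x + s *\<^sub>R g) has_derivative (\<lambda>s. s *\<^sub>R g)) (at 0)"
    by (auto intro!: derivative_eq_intros)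
  then have "((\<lambda>s. f (x + s *\<^sub>R g)) has_derivative (\<lambda>s. g \<bullet> (s *\<^sub>R g))) (at 0)"
    by (rule has_derivative_compose) (use f in auto)
  then have "((\<lambda>s. f (x + s *\<^sub>R g)) has_real_derivative g \<bullet> g) (at 0)"
    by (simp add: has_field_derivative_def mult_commute_abs)
  then have lim: "((\<lambda>s. (f (x + s *\<^sub>R g) - f x) / s) \<longlongrightarrow> g \<bullet> g) (at 0)"
    by (simp add: DERIV_def)
  have "\<forall>\<^sub>F s in at 0. x + s *\<^sub>R g \<in> S"
  proof -
    have "((\<lambda>s. x + s *\<^sub>R g) \<longlongrightarrow> x + 0 *\<^sub>R g) (at (0::real))"
      by (intro tendsto_intros)
    then show ?thesis
      using topological_tendstoD[OF _ \<open>open S\<close>] \<open>x \<in> S\<close> by force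
  qed
  then have "\<forall>\<^sub>F s in at 0. (f (x + s *\<^sub>R g) - f x) / s \<le> K * norm g"
    using eventually_neq_at_within[of 0 0 UNIV]
  proof eventually_elim
    case (elim s)
    have "(f (x + s *\<^sub>R g) - f x) / s \<le> \<bar>f (x + s *\<^sub>R g) - f x\<bar> / \<bar>s\<bar>"
      by (metis abs_divide abs_ge_self)
    also have "\<dots> \<le> (K * norm (s *\<^sub>R g)) / \<bar>s\<bar>"
      using lip[OF elim(1)] by (intro divide_right_mono) auto
    also have "\<dots> = K * norm g"
      using elim(2) by simp
    finally show ?case .
  qed
  with lim have "g \<bullet> g \<le> K * norm g"
    by (rule tendsto_upperbound) auto
  then show ?thesis
    using False by (simp add: dot_square_norm power2_eq_square)
qed (use \<open>0 \<le> K\<close> in auto)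

definition mollifier :: "real \<Rightarrow> ('a::euclidean_space \<Rightarrow> real) \<Rightarrow> bool" where
  "mollifier t \<rho> \<longleftrightarrow> smooth_fun \<rho> \<and> (\<forall>x. 0 \<le> \<rho> x) \<and> (\<forall>x. t \<le> norm x \<longrightarrow> \<rho> x = 0)
     \<and> integral\<^sup>L lborel \<rho> = 1"

text \<open>The kernel is translated by \<open>x\<close>, not \<open>f\<close>, so that derivatives
  fall on \<open>\<rho>\<close> and a continuous \<open>f\<close> becomes smooth.
  \<open>mollify_commute\<close> gives the other form, in which bounds on \<open>f\<close> are
  inherited.\<close>

definition mollify :: "('a::euclidean_space \<Rightarrow> real) \<Rightarrow> ('a \<Rightarrow> real) \<Rightarrow> 'a \<Rightarrow> real" where
  "mollify \<rho> f x = (LINT z|lborel. f z * \<rho> (x - z))"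

lemma norm_ge_outside_cbox:
  fixes x :: "'a::euclidean_space"
  assumes "x \<notin> cbox (- (t *\<^sub>R One)) (t *\<^sub>R One)"
  shows "t \<le> norm x"
proof -
  obtain b where b: "b \<in> Basis" "x \<bullet> b < - t \<or> t < x \<bullet> b"
    using assms by (force simp: mem_box)
  then show ?thesis
    using Basis_le_norm[OF b(1), of x] by auto
qed

text \<open>The bump of radius \<open>t\<close> is divided by its integral. That integral is not 0,
  since a nonnegative continuous function with integral 0 over the cube vanishes there, whereas the
  bump is positive at the origin.\<close>

lemma mollifier_exists:
  assumes "t > 0"
  obtains \<rho> :: "'a::euclidean_space \<Rightarrow> real" where "mollifier t \<rho>"
proof -
  define \<rho>0 :: "'a \<Rightarrow> real" where "\<rho>0 = (\<lambda>x. flat_exp 1 (t^2 - x \<bullet> x))"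
  have sm: "Ck_fun k \<rho>0" for k
    unfolding \<rho>0_def by (rule Ck_fun_flat_exp_ball)
  have nn: "0 \<le> \<rho>0 x" for x
    by (simp add: \<rho>0_def flat_exp_def)
  have z: "\<rho>0 x = 0" if "t \<le> norm x" for x
    using that assms power_mono[of t "norm x" 2] by (simp add: \<rho>0_def flat_exp_def dot_square_norm not_less)
  have co: "continuous_on UNIV \<rho>0"
    using sm[of 0] by simp
  define Q where "Q = cbox (- (t *\<^sub>R One)) (t *\<^sub>R One :: 'a)"
  have zQ: "\<rho>0 x = 0" if "x \<notin> Q" for x
    using that norm_ge_outside_cbox z unfolding Q_def by blast
  define I where "I = integral\<^sup>L lborel \<rho>0"
  have I: "integrable lborel \<rho>0" "I = integral Q \<rho>0"
    using integral_lborel_continuous_cbox[OF co zQ[unfolded Q_def]] by (auto simp: I_def Q_def)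
  have "I \<noteq> 0"
  proof
    assume "I = 0"
    then have "(\<rho>0 has_integral 0) Q"
      using I(2) integrable_continuous[OF continuous_on_subset[OF co]]
      by (metis Q_def has_integral_integral subset_UNIV)
    moreover have "0 \<in> Q"
      using assms by (simp add: Q_def mem_box)
    ultimately have "\<rho>0 0 = 0"
      unfolding Q_def
      by (intro has_integral_0_cbox_imp_0[of "- (t *\<^sub>R One)" "t *\<^sub>R One" \<rho>0 0])
         (use nn assms in \<open>auto intro: continuous_on_subset[OF co] simp: box_eq_empty mem_box\<close>)
    then show False
      using assms by (simp add: \<rho>0_def flat_exp_def)
  qed
  moreover have "I \<ge> 0"
    unfolding I_def by (rule Bochner_Integration.integral_nonneg) (use nn in auto)
  ultimately have "I > 0" by simp
  have "integral\<^sup>L lborel (\<lambda>x. (1 / I) * \<rho>0 x) = 1"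
    unfolding integral_mult_right_zero I_def[symmetric] using \<open>I > 0\<close> by simp
  then have "mollifier t (\<lambda>x. (1 / I) * \<rho>0 x)"
    unfolding mollifier_def smooth_fun_def
    using sm nn z \<open>I > 0\<close> by (auto intro!: Ck_fun_mult Ck_fun_const simp del: times_divide_eq_left)
  then show ?thesis by (rule that)
qed


lemma mollifier_continuous: "mollifier t \<rho> \<Longrightarrow> continuous_on UNIV \<rho>"
  unfolding mollifier_def smooth_fun_def using Ck_fun_continuous by blast

lemma mollify_commute:
  assumes "continuous_on UNIV f" "continuous_on UNIV \<rho>"
  shows "mollify \<rho> f x = (LINT y|lborel. f (x - y) * \<rho> y)"
proof -
  have [measurable]: "f \<in> borel_measurable borel" "\<rho> \<in> borel_measurable borel"
    using assms borel_measurable_continuous_onI by blast+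
  show ?thesis
    unfolding mollify_def
    by (subst lborel_integral_affine[of "-1" _ x]) auto
qed

text \<open>The induction is over arbitrary kernels, since a directional derivative of the
  mollification is again a mollification, with the derivative of \<open>\<rho>\<close> as kernel.
  The compact support of \<open>f\<close> lets all integrals run over one box.\<close>

lemma mollify_smooth:
  fixes f :: "'a::euclidean_space \<Rightarrow> real"
  assumes f: "continuous_on UNIV f" "\<And>x. x \<notin> cbox a b \<Longrightarrow> f x = 0" and \<rho>: "smooth_fun \<rho>"
  shows "smooth_fun (mollify \<rho> f)"
proof -
  have eq: "mollify \<rho> f = (\<lambda>x. integral (cbox a b) (\<lambda>z. f z * \<rho> (x - z)))"
    if "continuous_on UNIV \<rho>" for \<rho>
    unfolding mollify_def
    by (intro ext integral_lborel_continuous_cbox continuous_intros continuous_on_compose2[OF that])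
       (use f in auto)
  have "Ck_fun k (mollify \<rho> f)" if "Ck_fun k \<rho>" for k
    using that
  proof (induction k arbitrary: \<rho>)
    case 0
    then have c: "continuous_on UNIV \<rho>" by simp
    have "continuous_on UNIV (\<lambda>x. integral (cbox a b) (\<lambda>z. f z * \<rho> (x - z)))"
      by (rule integral_continuous_on_param, unfold split_beta')
         (intro continuous_intros continuous_on_compose2[OF c] continuous_on_compose2[OF f(1)]; auto)
    then show ?case
      by (simp add: eq[OF c])
  next
    case (Suc k)
    have c: "continuous_on UNIV \<rho>"
      using Suc.prems by simp
    have c': "continuous_on UNIV (\<lambda>x. frechet_derivative \<rho> (at x) v)" for v
      using Suc.prems Ck_fun_continuous by auto
    note g = Ck_fun_has_gradient[OF Suc.prems]
    have fr: "frechet_derivative \<rho> (at x) = (\<lambda>h. grad \<rho> x \<bullet> h)" for x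
      using frechet_derivative_at[OF g] by simp
    note cg = Ck_fun_grad_continuous[OF Suc.prems]
    have "((\<lambda>x. integral (cbox a b) (\<lambda>z. f z * \<rho> (x - z))) has_derivative
        (\<lambda>h. integral (cbox a b) (\<lambda>z. f z *\<^sub>R grad \<rho> (x - z)) \<bullet> h)) (at x)" for x
    proof (rule has_derivative_integral_cbox[where U = UNIV])
      show "((\<lambda>x. f t * \<rho> (x - t)) has_derivative (\<bullet>) (f t *\<^sub>R grad \<rho> (x - t))) (at x)" for x t
        by (rule has_derivative_eq_rhs[OF has_derivative_mult_right[OF has_derivative_compose[OF _ g]]])
           (auto intro!: derivative_eq_intros)
      show "(\<lambda>z. f z * \<rho> (x - z)) integrable_on cbox a b" for x
        by (intro integrable_continuous continuous_intros continuous_on_compose2[OF c] continuous_on_subset[OF f(1)]) auto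
      show "continuous_on (UNIV \<times> cbox a b) (\<lambda>(x, t). f t *\<^sub>R grad \<rho> (x - t))"
        unfolding split_beta'
        by (intro continuous_intros continuous_on_compose2[OF cg] continuous_on_compose2[OF f(1)]; auto)
    qed auto
    moreover have "integral (cbox a b) (\<lambda>z. f z *\<^sub>R grad \<rho> (x - z)) \<bullet> h = mollify (\<lambda>x. frechet_derivative \<rho> (at x) h) f x" for x h
    proof -
      have "(\<lambda>z. f z *\<^sub>R grad \<rho> (x - z)) integrable_on cbox a b"
        by (intro integrable_continuous continuous_intros continuous_on_compose2[OF cg] continuous_on_subset[OF f(1)]) auto
      from integral_linear[OF this bounded_linear_inner_left[of h]]
      show ?thesis
        by (simp add: eq[OF c'[unfolded fr]] fr o_def)
    qed
    ultimately show ?case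
      unfolding eq[OF c]
      by (rule_tac Ck_fun_SucI[where f' = "\<lambda>x h. mollify (\<lambda>x. frechet_derivative \<rho> (at x) h) f x"])
         (use Suc in auto)
  qed
  then show ?thesis
    using \<rho> by (auto simp: smooth_fun_def)
qed

text \<open>A mollifier is a probability density on the ball of radius \<open>t\<close>, so it
  averages values all within \<open>e\<close> of \<open>c\<close>. The same estimate serves for
  values, for gradients, for Lipschitz constants (with differences of translates and
  \<open>c = 0\<close>), and with \<open>e = 0\<close> for the preservation of locally constant
  values.\<close>

lemma mollifier_integral_bound:
  fixes \<rho> :: "'a::euclidean_space \<Rightarrow> real" and g :: "'a \<Rightarrow> 'b::euclidean_space"
  assumes \<rho>: "mollifier t \<rho>" and g: "continuous_on UNIV g"
    and e: "\<And>y. norm y < t \<Longrightarrow> norm (g y - c) \<le> e" "0 \<le> e"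
  shows "integrable lborel (\<lambda>y. \<rho> y *\<^sub>R g y)"
    and "norm ((LINT y|lborel. \<rho> y *\<^sub>R g y) - c) \<le> e"
proof -
  have c\<rho>: "continuous_on UNIV \<rho>"
    using \<rho> by (rule mollifier_continuous)
  have z: "\<rho> y = 0" if "y \<notin> cbox (- (t *\<^sub>R One)) (t *\<^sub>R One)" for y
    using norm_ge_outside_cbox[OF that] \<rho> by (auto simp: mollifier_def)
  show i: "integrable lborel (\<lambda>y. \<rho> y *\<^sub>R g y)"
    by (rule integral_lborel_continuous_cbox[where a = "- (t *\<^sub>R One)" and b = "t *\<^sub>R One"])
       (auto intro!: continuous_intros g c\<rho> simp: z)
  have i\<rho>: "integrable lborel \<rho>"
    by (rule integral_lborel_continuous_cbox[where a = "- (t *\<^sub>R One)" and b = "t *\<^sub>R One"])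
       (auto intro!: c\<rho> simp: z)
  have I1: "integral\<^sup>L lborel \<rho> = 1"
    using \<rho> by (simp add: mollifier_def)
  have "(LINT y|lborel. \<rho> y *\<^sub>R g y) - c = (LINT y|lborel. \<rho> y *\<^sub>R g y - \<rho> y *\<^sub>R c)"
    using i i\<rho> by (simp add: I1)
  also have "norm \<dots> \<le> (LINT y|lborel. norm (\<rho> y *\<^sub>R g y - \<rho> y *\<^sub>R c))"
    by (rule integral_norm_bound)
  also have "\<dots> \<le> (LINT y|lborel. \<rho> y * e)"
  proof (rule integral_mono)
    show "norm (\<rho> y *\<^sub>R g y - \<rho> y *\<^sub>R c) \<le> \<rho> y * e" for y
    proof (cases "norm y < t")
      case True
      then show ?thesis
        using e(1)[of y] \<rho> by (simp add: mollifier_def flip: scaleR_diff_right)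
           (simp add: mult_left_mono)
    next
      case False
      then show ?thesis using \<rho> by (simp add: mollifier_def)
    qed
  qed (use i i\<rho> in auto)
  also have "\<dots> = e"
    using I1 by simp
  finally show "norm ((LINT y|lborel. \<rho> y *\<^sub>R g y) - c) \<le> e" .
qed

lemma mollify_dist_le:
  assumes "mollifier t \<rho>" "continuous_on UNIV f"
    and "\<And>y. norm (x - y) < t \<Longrightarrow> \<bar>f y - c\<bar> \<le> e" "0 \<le> e"
  shows "\<bar>mollify \<rho> f x - c\<bar> \<le> e"
proof -
  have "norm ((LINT y|lborel. \<rho> y *\<^sub>R f (x - y)) - c) \<le> e"
    by (rule mollifier_integral_bound[OF assms(1)])
       (use assms in \<open>auto intro!: continuous_intros continuous_on_compose2[OF assms(2)]\<close>)
  then show ?thesis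
    by (simp add: mollify_commute[OF assms(2) mollifier_continuous[OF assms(1)]] mult.commute)
qed

lemma mollify_lipschitz:
  assumes \<rho>: "mollifier t \<rho>" and f: "continuous_on UNIV f"
    and "\<And>x y. \<bar>f x - f y\<bar> \<le> K * norm (x - y)"
  shows "\<bar>mollify \<rho> f x - mollify \<rho> f y\<bar> \<le> K * norm (x - y)"
proof -
  have c: "continuous_on UNIV (\<lambda>z. f (x - z))" for x
    by (auto intro!: continuous_intros continuous_on_compose2[OF f])
  have b: "bounded ((\<lambda>z. f (x - z)) ` cball 0 t)" for x
    by (intro compact_imp_bounded compact_continuous_image continuous_on_subset[OF c]) auto
  have i: "integrable lborel (\<lambda>z. \<rho> z *\<^sub>R f (x - z))" for x
  proof -
    obtain B where "\<And>z. norm z \<le> t \<Longrightarrow> norm (f (x - z)) \<le> B"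
      using b[of x] unfolding bounded_iff by (metis imageI mem_cball_0)
    then show ?thesis
      by (intro mollifier_integral_bound(1)[OF \<rho> c, where c = 0 and e = "max B 0"])
         (auto simp: le_max_iff_disj)
  qed
  have "norm ((LINT z|lborel. \<rho> z *\<^sub>R (f (x - z) - f (y - z))) - 0) \<le> K * norm (x - y)"
    using assms(3)[of "x - z" "y - z" for z] order_trans[OF abs_ge_zero assms(3)]
    by (intro mollifier_integral_bound(2)[OF \<rho>] continuous_intros c) auto
  moreover have "(LINT z|lborel. \<rho> z *\<^sub>R (f (x - z) - f (y - z))) = mollify \<rho> f x - mollify \<rho> f y"
    unfolding mollify_commute[OF f mollifier_continuous[OF \<rho>]] scaleR_diff_right
    by (subst Bochner_Integration.integral_diff[OF i i]) (simp add: mult.commute)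
  ultimately show ?thesis by simp
qed

text \<open>Here the derivative falls on \<open>f\<close>. The gradient of the mollification is
  thereby an average of nearby values of \<open>g\<close>, and so close to \<open>g\<close> wherever
  \<open>g\<close> varies little.\<close>

lemma mollify_has_derivative:
  assumes \<rho>: "mollifier t \<rho>"
    and f: "\<And>x. (f has_derivative (\<lambda>h. g x \<bullet> h)) (at x)" and g: "continuous_on UNIV g"
  shows "(mollify \<rho> f has_derivative (\<lambda>h. (LINT y|lborel. \<rho> y *\<^sub>R g (x - y)) \<bullet> h)) (at x)"
proof -
  define a :: 'a where "a = - (t *\<^sub>R One)"
  define b :: 'a where "b = t *\<^sub>R One"
  have cf: "continuous_on UNIV f"
    using f by (meson continuous_at_imp_continuous_on has_derivative_continuous)
  have c\<rho>: "continuous_on UNIV \<rho>"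
    using \<rho> by (rule mollifier_continuous)
  have z: "\<rho> y = 0" if "y \<notin> cbox a b" for y
    using norm_ge_outside_cbox that \<rho> by (auto simp: mollifier_def a_def b_def)
  have eqf: "mollify \<rho> f = (\<lambda>x. integral (cbox a b) (\<lambda>y. \<rho> y *\<^sub>R f (x - y)))"
  proof
    fix x
    have "mollify \<rho> f x = (LINT y|lborel. \<rho> y *\<^sub>R f (x - y))"
      by (simp add: mollify_commute[OF cf c\<rho>] mult.commute)
    also have "\<dots> = integral (cbox a b) (\<lambda>y. \<rho> y *\<^sub>R f (x - y))"
      by (rule integral_lborel_continuous_cbox)
         (auto intro!: continuous_intros c\<rho> continuous_on_compose2[OF cf] simp: z)
    finally show "mollify \<rho> f x = integral (cbox a b) (\<lambda>y. \<rho> y *\<^sub>R f (x - y))" .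
  qed
  have eqg: "(LINT y|lborel. \<rho> y *\<^sub>R g (x - y)) = integral (cbox a b) (\<lambda>y. \<rho> y *\<^sub>R g (x - y))"
    by (rule integral_lborel_continuous_cbox)
       (auto intro!: continuous_intros c\<rho> continuous_on_compose2[OF g] simp: z)
  show ?thesis
    unfolding eqf eqg
  proof (rule has_derivative_integral_cbox[where U = UNIV])
    show "((\<lambda>x. \<rho> y *\<^sub>R f (x - y)) has_derivative (\<bullet>) (\<rho> y *\<^sub>R g (x - y))) (at x)" for x y
      by (rule has_derivative_eq_rhs[OF has_derivative_scaleR_right[OF has_derivative_compose[OF _ f]]])
         (auto intro!: derivative_eq_intros)
    show "(\<lambda>y. \<rho> y *\<^sub>R f (x - y)) integrable_on cbox a b" for x
      by (intro integrable_continuous continuous_intros continuous_on_compose2[OF cf] continuous_on_subset[OF c\<rho>]) auto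
    show "continuous_on (UNIV \<times> cbox a b) (\<lambda>(x, y). \<rho> y *\<^sub>R g (x - y))"
      unfolding split_beta'
      by (intro continuous_intros continuous_on_compose2[OF g] continuous_on_compose2[OF c\<rho>]; auto)
  qed auto
qed

section \<open>Testing against functions vanishing at the boundary\<close>

lemma borel_measurable_lebesgue_on:
  "f \<in> borel_measurable borel \<Longrightarrow> f \<in> borel_measurable (lebesgue_on S)"
  by (intro measurable_restrict_space1 measurable_completion) simp

lemma integrable_inner_bounded:
  fixes u g :: "'a \<Rightarrow> 'b::euclidean_space"
  assumes u: "integrable M u" and g[measurable]: "g \<in> borel_measurable M" 
    and C: "\<And>x. x \<in> space M \<Longrightarrow> norm (g x) \<le> C"
  shows "integrable M (\<lambda>x. u x \<bullet> g x)"
proof (rule Bochner_Integration.integrable_bound)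
  have [measurable]: "u \<in> borel_measurable M"
    using u by simp
  show "(\<lambda>x. u x \<bullet> g x) \<in> borel_measurable M"
    by measurable
  show "integrable M (\<lambda>x. C * norm (u x))"
    using u by simp
  show "AE x in M. norm (u x \<bullet> g x) \<le> norm (C * norm (u x))"
  proof (rule AE_I2)
    fix x assume x: "x \<in> space M"
    have "norm (u x \<bullet> g x) \<le> norm (u x) * norm (g x)"
      by (simp add: Cauchy_Schwarz_ineq2)
    also have "\<dots> \<le> norm (u x) * C"
      using C[OF x] by (intro mult_left_mono) auto
    also have "\<dots> \<le> norm (C * norm (u x))"
      by (metis abs_ge_self mult.commute real_norm_def)
    finally show "norm (u x \<bullet> g x) \<le> norm (C * norm (u x))" .
  qed
qed

lemma compact_cball_sum:
  fixes K :: "'a::euclidean_space set"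
  assumes "compact K"
  shows "compact {x. \<exists>y\<in>K. norm (x - y) \<le> t}"
proof -
  have "{x. \<exists>y\<in>K. norm (x - y) \<le> t} = {x + y |x y. x \<in> K \<and> y \<in> cball 0 t}"
  proof (intro equalityI subsetI)
    fix z assume "z \<in> {x. \<exists>y\<in>K. norm (x - y) \<le> t}"
    then obtain y where "y \<in> K" "norm (z - y) \<le> t" by blast
    then show "z \<in> {x + y |x y. x \<in> K \<and> y \<in> cball 0 t}"
      by (intro CollectI exI[of _ y] exI[of _ "z - y"]) simp
  next
    fix z assume "z \<in> {x + y |x y. x \<in> K \<and> y \<in> cball 0 t}"
    then obtain x y where "z = x + y" "x \<in> K" "norm y \<le> t" by auto
    then show "z \<in> {x. \<exists>y\<in>K. norm (x - y) \<le> t}" by (intro CollectI bexI[of _ x]) auto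
  qed
  then show ?thesis
    using compact_sums[OF assms compact_cball[of 0 t]] by simp
qed

lemma div_free_C1:
  fixes \<Omega> :: "'a::euclidean_space set"
  assumes \<Omega>: "open \<Omega>" and u: "integrable (lebesgue_on \<Omega>) u" "div_free \<Omega> u"
    and \<psi>: "\<And>x. (\<psi> has_derivative (\<lambda>h. g x \<bullet> h)) (at x)" and g: "continuous_on UNIV g"
    and K: "compact K" "K \<subseteq> \<Omega>" "\<And>x. x \<notin> K \<Longrightarrow> \<psi> x = 0"
  shows "(LINT x|lebesgue_on \<Omega>. u x \<bullet> g x) = 0"
proof -
  define A where "A = (LINT x|lebesgue_on \<Omega>. norm (u x))"
  have c\<psi>: "continuous_on UNIV \<psi>"
    using \<psi> by (meson continuous_at_imp_continuous_on has_derivative_continuous)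
  have g0: "g x = 0" if "x \<notin> K" for x
  proof -
    have "((\<lambda>x. 0) has_derivative (\<lambda>h. g x \<bullet> h)) (at x)"
      by (rule has_derivative_transform_within_open[OF \<psi>, of "- K"])
         (use that K compact_imp_closed in \<open>auto simp: open_Compl\<close>)
    then have "(\<lambda>h. g x \<bullet> h) = (\<lambda>h. 0)"
      using has_derivative_unique has_derivative_const by blast
    then have "g x \<bullet> g x = 0" by metis
    then show ?thesis by simp
  qed
  have "bounded (g ` K)"
    by (intro compact_imp_bounded compact_continuous_image continuous_on_subset[OF g] K) auto
  then obtain B where B: "\<And>x. norm (g x) \<le> B"
    unfolding bounded_iff by (metis g0 imageI norm_zero norm_ge_zero order_trans linorder_le_cases)
  have mg: "g \<in> borel_measurable (lebesgue_on \<Omega>)"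
    by (intro borel_measurable_lebesgue_on borel_measurable_continuous_onI g)
  have "\<bar>LINT x|lebesgue_on \<Omega>. u x \<bullet> g x\<bar> \<le> e * A" if "e > 0" for e
  proof -
    obtain r where r: "r > 0" "(\<Union>x\<in>K. ball x r) \<subseteq> \<Omega>"
      using compact_subset_open_imp_ball_epsilon_subset[OF K(1) \<Omega> K(2)] by metis
    \<comment> \<open>Two points at distance below \<open>t \<le> 1\<close> either both lie in
      \<open>K1\<close> or both miss \<open>K\<close>, where \<open>g\<close> vanishes. Hence
      uniform continuity on the compact set \<open>K1\<close> is enough.\<close>
    define K1 where "K1 = {x. \<exists>y\<in>K. norm (x - y) \<le> 1}"
    have "uniformly_continuous_on K1 g"
      unfolding K1_def
      by (intro compact_uniformly_continuous compact_cball_sum K continuous_on_subset[OF g]) auto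
    then obtain d where d: "d > 0" "\<And>x y. x \<in> K1 \<Longrightarrow> y \<in> K1 \<Longrightarrow> norm (x - y) < d \<Longrightarrow> norm (g x - g y) < e"
      unfolding uniformly_continuous_on_def using \<open>e > 0\<close> by (metis dist_norm)
    define t where "t = min (r / 2) (min d 1)"
    have t: "t > 0" "t < r" "t \<le> d" "t \<le> 1"
      using r d by (auto simp: t_def)
    have close: "norm (g y - g x) \<le> e" if "norm (x - y) < t" for x y
    proof (cases "x \<in> K1 \<and> y \<in> K1")
      case True
      then show ?thesis using d(2)[of y x] that t by (simp add: norm_minus_commute)
    next
      case False
      have "x \<notin> K" "y \<notin> K"
        using False that t by (force simp: K1_def norm_minus_commute)+
      then show ?thesis using \<open>e > 0\<close> by (simp add: g0)
    qed
    obtain \<rho> :: "'a \<Rightarrow> real" where \<rho>: "mollifier t \<rho>"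
      using mollifier_exists[OF t(1)] .
    define m where "m = mollify \<rho> \<psi>"
    define G where "G = (\<lambda>x. LINT y|lborel. \<rho> y *\<^sub>R g (x - y))"
    have mG: "(m has_derivative (\<lambda>h. G x \<bullet> h)) (at x)" for x
      unfolding m_def G_def by (rule mollify_has_derivative[OF \<rho> \<psi> g])
    have Gg: "norm (G x - g x) \<le> e" for x
      unfolding G_def
    proof (rule mollifier_integral_bound[OF \<rho>])
      show "continuous_on UNIV (\<lambda>y. g (x - y))"
        by (intro continuous_intros continuous_on_compose2[OF g]) auto
    qed (use close[of x "x - _"] \<open>e > 0\<close> in auto)
    obtain a b where ab: "K \<subseteq> cbox a b"
      using bounded_subset_cbox_symmetric[OF compact_imp_bounded[OF K(1)]] by blast
    have sm: "smooth_fun m"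
      unfolding m_def
      by (rule mollify_smooth[OF c\<psi>, of a b]) (use ab K \<rho> in \<open>auto simp: mollifier_def\<close>)
    have Gcont: "continuous_on UNIV G"
    proof -
      have "Ck_fun (Suc 0) m"
        using sm by (auto simp: smooth_fun_def)
      then have "continuous_on UNIV (grad m)"
        by (rule Ck_fun_grad_continuous)
      moreover have "grad m = G"
        using grad_eqI[OF mG] by auto
      ultimately show ?thesis by simp
    qed
    define Kt where "Kt = {x. \<exists>y\<in>K. norm (x - y) \<le> t}"
    have "compact Kt"
      unfolding Kt_def by (rule compact_cball_sum[OF K(1)])
    have "Kt \<subseteq> \<Omega>"
    proof
      fix x assume "x \<in> Kt"
      then obtain y where "y \<in> K" "norm (x - y) \<le> t"
        by (auto simp: Kt_def)
      then have "x \<in> ball y r"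
        using t by (simp add: dist_norm norm_minus_commute)
      then show "x \<in> \<Omega>" using r \<open>y \<in> K\<close> by blast
    qed
    have supp: "{x. m x \<noteq> 0} \<subseteq> Kt"
    proof (rule subsetI, rule ccontr)
      fix x assume x: "x \<in> {x. m x \<noteq> 0}" "x \<notin> Kt"
      have "\<bar>m x - 0\<bar> \<le> 0"
        unfolding m_def
        by (rule mollify_dist_le[OF \<rho> c\<psi>]) (use x(2) K(3) in \<open>force simp: Kt_def\<close>)+
      then show False using x by simp
    qed
    then have cl: "closure {x. m x \<noteq> 0} \<subseteq> Kt"
      using \<open>compact Kt\<close> by (simp add: closure_minimal compact_imp_closed)
    then have "compact (closure {x. m x \<noteq> 0})"
      using \<open>compact Kt\<close> by (meson bounded_subset closed_closure compact_eq_bounded_closed)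
    then have "test_fun \<Omega> m"
      using sm cl \<open>Kt \<subseteq> \<Omega>\<close> by (auto simp: test_fun_def)
    then have 0: "(LINT x|lebesgue_on \<Omega>. u x \<bullet> G x) = 0"
      using u(2)[unfolded div_free_def, rule_format, OF \<open>test_fun \<Omega> m\<close>] grad_eqI[OF mG] by simp
    have mG': "G \<in> borel_measurable (lebesgue_on \<Omega>)"
      by (intro borel_measurable_lebesgue_on borel_measurable_continuous_onI Gcont)
    have BG: "norm (G x) \<le> B + e" for x
      using Gg[of x] B[of x] norm_triangle_sub[of "G x" "g x"] by linarith
    have "(LINT x|lebesgue_on \<Omega>. u x \<bullet> g x) = (LINT x|lebesgue_on \<Omega>. u x \<bullet> g x - u x \<bullet> G x)"
      using integrable_inner_bounded[OF u(1) mg B] integrable_inner_bounded[OF u(1) mG' BG] 0 by simp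
    also have "\<bar>\<dots>\<bar> \<le> (LINT x|lebesgue_on \<Omega>. \<bar>u x \<bullet> g x - u x \<bullet> G x\<bar>)"
      by (rule integral_abs_bound)
    also have "\<dots> \<le> (LINT x|lebesgue_on \<Omega>. e * norm (u x))"
    proof (rule integral_mono)
      fix x
      have "\<bar>u x \<bullet> g x - u x \<bullet> G x\<bar> \<le> norm (u x) * norm (G x - g x)"
        unfolding inner_diff_right[symmetric] by (metis Cauchy_Schwarz_ineq2 norm_minus_commute)
      also have "\<dots> \<le> norm (u x) * e"
        by (intro mult_left_mono Gg) auto
      finally show "\<bar>u x \<bullet> g x - u x \<bullet> G x\<bar> \<le> e * norm (u x)" by (simp add: mult.commute)
    qed (use integrable_inner_bounded[OF u(1) mg B] integrable_inner_bounded[OF u(1) mG' BG] u in auto)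
    finally show ?thesis by (simp add: A_def)
  qed
  \<comment> \<open>The divisor is \<open>A + 1\<close> because the norm \<open>A\<close> of
    \<open>u\<close> may be 0.\<close>
  then have *: "\<bar>LINT x|lebesgue_on \<Omega>. u x \<bullet> g x\<bar> / (A + 1) \<le> e" if "e > 0" for e
  proof -
    have "A \<ge> 0" by (auto simp: A_def)
    then show ?thesis
      using \<open>\<And>e. 0 < e \<Longrightarrow> \<bar>LINT x|lebesgue_on \<Omega>. u x \<bullet> g x\<bar> \<le> e * A\<close>[OF that] that
      by (simp add: field_simps)
  qed
  have "A \<ge> 0" by (auto simp: A_def)
  have "\<bar>LINT x|lebesgue_on \<Omega>. u x \<bullet> g x\<bar> / (A + 1) \<le> 0"
    by (rule field_le_epsilon) (use * in simp)
  then show ?thesis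
    using \<open>A \<ge> 0\<close> by (simp add: divide_le_0_iff)
qed

lemma cutoff_exists:
  fixes \<Omega> :: "'a::euclidean_space set"
  assumes "bounded \<Omega>" and t: "t > 0"
  obtains X :: "'a \<Rightarrow> real" and X' :: "'a \<Rightarrow> 'a" where
    "\<And>x. (X has_derivative (\<lambda>h. X' x \<bullet> h)) (at x)" "continuous_on UNIV X'"
    "\<And>x. 0 \<le> X x" "\<And>x. X x \<le> 1"
    "\<And>x. infdist x (- \<Omega>) \<le> t \<Longrightarrow> X x = 0"
    "\<And>x. 2 * t \<le> infdist x (- \<Omega>) \<Longrightarrow> X x = 1"
    "\<And>x. norm (X' x) \<le> 2 / t"
    "\<And>x. infdist x (- \<Omega>) < t \<or> 2 * t < infdist x (- \<Omega>) \<Longrightarrow> X' x = 0"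
proof -
  define \<delta> where "\<delta> = (\<lambda>x. infdist x (- \<Omega>))"
  have \<delta>lip: "\<bar>\<delta> x - \<delta> y\<bar> \<le> norm (x - y)" for x y
    using infdist_triangle_abs[of x "- \<Omega>" y] by (simp add: \<delta>_def dist_norm)
  have \<delta>c: "continuous_on UNIV \<delta>"
    unfolding \<delta>_def by (intro continuous_intros)
  \<comment> \<open>A ramp in \<open>\<delta>\<close> from 0 at \<open>5 / 4 * t\<close> to 1 at
    \<open>7 / 4 * t\<close>, of slope \<open>2 / t\<close>. The margin \<open>t / 4\<close> on
    either side is the mollification radius, so the values 0 for \<open>\<delta> x \<le> t\<close>
    and 1 for \<open>2 * t \<le> \<delta> x\<close> survive the smoothing, as does the
    slope.\<close>
  define f where "f = (\<lambda>x. max 0 (min 1 ((\<delta> x - 5 / 4 * t) * (2 / t))))"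
  have fc: "continuous_on UNIV f"
    unfolding f_def by (intro continuous_intros \<delta>c)
  have flip: "\<bar>f x - f y\<bar> \<le> 2 / t * norm (x - y)" for x y
  proof -
    have "\<bar>f x - f y\<bar> \<le> \<bar>(\<delta> x - 5 / 4 * t) * (2 / t) - (\<delta> y - 5 / 4 * t) * (2 / t)\<bar>"
      unfolding f_def by (auto simp: max_def min_def)
    also have "\<dots> = \<bar>(\<delta> x - \<delta> y) * (2 / t)\<bar>"
      by (simp only: left_diff_distrib)
    also have "\<dots> = 2 / t * \<bar>\<delta> x - \<delta> y\<bar>"
      using t by (simp only: abs_mult) simp
    also have "\<dots> \<le> 2 / t * norm (x - y)"
      using t \<delta>lip by (intro mult_left_mono) auto
    finally show ?thesis .
  qed
  obtain \<rho> :: "'a \<Rightarrow> real" where \<rho>: "mollifier (t / 4) \<rho>"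
    using mollifier_exists[of "t / 4"] t by auto
  define X where "X = mollify \<rho> f"
  obtain a b where ab: "\<Omega> \<subseteq> cbox a b"
    using bounded_subset_cbox_symmetric[OF assms(1)] by blast
  have "smooth_fun X"
    unfolding X_def
  proof (rule mollify_smooth[OF fc])
    fix x assume "x \<notin> cbox a b"
    then have "\<delta> x = 0"
      using ab by (auto simp: \<delta>_def intro!: infdist_zero)
    then show "f x = 0" using t by (simp add: f_def)
  qed (use \<rho> in \<open>simp add: mollifier_def\<close>)
  then have sm: "Ck_fun (Suc 0) X"
    by (auto simp: smooth_fun_def)
  have X0: "X x = 0" if "\<delta> x \<le> t" for x
  proof -
    have "\<bar>X x - 0\<bar> \<le> 0"
      unfolding X_def
    proof (rule mollify_dist_le[OF \<rho> fc])
      fix y assume "norm (x - y) < t / 4"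
      then have "\<delta> y \<le> 5 / 4 * t" using \<delta>lip[of x y] that by linarith
      then have "(\<delta> y - 5 / 4 * t) * (2 / t) \<le> 0" using t by (intro mult_nonpos_nonneg) auto
      then show "\<bar>f y - 0\<bar> \<le> 0" by (simp add: f_def)
    qed auto
    then show ?thesis by simp
  qed
  have X1: "X x = 1" if "2 * t \<le> \<delta> x" for x
  proof -
    have "\<bar>X x - 1\<bar> \<le> 0"
      unfolding X_def
    proof (rule mollify_dist_le[OF \<rho> fc])
      fix y assume "norm (x - y) < t / 4"
      then have "7 / 4 * t \<le> \<delta> y" using \<delta>lip[of x y] that by linarith
      then have "1 \<le> (\<delta> y - 5 / 4 * t) * (2 / t)" using t by (simp add: field_simps)
      then show "\<bar>f y - 1\<bar> \<le> 0" by (simp add: f_def)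
    qed auto
    then show ?thesis by simp
  qed
  \<comment> \<open>Both bounds at once: the interval from 0 to 1 is the ball of radius 1/2 around
    1/2.\<close>
  have half: "\<bar>X x - 1 / 2\<bar> \<le> 1 / 2" for x
  proof -
    have "0 \<le> f y" "f y \<le> 1" for y
      by (auto simp: f_def)
    then have "\<bar>f y - 1 / 2\<bar> \<le> 1 / 2" for y
      by (smt (verit) field_sum_of_halves)
    then show ?thesis
      unfolding X_def by (intro mollify_dist_le[OF \<rho> fc]) auto
  qed
  have grad: "(X has_derivative (\<lambda>h. grad X x \<bullet> h)) (at x)" for x
    by (rule Ck_fun_has_gradient[OF sm])
  have zero: "grad X x = 0" if "\<delta> x < t \<or> 2 * t < \<delta> x" for x
  proof -
    have "norm (grad X x) \<le> 0"
      using that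
    proof
      assume "\<delta> x < t"
      then show ?thesis
        using \<delta>c by (intro norm_gradient_le[OF grad, of "{x. \<delta> x < t}"] open_Collect_less) (auto simp: X0)
    next
      assume "2 * t < \<delta> x"
      then show ?thesis
        using \<delta>c by (intro norm_gradient_le[OF grad, of "{x. 2 * t < \<delta> x}"] open_Collect_less) (auto simp: X1)
    qed
    then show ?thesis by simp
  qed
  show ?thesis
  proof (rule that[of X "grad X"])
    show "norm (grad X x) \<le> 2 / t" for x
    proof (rule norm_gradient_le[OF grad, of UNIV])
      show "\<bar>X y - X x\<bar> \<le> 2 / t * norm (y - x)" for y
        unfolding X_def by (rule mollify_lipschitz[OF \<rho> fc flip])
    qed (use t in auto)
    show "continuous_on UNIV (grad X)"
      by (rule Ck_fun_grad_continuous[OF sm])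
    show "0 \<le> X x" "X x \<le> 1" for x
      using half[of x] by linarith+
  qed (use grad X0 X1 zero in \<open>auto simp: \<delta>_def\<close>)
qed

text \<open>With a cutoff \<open>X n\<close> at distance \<open>t n\<close>, the product
  \<open>X n * \<psi>\<close> has compact support in \<open>\<Omega>\<close> and gradient
  \<open>X n *\<^sub>R g + \<psi> *\<^sub>R X' n\<close>. The second term lives where
  \<open>\<delta> \<le> 2 * t n\<close>; there \<open>\<psi>\<close> is at most
  \<open>2 * C * t n\<close> and \<open>X' n\<close> at most \<open>2 / t n\<close>, so it is
  bounded uniformly in \<open>n\<close>, and at each fixed point it is eventually 0. Dominated
  convergence removes the cutoff.\<close>

lemma div_free_boundary_vanishing:
  fixes \<Omega> :: "'a::euclidean_space set"
  assumes \<Omega>: "open \<Omega>" "bounded \<Omega>" and u: "integrable (lebesgue_on \<Omega>) u" "div_free \<Omega> u"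
    and \<psi>: "\<And>x. x \<in> \<Omega> \<Longrightarrow> (\<psi> has_derivative (\<lambda>h. g x \<bullet> h)) (at x)" and g: "continuous_on \<Omega> g"
    and C: "\<And>x. x \<in> \<Omega> \<Longrightarrow> norm (g x) \<le> C" "\<And>x. x \<in> \<Omega> \<Longrightarrow> \<bar>\<psi> x\<bar> \<le> C * infdist x (- \<Omega>)"
  shows "(LINT x|lebesgue_on \<Omega>. u x \<bullet> g x) = 0"
proof -
  define \<delta> where "\<delta> = (\<lambda>x. infdist x (- \<Omega>))"
  have \<delta>c: "continuous_on UNIV \<delta>"
    unfolding \<delta>_def by (intro continuous_intros)
  have \<delta>0: "\<delta> x = 0" if "x \<notin> \<Omega>" for x
    using that by (simp add: \<delta>_def)
  have "\<Omega> \<noteq> UNIV"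
    using \<Omega>(2) not_bounded_UNIV by blast
  then have \<delta>pos: "\<delta> x > 0" if "x \<in> \<Omega>" for x
    unfolding \<delta>_def using that \<Omega> by (intro infdist_pos_not_in_closed) auto
  define t where "t = (\<lambda>n. 1 / real (Suc n))"
  have t: "t n > 0" for n by (simp add: t_def)
  have tlim: "t \<longlonglongrightarrow> 0"
    unfolding t_def using lim_inverse_n' LIMSEQ_Suc by blast
  have "\<exists>X :: 'a \<Rightarrow> real. \<exists>X'.
      (\<forall>x. (X has_derivative (\<lambda>h. X' x \<bullet> h)) (at x)) \<and> continuous_on UNIV X' \<and>
      (\<forall>x. 0 \<le> X x) \<and> (\<forall>x. X x \<le> 1) \<and> (\<forall>x. \<delta> x \<le> t n \<longrightarrow> X x = 0) \<and>
      (\<forall>x. 2 * t n \<le> \<delta> x \<longrightarrow> X x = 1) \<and> (\<forall>x. norm (X' x) \<le> 2 / t n) \<and>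
      (\<forall>x. \<delta> x < t n \<or> 2 * t n < \<delta> x \<longrightarrow> X' x = 0)" for n
    by (rule cutoff_exists[OF \<Omega>(2) t[of n]]) (unfold \<delta>_def, blast)
  then obtain X X' where
    X: "\<And>n x. (X n has_derivative (\<lambda>h. X' n x \<bullet> h)) (at x)" "\<And>n. continuous_on UNIV (X' n)"
      "\<And>n x. 0 \<le> X n x" "\<And>n x. X n x \<le> 1" "\<And>n x. \<delta> x \<le> t n \<Longrightarrow> X n x = (0::real)"
      "\<And>n x. 2 * t n \<le> \<delta> x \<Longrightarrow> X n x = 1" "\<And>n x. norm (X' n x) \<le> 2 / t n"
      "\<And>n x. \<delta> x < t n \<or> 2 * t n < \<delta> x \<Longrightarrow> X' n x = 0"
    by metis
  define G where "G = (\<lambda>n x. X n x *\<^sub>R g x + \<psi> x *\<^sub>R X' n x)"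
  have \<psi>c: "continuous_on \<Omega> \<psi>"
    using \<psi> by (meson continuous_at_imp_continuous_on has_derivative_continuous)
  have Xc: "continuous_on UNIV (X n)" for n
    using X(1) by (meson continuous_at_imp_continuous_on has_derivative_continuous)
  have bound: "norm (G n x) \<le> 5 * C" if x: "x \<in> \<Omega>" for n x
  proof -
    have "C \<ge> 0" using C(1)[OF x] norm_ge_zero order_trans by blast
    have 1: "norm (X n x *\<^sub>R g x) \<le> 1 * C"
      unfolding norm_scaleR using X(3,4)[of n x] C(1)[OF x] by (intro mult_mono) auto
    have 2: "norm (\<psi> x *\<^sub>R X' n x) \<le> 4 * C"
    proof (cases "\<delta> x \<le> 2 * t n")
      case True
      have "norm (\<psi> x *\<^sub>R X' n x) \<le> (C * (2 * t n)) * (2 / t n)"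
        unfolding norm_scaleR
      proof (rule mult_mono)
        have "\<bar>\<psi> x\<bar> \<le> C * \<delta> x" using C(2)[OF x] by (simp add: \<delta>_def)
        also have "\<dots> \<le> C * (2 * t n)" using True \<open>C \<ge> 0\<close> by (rule mult_left_mono)
        finally show "\<bar>\<psi> x\<bar> \<le> C * (2 * t n)" .
      qed (use X(7) \<open>C \<ge> 0\<close> t[of n] in auto)
      also have "\<dots> = 4 * C" using t[of n] by simp
      finally show ?thesis .
    next
      case False
      then show ?thesis using X(8)[of x n] \<open>C \<ge> 0\<close> by simp
    qed
    show ?thesis
      unfolding G_def using norm_triangle_mono[OF 1 2] by simp
  qed
  have 0: "(LINT x|lebesgue_on \<Omega>. u x \<bullet> G n x) = 0" and Gc: "continuous_on UNIV (G n)" for n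
  proof -
    have o: "open {x. \<delta> x < t n}"
      using \<delta>c by (intro open_Collect_less) auto
    \<comment> \<open>Where \<open>\<delta> x < t n\<close> both \<open>X n\<close> and
      \<open>X' n\<close> vanish, so \<open>G n\<close> is 0 there although nothing is known about
      \<open>\<psi>\<close> outside \<open>\<Omega>\<close>. The two open sets cover the space, and
      continuity is checked on each.\<close>
    have un: "\<Omega> \<union> {x. \<delta> x < t n} = UNIV"
      using \<delta>0 t[of n] by force
    have "continuous_on \<Omega> (G n)"
      unfolding G_def
      by (intro continuous_intros g \<psi>c continuous_on_subset[OF Xc] continuous_on_subset[OF X(2)]) auto
    moreover have "continuous_on {x. \<delta> x < t n} (G n)"
      by (rule continuous_on_eq[OF continuous_on_const[of _ 0]]) (auto simp: G_def X)
    ultimately show Gc: "continuous_on UNIV (G n)"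
      using continuous_on_open_Un[OF \<Omega>(1) o] un by metis
    show "(LINT x|lebesgue_on \<Omega>. u x \<bullet> G n x) = 0"
    proof (rule div_free_C1[OF \<Omega>(1) u _ Gc])
      show "((\<lambda>x. X n x * \<psi> x) has_derivative (\<lambda>h. G n x \<bullet> h)) (at x)" for x
      proof (cases "x \<in> \<Omega>")
        case True
        show ?thesis
          by (rule has_derivative_eq_rhs[OF has_derivative_mult[OF X(1) \<psi>[OF True]]])
             (auto simp: G_def algebra_simps inner_add_left)
      next
        case False
        have x: "\<delta> x < t n" using False t \<delta>0 by simp
        have "(\<lambda>h. G n x \<bullet> h) = (\<lambda>h. 0)"
          using x by (simp add: G_def X)
        moreover have "((\<lambda>x. X n x * \<psi> x) has_derivative (\<lambda>h. 0)) (at x)"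
          by (rule has_derivative_transform_within_open[OF has_derivative_const[of 0] o])
             (use x in \<open>auto simp: X\<close>)
        ultimately show ?thesis by simp
      qed
      have cl: "closed {x. t n \<le> \<delta> x}"
        using \<delta>c by (intro closed_Collect_le) auto
      show sub: "{x. t n \<le> \<delta> x} \<subseteq> \<Omega>"
        using \<delta>0 t[of n] by force
      show "compact {x. t n \<le> \<delta> x}"
        using cl bounded_subset[OF \<Omega>(2) sub] compact_eq_bounded_closed by blast
      show "x \<notin> {x. t n \<le> \<delta> x} \<Longrightarrow> X n x * \<psi> x = 0" for x
        by (simp add: X)
    qed
  qed
  have "(\<lambda>n. LINT x|lebesgue_on \<Omega>. u x \<bullet> G n x) \<longlonglongrightarrow> (LINT x|lebesgue_on \<Omega>. u x \<bullet> g x)"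
  proof (rule integral_dominated_convergence[where w = "\<lambda>x. 5 * C * norm (u x)"])
    have [measurable]: "u \<in> borel_measurable (lebesgue_on \<Omega>)"
      using u by simp
    have [measurable]: "g \<in> borel_measurable (lebesgue_on \<Omega>)"
      using g \<Omega> by (intro continuous_imp_measurable_on_sets_lebesgue) auto
    have [measurable]: "G n \<in> borel_measurable (lebesgue_on \<Omega>)" for n
      by (intro borel_measurable_lebesgue_on borel_measurable_continuous_onI Gc)
    show "(\<lambda>x. u x \<bullet> g x) \<in> borel_measurable (lebesgue_on \<Omega>)"
      by measurable
    show "(\<lambda>x. u x \<bullet> G n x) \<in> borel_measurable (lebesgue_on \<Omega>)" for n
      by measurable
    show "integrable (lebesgue_on \<Omega>) (\<lambda>x. 5 * C * norm (u x))"
      using u by simp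
    show "AE x in lebesgue_on \<Omega>. (\<lambda>n. u x \<bullet> G n x) \<longlonglongrightarrow> u x \<bullet> g x"
    proof (rule AE_I2)
      fix x assume "x \<in> space (lebesgue_on \<Omega>)"
      then have "\<delta> x / 2 > 0" using \<delta>pos by simp
      with tlim have "\<forall>\<^sub>F n in sequentially. t n < \<delta> x / 2"
        by (rule order_tendstoD)
      then have "\<forall>\<^sub>F n in sequentially. u x \<bullet> G n x = u x \<bullet> g x"
        by eventually_elim (simp add: G_def X)
      then show "(\<lambda>n. u x \<bullet> G n x) \<longlonglongrightarrow> u x \<bullet> g x"
        by (rule tendsto_eventually)
    qed
    show "AE x in lebesgue_on \<Omega>. norm (u x \<bullet> G n x) \<le> 5 * C * norm (u x)" for n
    proof (rule AE_I2)
      fix x assume "x \<in> space (lebesgue_on \<Omega>)"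
      then have "norm (u x) * norm (G n x) \<le> norm (u x) * (5 * C)"
        using bound by (intro mult_left_mono) auto
      then show "norm (u x \<bullet> G n x) \<le> 5 * C * norm (u x)"
        using Cauchy_Schwarz_ineq2[of "u x" "G n x"] by (simp add: mult.commute)
    qed
  qed
  then show ?thesis
    unfolding 0 using LIMSEQ_unique tendsto_const by blast
qed

section \<open>Exit directions of a Lipschitz domain\<close>

lemma norm_diff_projection_le:
  fixes v :: "'a::real_inner"
  assumes "norm \<nu> = 1"
  shows "norm (v - (v \<bullet> \<nu>) *\<^sub>R \<nu>) \<le> norm v"
proof (rule power2_le_imp_le)
  have "(norm (v - (v \<bullet> \<nu>) *\<^sub>R \<nu>))\<^sup>2 = (norm v)\<^sup>2 - (v \<bullet> \<nu>)\<^sup>2"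
    using assms unfolding power2_norm_eq_inner
    by (simp add: inner_diff_left inner_diff_right inner_commute norm_eq_1 power2_eq_square)
  then show "(norm (v - (v \<bullet> \<nu>) *\<^sub>R \<nu>))\<^sup>2 \<le> (norm v)\<^sup>2"
    by simp
qed auto

text \<open>A step \<open>s (\<nu> + y)\<close> raises the height by
  \<open>s (1 + y \<bullet> \<nu>)\<close>, while the graph underneath rises by at most
  \<open>s L |y|\<close>. A point on or above the graph remains so if
  \<open>L |y| \<le> 1 - |y|\<close>, which is the opening \<open>1 / (1 + L)\<close>.\<close>

lemma lipschitz_boundary_exit_cone:
  fixes \<Omega> :: "'a::euclidean_space set"
  assumes "lipschitz_boundary \<Omega>" "x \<in> frontier \<Omega>"
  obtains \<nu> \<rho> c where "norm \<nu> = 1" "\<rho> > 0" "c > 0"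
    "\<And>q s y. q \<in> ball x \<rho> \<Longrightarrow> q \<notin> \<Omega> \<Longrightarrow> 0 \<le> s \<Longrightarrow> norm y \<le> c \<Longrightarrow>
       q + s *\<^sub>R (\<nu> + y) \<in> ball x \<rho> \<Longrightarrow> q + s *\<^sub>R (\<nu> + y) \<notin> \<Omega>"
proof -
  obtain \<nu> r h L \<gamma> where \<nu>: "norm \<nu> = 1" and rh: "r > 0" "h > 0"
    and lip: "L-lipschitz_on {z. z \<bullet> \<nu> = 0} \<gamma>"
    and eq: "\<Omega> \<inter> {x + z + t *\<^sub>R \<nu> | z t. z \<bullet> \<nu> = 0 \<and> norm z < r \<and> \<bar>t\<bar> < h}
         = {x + z + t *\<^sub>R \<nu> | z t. z \<bullet> \<nu> = 0 \<and> norm z < r \<and> - h < t \<and> t < \<gamma> z}"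
    using assms unfolding lipschitz_boundary_def by meson
  have L: "L \<ge> 0"
    using lip by (rule lipschitz_on_nonneg)
  have \<nu>\<nu>: "\<nu> \<bullet> \<nu> = 1"
    using \<nu> by (simp add: norm_eq_1)
  define T where "T = (\<lambda>p. (p - x) \<bullet> \<nu>)"
  define Z where "Z = (\<lambda>p. (p - x) - T p *\<^sub>R \<nu>)"
  have Z\<nu>: "Z p \<bullet> \<nu> = 0" for p
    by (simp add: Z_def T_def inner_diff_left \<nu>\<nu>)
  \<comment> \<open>\<open>T p\<close> is the height and \<open>Z p\<close> the foot point of
    \<open>p\<close> in the chart. Neither exceeds \<open>norm (p - x)\<close> in size, so the ball
    lies in the cylinder, and uniqueness of the decomposition turns the equation of sets into an
    inequality.\<close>
  have mem: "p \<in> \<Omega> \<longleftrightarrow> T p < \<gamma> (Z p)" if p: "p \<in> ball x (min r h)" for p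
  proof -
    have pxt: "norm (p - x) < r" "norm (p - x) < h"
      using p by (auto simp: dist_norm norm_minus_commute)
    have Zr: "norm (Z p) < r"
      using norm_diff_projection_le[OF \<nu>, of "p - x"] pxt by (simp add: Z_def T_def)
    have Th: "\<bar>T p\<bar> < h"
      using Cauchy_Schwarz_ineq2[of "p - x" \<nu>] pxt \<nu> by (simp add: T_def)
    have px: "p = x + Z p + T p *\<^sub>R \<nu>"
      by (simp add: Z_def)
    show ?thesis
    proof
      assume "p \<in> \<Omega>"
      then have "p \<in> \<Omega> \<inter> {x + z + t *\<^sub>R \<nu> | z t. z \<bullet> \<nu> = 0 \<and> norm z < r \<and> \<bar>t\<bar> < h}"
        by (intro IntI \<open>p \<in> \<Omega>\<close> CollectI exI[of _ "Z p"] exI[of _ "T p"] conjI px Z\<nu> Zr Th)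
      then obtain z t where zt: "p = x + z + t *\<^sub>R \<nu>" "z \<bullet> \<nu> = 0" "t < \<gamma> z"
        unfolding eq by blast
      have "T p = t"
        using zt by (simp add: T_def inner_add_left \<nu>\<nu>)
      moreover have "Z p = z"
        using zt \<open>T p = t\<close> by (simp add: Z_def)
      ultimately show "T p < \<gamma> (Z p)" using zt by simp
    next
      assume "T p < \<gamma> (Z p)"
      then have "p \<in> {x + z + t *\<^sub>R \<nu> | z t. z \<bullet> \<nu> = 0 \<and> norm z < r \<and> - h < t \<and> t < \<gamma> z}"
        by (intro CollectI exI[of _ "Z p"] exI[of _ "T p"] conjI) (use px Z\<nu> Zr Th in \<open>simp_all add: abs_less_iff\<close>)
      then show "p \<in> \<Omega>"
        using eq by blast
    qed
  qed
  show ?thesis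
  proof (rule that[of \<nu> "min r h" "1 / (1 + L)"])
    fix q s y
    assume q: "q \<in> ball x (min r h)" "q \<notin> \<Omega>" and s: "0 \<le> s" and y: "norm y \<le> 1 / (1 + L)"
      and q': "q + s *\<^sub>R (\<nu> + y) \<in> ball x (min r h)"
    define q' where "q' = q + s *\<^sub>R (\<nu> + y)"
    have T': "T q' = T q + s * (1 + y \<bullet> \<nu>)"
      by (simp add: T_def q'_def inner_add_left inner_diff_left \<nu>\<nu> algebra_simps)
    have Z': "Z q' - Z q = s *\<^sub>R (y - (y \<bullet> \<nu>) *\<^sub>R \<nu>)"
      unfolding Z_def T' by (simp add: q'_def algebra_simps)
    have "\<bar>\<gamma> (Z q') - \<gamma> (Z q)\<bar> \<le> L * norm (Z q' - Z q)"
      using lipschitz_onD[OF lip, of "Z q'" "Z q"] Z\<nu> by (simp add: dist_norm)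
    also have "\<dots> \<le> L * (s * norm y)"
      unfolding Z' using norm_diff_projection_le[OF \<nu>, of y] s L
      by (intro mult_left_mono) (auto simp: abs_of_nonneg intro!: mult_left_mono)
    also have "\<dots> = s * (L * norm y)" by simp
    also have "\<dots> \<le> s * (1 - norm y)"
    proof (rule mult_left_mono[OF _ s])
      have "norm y * (1 + L) \<le> 1"
        using y L by (simp add: field_simps)
      then show "L * norm y \<le> 1 - norm y" by (simp add: algebra_simps)
    qed
    also have "\<dots> \<le> s * (1 + y \<bullet> \<nu>)"
      using Cauchy_Schwarz_ineq2[of y \<nu>] \<nu> s by (intro mult_left_mono) auto
    finally have "\<gamma> (Z q') \<le> T q'"
      using mem[OF q(1)] q(2) T' by linarith
    then show "q + s *\<^sub>R (\<nu> + y) \<notin> \<Omega>"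
      using mem[OF q'] by (simp add: q'_def)
  qed (use \<nu> rh L in auto)
qed

text \<open>Squaring makes the positive part C^1, which is all the regularity that the weights of
  the exit field must have.\<close>

lemma DERIV_max_0_square: "((\<lambda>s. (max 0 s)\<^sup>2) has_real_derivative 2 * max 0 s) (at s)"
proof -
  consider "s > 0" | "s < 0" | "s = 0" by linarith
  then show ?thesis
  proof cases
    case 1
    have "((\<lambda>s. s\<^sup>2) has_real_derivative 2 * max 0 s) (at s)"
      using 1 by (auto intro!: derivative_eq_intros)
    then show ?thesis
      by (rule has_field_derivative_transform_within_open[of _ _ _ "{0<..}"]) (use 1 in auto)
  next
    case 2
    have "((\<lambda>s. 0) has_real_derivative 2 * max 0 s) (at s)"
      using 2 by auto
    then show ?thesis
      by (rule has_field_derivative_transform_within_open[of _ _ _ "{..<0}"]) (use 2 in auto)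
  next
    case 3
    have "((\<lambda>h. ((max 0 (0 + h))\<^sup>2 - (max 0 0)\<^sup>2) / h) \<longlongrightarrow> 0) (at (0::real))"
    proof (rule Lim_null_comparison)
      show "\<forall>\<^sub>F h in at 0. norm (((max 0 (0 + h))\<^sup>2 - (max 0 0)\<^sup>2) / h) \<le> \<bar>h\<bar>"
        by (rule eventuallyI) (auto simp: max_def power2_eq_square)
      show "((\<lambda>h. \<bar>h\<bar>) \<longlongrightarrow> 0) (at (0::real))"
        by (intro tendsto_rabs_zero tendsto_ident_at)
    qed
    then show ?thesis
      unfolding DERIV_def 3 by simp
  qed
qed

text \<open>\<open>q\<close> is a nearest point of the complement, and the segment from
  \<open>x\<close> to \<open>q\<close> crosses the frontier in \<open>p\<close>. Later
  \<open>p\<close> tells which charts see \<open>x\<close>, and \<open>q\<close> is the point from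
  which the way out starts.\<close>

lemma infdist_compl_frontier:
  fixes \<Omega> :: "'a::euclidean_space set"
  assumes "open \<Omega>" "bounded \<Omega>" "x \<in> \<Omega>"
  obtains p q where "p \<in> frontier \<Omega>" "dist x p \<le> infdist x (- \<Omega>)"
    "q \<notin> \<Omega>" "dist x q = infdist x (- \<Omega>)"
proof -
  have "\<Omega> \<noteq> UNIV"
    using assms not_bounded_UNIV by blast
  then have ne: "- \<Omega> \<noteq> {}" by blast
  obtain q where q: "q \<in> - \<Omega>" "infdist x (- \<Omega>) = dist x q"
    by (rule infdist_attains_inf[OF closed_Compl[OF assms(1)] ne])
  have "closed_segment x q \<inter> frontier \<Omega> \<noteq> {}"
  proof (rule connected_Int_frontier)
    show "closed_segment x q \<inter> \<Omega> \<noteq> {}" "closed_segment x q - \<Omega> \<noteq> {}"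
      using assms(3) q(1) ends_in_segment by blast+
  qed simp
  then obtain p where p: "p \<in> closed_segment x q" "p \<in> frontier \<Omega>" by blast
  have "dist x p \<le> dist x q"
    using dist_in_closed_segment[OF p(1)] by (simp add: dist_commute)
  then show ?thesis
    using that[OF p(2) _ _ q(2)[symmetric]] q by simp
qed

text \<open>Near a boundary point lying in several charts, every nonnegative combination of the chart
  directions still leads out of \<open>\<Omega>\<close>: follow the directions one after the other.\<close>

lemma exit_field:
  fixes \<Omega> :: "'a::euclidean_space set"
  assumes lb: "lipschitz_boundary \<Omega>" and \<Omega>: "open \<Omega>" "bounded \<Omega>"
  obtains \<nu> :: "'a \<Rightarrow> 'a" and \<nu>' c r where
    "\<And>x. (\<nu> has_derivative \<nu>' x) (at x)" "\<And>h. continuous_on UNIV (\<lambda>x. \<nu>' x h)"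
    "0 < c" "c \<le> 1" "0 < r" "r \<le> 1"
    "\<And>x q s y. x \<in> \<Omega> \<Longrightarrow> infdist x (- \<Omega>) < r \<Longrightarrow> q \<notin> \<Omega> \<Longrightarrow> norm (q - x) < r \<Longrightarrow>
       0 \<le> s \<Longrightarrow> s < r \<Longrightarrow> norm y \<le> c \<Longrightarrow> q + s *\<^sub>R (\<nu> x + y) \<notin> \<Omega>"
proof -
  have "\<exists>\<nu> \<rho> c. norm \<nu> = 1 \<and> \<rho> > 0 \<and> c > 0 \<and>
    (\<forall>q s y. q \<in> ball x \<rho> \<longrightarrow> q \<notin> \<Omega> \<longrightarrow> 0 \<le> s \<longrightarrow> norm y \<le> c \<longrightarrow>
       q + s *\<^sub>R (\<nu> + y) \<in> ball x \<rho> \<longrightarrow> q + s *\<^sub>R (\<nu> + y) \<notin> \<Omega>)" if x: "x \<in> frontier \<Omega>" for x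
    by (rule lipschitz_boundary_exit_cone[OF lb x]) blast
  then obtain N R c where N: "\<And>x. x \<in> frontier \<Omega> \<Longrightarrow> norm (N x) = 1"
    and R: "\<And>x. x \<in> frontier \<Omega> \<Longrightarrow> R x > 0" and c: "\<And>x. x \<in> frontier \<Omega> \<Longrightarrow> c x > 0"
    and cone: "\<And>x q s y. x \<in> frontier \<Omega> \<Longrightarrow> q \<in> ball x (R x) \<Longrightarrow> q \<notin> \<Omega> \<Longrightarrow> 0 \<le> s \<Longrightarrow> norm y \<le> c x \<Longrightarrow>
       q + s *\<^sub>R (N x + y) \<in> ball x (R x) \<Longrightarrow> q + s *\<^sub>R (N x + y) \<notin> \<Omega>"
    by metis
  have cf: "compact (frontier \<Omega>)"
    using \<Omega> by (simp add: compact_frontier_bounded)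
  \<comment> \<open>The balls of the cover have half the chart radius: what remains is room for a
    path that starts near \<open>x\<close> to stay inside the chart.\<close>
  obtain K where K: "K \<subseteq> frontier \<Omega>" "finite K" "frontier \<Omega> \<subseteq> (\<Union>k\<in>K. ball k (R k / 2))"
  proof (rule compactE_image[OF cf, of "frontier \<Omega>" "\<lambda>k. ball k (R k / 2)"])
    show "frontier \<Omega> \<subseteq> (\<Union>k\<in>frontier \<Omega>. ball k (R k / 2))"
      using R by (force simp: subset_iff)
  qed auto
  \<comment> \<open>C^1 weights, positive for \<open>k\<close> in \<open>K\<close> exactly on the
    half ball. They are not normalised: the field has to be differentiable on the whole space, while
    the sum \<open>\<Theta>\<close> is bounded below only near the frontier.\<close>
  define \<theta> where "\<theta> = (\<lambda>k x. (max 0 ((R k / 2)\<^sup>2 - (x - k) \<bullet> (x - k)))\<^sup>2)"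
  define \<theta>' where "\<theta>' = (\<lambda>k x. (2 * max 0 ((R k / 2)\<^sup>2 - (x - k) \<bullet> (x - k)) * (- 2)) *\<^sub>R (x - k))"
  have \<theta>d: "(\<theta> k has_derivative (\<lambda>h. \<theta>' k x \<bullet> h)) (at x)" for k x
  proof -
    have 1: "((\<lambda>x. (R k / 2)\<^sup>2 - (x - k) \<bullet> (x - k)) has_derivative (\<lambda>h. - 2 * ((x - k) \<bullet> h))) (at x)"
      by (auto intro!: derivative_eq_intros simp: inner_commute algebra_simps)
    show ?thesis
      unfolding \<theta>_def \<theta>'_def
      by (rule has_derivative_eq_rhs[OF has_derivative_compose[OF 1 DERIV_max_0_square[unfolded has_field_derivative_def]]])
         (simp add: fun_eq_iff)
  qed
  have \<theta>0: "\<theta> k x \<ge> 0" for k x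
    by (simp add: \<theta>_def)
  have \<theta>pos: "\<theta> k x > 0 \<longleftrightarrow> norm (x - k) < R k / 2" if "k \<in> K" for k x
  proof -
    have "R k > 0" using R K that by blast
    then have "norm (x - k) < R k / 2 \<longleftrightarrow> (norm (x - k))\<^sup>2 < (R k / 2)\<^sup>2"
      by (intro iffI power_strict_mono) (auto dest: power2_less_imp_less)
    then have "norm (x - k) < R k / 2 \<longleftrightarrow> (x - k) \<bullet> (x - k) < (R k / 2)\<^sup>2"
      by (simp only: power2_norm_eq_inner)
    then show ?thesis
      by (auto simp: \<theta>_def max_def)
  qed
  have \<theta>le: "\<theta> k x \<le> ((R k / 2)\<^sup>2)\<^sup>2" for k x
    unfolding \<theta>_def by (intro power_mono) auto
  have \<theta>c: "continuous_on UNIV (\<theta> k)" for k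
    unfolding \<theta>_def by (intro continuous_intros)
  define \<Theta> where "\<Theta> = (\<lambda>x. \<Sum>k\<in>K. \<theta> k x)"
  have \<Theta>c: "continuous_on UNIV \<Theta>"
    unfolding \<Theta>_def by (intro continuous_intros \<theta>c)
  have \<Theta>pos: "\<Theta> x > 0" if x: "x \<in> frontier \<Omega>" for x
  proof -
    obtain k where "k \<in> K" "x \<in> ball k (R k / 2)"
      using K x by blast
    then show ?thesis
      unfolding \<Theta>_def using \<theta>0 \<theta>pos[of k x] K(2)
      by (intro sum_pos2[of K k]) (auto simp: dist_norm norm_minus_commute)
  qed
  \<comment> \<open>A strict lower bound on the compact frontier persists on a neighbourhood, whose
    width is \<open>r1\<close> below.\<close>
  obtain m where m: "m > 0" "\<And>x. x \<in> frontier \<Omega> \<Longrightarrow> m < \<Theta> x"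
  proof (cases "frontier \<Omega> = {}")
    case True
    then show ?thesis using that[of 1] by auto
  next
    case False
    obtain x where x: "x \<in> frontier \<Omega>" "\<And>y. y \<in> frontier \<Omega> \<Longrightarrow> \<Theta> x \<le> \<Theta> y"
      using continuous_attains_inf[OF cf False continuous_on_subset[OF \<Theta>c]] by blast
    show ?thesis
    proof (rule that[of "\<Theta> x / 2"])
      show "\<Theta> x / 2 < \<Theta> y" if "y \<in> frontier \<Omega>" for y
        using x(2)[OF that] \<Theta>pos[OF x(1)] by simp
    qed (use \<Theta>pos[OF x(1)] in simp)
  qed
  have "open {x. m < \<Theta> x}"
    using open_Collect_less[OF continuous_on_const \<Theta>c] .
  moreover have "frontier \<Omega> \<subseteq> {x. m < \<Theta> x}"
    using m(2) by blast
  ultimately obtain r1 where r1: "r1 > 0" "(\<Union>x\<in>frontier \<Omega>. ball x r1) \<subseteq> {x. m < \<Theta> x}"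
    by (rule compact_subset_open_imp_ball_epsilon_subset[OF cf])
  define M where "M = (\<Sum>k\<in>K. ((R k / 2)\<^sup>2)\<^sup>2)"
  have M: "\<Theta> x \<le> M" "M \<ge> 0" for x
    unfolding \<Theta>_def M_def by (intro sum_mono \<theta>le, intro sum_nonneg, simp)
  define c0 where "c0 = Min (insert 1 (c ` K))"
  have c0: "0 < c0" "c0 \<le> 1" "\<And>k. k \<in> K \<Longrightarrow> c0 \<le> c k"
    using K c by (auto simp: c0_def)
  define R0 where "R0 = Min (insert 1 (R ` K))"
  have R0: "0 < R0" "\<And>k. k \<in> K \<Longrightarrow> R0 \<le> R k"
    using K R by (auto simp: R0_def)
  \<comment> \<open>A path of steps starts within \<open>r\<close> of \<open>x\<close> and has
    length at most \<open>2 * r * M\<close>, because \<open>s < r\<close>, the weights add up to at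
    most \<open>M\<close> and each \<open>N k + y'\<close> has norm at most 2. The choice keeps it
    within \<open>R0 / 2\<close> of \<open>x\<close>.\<close>
  define r where "r = min (min 1 r1) (R0 / (2 * (1 + 2 * M)))"
  have r: "0 < r" "r \<le> 1" "r \<le> r1" "r * (1 + 2 * M) \<le> R0 / 2"
  proof -
    show "0 < r" "r \<le> 1" "r \<le> r1"
      using r1 R0 M(2) by (auto simp: r_def)
    have "r \<le> R0 / (2 * (1 + 2 * M))" by (simp add: r_def)
    then show "r * (1 + 2 * M) \<le> R0 / 2"
      using M(2) by (simp add: field_simps)
  qed
  define \<nu> where "\<nu> = (\<lambda>x. \<Sum>k\<in>K. \<theta> k x *\<^sub>R N k)"
  define \<nu>' where "\<nu>' = (\<lambda>x h. \<Sum>k\<in>K. (\<theta>' k x \<bullet> h) *\<^sub>R N k)"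
  show ?thesis
  proof (rule that[of \<nu> \<nu>' "min 1 (m * c0)" r])
    show "(\<nu> has_derivative \<nu>' x) (at x)" for x
      unfolding \<nu>_def \<nu>'_def
      by (intro has_derivative_sum has_derivative_scaleR_left \<theta>d)
    show "continuous_on UNIV (\<lambda>x. \<nu>' x h)" for h
      unfolding \<nu>'_def \<theta>'_def by (intro continuous_intros)
  next
    fix x q y :: 'a and s :: real
    assume x: "x \<in> \<Omega>" "infdist x (- \<Omega>) < r" and q: "q \<notin> \<Omega>" "norm (q - x) < r"
      and s: "0 \<le> s" "s < r" and y: "norm y \<le> min 1 (m * c0)"
    obtain p where "p \<in> frontier \<Omega>" "dist x p \<le> infdist x (- \<Omega>)"
      using infdist_compl_frontier[OF \<Omega> x(1)] by metis
    then have "x \<in> ball p r1"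
      using x(2) r(3) by (simp add: dist_commute)
    then have \<Theta>x: "m < \<Theta> x"
      using r1(2) \<open>p \<in> frontier \<Omega>\<close> by blast
    \<comment> \<open>The perturbation is shared among the charts in proportion to the weights: the
      sum of \<open>\<theta> k x *\<^sub>R (N k + y')\<close> is \<open>\<nu> x + y\<close>. As
      \<open>m < \<Theta> x\<close>, the bound \<open>m * c0\<close> on \<open>y\<close> makes
      \<open>y'\<close> fit into every cone.\<close>
    define y' where "y' = y /\<^sub>R \<Theta> x"
    have y': "norm y' \<le> c0"
    proof -
      have "norm y \<le> \<Theta> x * c0"
        using y \<Theta>x c0(1) mult_right_mono[of m "\<Theta> x" c0] by linarith
      then show ?thesis
        using \<Theta>x m(1) by (simp add: y'_def field_simps)
    qed
    \<comment> \<open>The position after the steps belonging to the charts in \<open>J\<close>. The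
      induction carries the distance to \<open>x\<close> along, since each cone can be used only
      inside its own ball.\<close>
    define P where "P = (\<lambda>J. q + (\<Sum>k\<in>J. (s * \<theta> k x) *\<^sub>R (N k + y')))"
    have "P J \<notin> \<Omega> \<and> norm (P J - x) \<le> norm (q - x) + (\<Sum>k\<in>J. s * \<theta> k x * 2)" if "J \<subseteq> K" for J
      using finite_subset[OF that K(2)] that
    proof (induction J)
      case empty
      then show ?case using q by (simp add: P_def)
    next
      case (insert k J)
      have k: "k \<in> K" "k \<in> frontier \<Omega>" using insert K by auto
      have PJ: "P J \<notin> \<Omega>" "norm (P J - x) \<le> norm (q - x) + (\<Sum>k\<in>J. s * \<theta> k x * 2)"
        using insert by auto
      have Pk: "P (insert k J) = P J + (s * \<theta> k x) *\<^sub>R (N k + y')"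
        using insert by (simp add: P_def)
      have "norm ((s * \<theta> k x) *\<^sub>R (N k + y')) \<le> s * \<theta> k x * 2"
        unfolding norm_scaleR
        using N[OF k(2)] y' c0(2) norm_triangle_ineq[of "N k" y'] s(1) \<theta>0[of k x]
        by (simp add: abs_of_nonneg mult_left_mono)
      then have n: "norm (P (insert k J) - x) \<le> norm (q - x) + (\<Sum>k\<in>insert k J. s * \<theta> k x * 2)"
        using PJ(2) norm_triangle_ineq[of "P J - x" "(s * \<theta> k x) *\<^sub>R (N k + y')"] insert
        unfolding Pk by (simp add: algebra_simps)
      have near: "norm (p - x) < R0 / 2" if "norm (p - x) \<le> norm (q - x) + (\<Sum>k\<in>J'. s * \<theta> k x * 2)" "J' \<subseteq> K" for p J'
      proof -
        have "(\<Sum>k\<in>J'. s * \<theta> k x * 2) \<le> (\<Sum>k\<in>K. s * \<theta> k x * 2)"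
          using that K(2) s(1) \<theta>0 by (intro sum_mono2) auto
        also have "\<dots> = s * \<Theta> x * 2"
          by (simp add: \<Theta>_def sum_distrib_left sum_distrib_right)
        also have "\<dots> \<le> r * M * 2"
          using s M(1)[of x] \<Theta>x m(1) by (intro mult_right_mono mult_mono) auto
        finally have "norm (p - x) < r + r * M * 2"
          using that q(2) by linarith
        then show ?thesis using r(4) by (simp add: algebra_simps)
      qed
      have "P (insert k J) \<notin> \<Omega>"
      \<comment> \<open>A chart of weight 0 makes no step; a positive weight places \<open>x\<close>
        in the half ball of \<open>k\<close>, so both ends of the step lie in the full ball.\<close>
      proof (cases "\<theta> k x = 0")
        case True
        then show ?thesis using PJ Pk by simp
      next
        case False
        then have xk: "norm (x - k) < R k / 2"
          using \<theta>pos[OF k(1)] \<theta>0[of k x] by force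
        have b: "p \<in> ball k (R k)" if "norm (p - x) < R0 / 2" for p
          using that xk R0(2)[OF k(1)] norm_triangle_ineq[of "p - x" "x - k"]
          by (simp add: dist_norm norm_minus_commute)
        show ?thesis
          unfolding Pk
        proof (rule cone[OF k(2) _ PJ(1)])
          show "P J \<in> ball k (R k)"
            by (rule b[OF near[OF PJ(2)]]) (use insert in auto)
          show "P J + (s * \<theta> k x) *\<^sub>R (N k + y') \<in> ball k (R k)"
            unfolding Pk[symmetric] by (rule b[OF near[OF n insert.prems]])
          show "norm y' \<le> c k" using y' c0(3)[OF k(1)] by linarith
        qed (use s \<theta>0 in auto)
      qed
      then show ?case using n by blast
    qed
    then have "P K \<notin> \<Omega>" by blast
    moreover have "P K = q + s *\<^sub>R (\<nu> x + y)"
    proof -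
      have "(\<Sum>k\<in>K. (s * \<theta> k x) *\<^sub>R (N k + y')) = s *\<^sub>R (\<nu> x + \<Theta> x *\<^sub>R y')"
        by (simp add: \<nu>_def \<Theta>_def scaleR_sum_left scaleR_sum_right scaleR_add_right sum.distrib)
      also have "\<Theta> x *\<^sub>R y' = y"
        using \<Theta>x m(1) by (simp add: y'_def)
      finally show ?thesis by (simp add: P_def)
    qed
    ultimately show "q + s *\<^sub>R (\<nu> x + y) \<notin> \<Omega>" by simp
  qed (use c0 m r in auto)
qed

section \<open>Regularized distance to the complement\<close>

text \<open>\<open>d\<close> sums the cutoffs at the dyadic scales \<open>t j\<close>, each weighted
  by its scale. A cutoff at scale \<open>t j\<close> has gradient at most \<open>2 / t j\<close>, so
  each scale contributes at most 2, and at most two scales are active at a point. On the set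
  \<open>2 * t J < \<delta> x\<close> all cutoffs from index \<open>J\<close> on equal 1, so
  \<open>d\<close> is a finite sum plus a constant there.\<close>

lemma regularized_distance:
  fixes \<Omega> :: "'a::euclidean_space set"
  assumes \<Omega>: "open \<Omega>" "bounded \<Omega>"
  obtains d :: "'a \<Rightarrow> real" and d' :: "'a \<Rightarrow> 'a" where
    "\<And>x. x \<in> \<Omega> \<Longrightarrow> (d has_derivative (\<lambda>h. d' x \<bullet> h)) (at x)" "continuous_on \<Omega> d'"
    "\<And>x. x \<in> \<Omega> \<Longrightarrow> norm (d' x) \<le> 4"
    "\<And>x. x \<in> \<Omega> \<Longrightarrow> d x \<le> 2 * infdist x (- \<Omega>)"
    "\<And>x. x \<in> \<Omega> \<Longrightarrow> infdist x (- \<Omega>) \<le> 1 \<Longrightarrow> infdist x (- \<Omega>) / 4 \<le> d x"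
proof -
  define \<delta> where "\<delta> = (\<lambda>x. infdist x (- \<Omega>))"
  have \<delta>c: "continuous_on UNIV \<delta>"
    unfolding \<delta>_def by (intro continuous_intros)
  have "\<Omega> \<noteq> UNIV"
    using \<Omega>(2) not_bounded_UNIV by blast
  then have \<delta>pos: "\<delta> x > 0" if "x \<in> \<Omega>" for x
    unfolding \<delta>_def using that \<Omega> by (intro infdist_pos_not_in_closed) auto
  define t where "t = (\<lambda>n. (1 / 2 :: real) ^ n)"
  have t: "t n > 0" for n by (simp add: t_def)
  have tmono: "t n \<le> t m" if "m \<le> n" for m n
    using that by (simp add: t_def power_decreasing)
  have tSuc: "t n = 2 * t (Suc n)" for n by (simp add: t_def)
  have tsums: "(\<lambda>j. t (j + J)) sums (2 * t J)" for J
  proof -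
    have "(\<lambda>j. t J * (1 / 2) ^ j) sums (t J * (1 / (1 - 1 / 2)))"
      by (intro sums_mult geometric_sums) auto
    then show ?thesis by (simp add: t_def power_add mult.commute)
  qed
  have tsmall: "\<exists>n. t n < e" if "e > 0" for e
    unfolding t_def using real_arch_pow_inv[OF that, of "1 / 2"] by simp
  have "\<exists>X :: 'a \<Rightarrow> real. \<exists>X'.
      (\<forall>x. (X has_derivative (\<lambda>h. X' x \<bullet> h)) (at x)) \<and> continuous_on UNIV X' \<and>
      (\<forall>x. 0 \<le> X x) \<and> (\<forall>x. X x \<le> 1) \<and> (\<forall>x. \<delta> x \<le> t n \<longrightarrow> X x = 0) \<and>
      (\<forall>x. 2 * t n \<le> \<delta> x \<longrightarrow> X x = 1) \<and> (\<forall>x. norm (X' x) \<le> 2 / t n) \<and>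
      (\<forall>x. \<delta> x < t n \<or> 2 * t n < \<delta> x \<longrightarrow> X' x = 0)" for n
    by (rule cutoff_exists[OF \<Omega>(2) t[of n]]) (unfold \<delta>_def, blast)
  then obtain X X' where
    X: "\<And>n x. (X n has_derivative (\<lambda>h. X' n x \<bullet> h)) (at x)" "\<And>n. continuous_on UNIV (X' n)"
      "\<And>n x. 0 \<le> X n x" "\<And>n x. X n x \<le> 1" "\<And>n x. \<delta> x \<le> t n \<Longrightarrow> X n x = (0::real)"
      "\<And>n x. 2 * t n \<le> \<delta> x \<Longrightarrow> X n x = 1" "\<And>n x. norm (X' n x) \<le> 2 / t n"
      "\<And>n x. \<delta> x < t n \<or> 2 * t n < \<delta> x \<Longrightarrow> X' n x = 0"
    by metis
  define d where "d = (\<lambda>x. \<Sum>j. t j * X j x)"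
  have sm: "summable (\<lambda>j. t j * X j x)" for x
  proof (rule summable_comparison_test')
    show "summable t"
      using tsums[of 0] by (simp add: sums_iff)
    show "norm (t n * X n x) \<le> t n" for n
      using mult_left_mono[OF X(4), of "t n" n x] X(3)[of n x] t[of n] by (simp add: abs_mult)
  qed
  have dJ: "d x = (\<Sum>j<J. t j * X j x) + 2 * t J" if "2 * t J \<le> \<delta> x" for x J
  proof -
    have "(\<lambda>j. t (j + J) * X (j + J) x) = (\<lambda>j. t (j + J))"
    proof
      fix j
      have "X (j + J) x = 1"
        using that tmono[of J "j + J"] by (intro X(6)) simp
      then show "t (j + J) * X (j + J) x = t (j + J)" by simp
    qed
    then have "(\<Sum>j. t (j + J) * X (j + J) x) = 2 * t J"
      using tsums[of J] by (simp add: sums_iff)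
    then show ?thesis
      unfolding d_def using suminf_split_initial_segment[OF sm, of x J] by simp
  qed
  define d' where "d' = (\<lambda>J x. \<Sum>j<J. t j *\<^sub>R X' j x)"
  have o: "open {x. 2 * t J < \<delta> x}" for J
    using \<delta>c by (intro open_Collect_less) auto
  have dd: "(d has_derivative (\<lambda>h. d' J x \<bullet> h)) (at x)" if "2 * t J < \<delta> x" for J x
  proof -
    have "((\<lambda>x. (\<Sum>j<J. t j * X j x) + 2 * t J) has_derivative (\<lambda>h. (\<Sum>j<J. t j * (X' j x \<bullet> h)) + 0)) (at x)"
      by (intro has_derivative_add has_derivative_sum has_derivative_mult_right X has_derivative_const)
    then have "((\<lambda>x. (\<Sum>j<J. t j * X j x) + 2 * t J) has_derivative (\<lambda>h. d' J x \<bullet> h)) (at x)"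
      by (simp add: d'_def inner_sum_left)
    then show ?thesis
      by (rule has_derivative_transform_within_open[OF _ o[of J]]) (use that dJ[OF less_imp_le] in auto)
  qed
  have ex: "\<exists>J. 2 * t J < \<delta> x" if "x \<in> \<Omega>" for x
    proof -
    have "\<delta> x / 2 > 0" using \<delta>pos that by simp
    then obtain J where "t J < \<delta> x / 2"
      using tsmall by blast
    then show ?thesis by (intro exI[of _ J]) simp
  qed
  show ?thesis
  proof (rule that[of d "grad d"])
    show "(d has_derivative (\<lambda>h. grad d x \<bullet> h)) (at x)" if "x \<in> \<Omega>" for x
      using ex[OF that] dd grad_eqI by metis
    show "continuous_on \<Omega> (grad d)"
    proof (rule continuous_at_imp_continuous_on, rule ballI)
      fix x assume "x \<in> \<Omega>"
      then obtain J where J: "2 * t J < \<delta> x" using ex by blast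
      have "continuous_on {x. 2 * t J < \<delta> x} (d' J)"
        unfolding d'_def by (intro continuous_intros continuous_on_subset[OF X(2)]) auto
      then have "continuous_on {x. 2 * t J < \<delta> x} (grad d)"
        by (rule continuous_on_eq) (use grad_eqI[OF dd] in auto)
      then show "isCont (grad d) x"
        using J o[of J] by (simp add: continuous_on_eq_continuous_at)
    qed
    show "norm (grad d x) \<le> 4" if x: "x \<in> \<Omega>" for x
    proof -
      obtain J where J: "2 * t J < \<delta> x" using ex x by blast
      \<comment> \<open>A gradient can be nonzero only for
        \<open>t j \<le> \<delta> x \<le> 2 * t j\<close>. This leaves \<open>j = i\<close>, and
        \<open>j = Suc i\<close> in the borderline case \<open>\<delta> x = t i\<close>.\<close>
      define i where "i = (LEAST j. t j \<le> \<delta> x)"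
      have i: "t i \<le> \<delta> x" "\<And>j. t j \<le> \<delta> x \<Longrightarrow> i \<le> j"
        unfolding i_def using J t[of J] by (auto intro: LeastI[of _ J] Least_le)
      have "norm (grad d x) = norm (d' J x)"
        using grad_eqI[OF dd[OF J]] by simp
      also have "\<dots> \<le> (\<Sum>j<J. norm (t j *\<^sub>R X' j x))"
        unfolding d'_def by (rule norm_sum)
      also have "\<dots> \<le> (\<Sum>j<J. if j \<in> {i, Suc i} then 2 else 0)"
      proof (rule sum_mono)
        fix j
        show "norm (t j *\<^sub>R X' j x) \<le> (if j \<in> {i, Suc i} then 2 else 0)"
        proof (cases "j \<in> {i, Suc i}")
          case True
          have "t j * norm (X' j x) \<le> t j * (2 / t j)"
            using t[of j] X(7) by (intro mult_left_mono) auto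
          then show ?thesis using True t[of j] by (simp add: abs_of_pos)
        next
          case False
          have "\<delta> x < t j \<or> 2 * t j < \<delta> x"
          proof (rule ccontr)
            assume *: "\<not> ?thesis"
            then have "i \<le> j" using i(2) by simp
            then have "Suc (Suc i) \<le> j" using False by auto
            then have "4 * t j \<le> t i"
              using tmono[of "Suc (Suc i)" j] tSuc[of i] tSuc[of "Suc i"] by linarith
            then show False
              using * i(1) t[of j] t[of i] by linarith
          qed
          then show ?thesis using False X(8) by simp
        qed
      qed
      also have "\<dots> = (\<Sum>j\<in>{..<J} \<inter> {i, Suc i}. 2)"
        by (subst sum.inter_restrict) auto
      also have "\<dots> \<le> (\<Sum>j\<in>{i, Suc i}. 2)"
        by (rule sum_mono2) auto
      finally show ?thesis by simp
    qed
    show "d x \<le> 2 * infdist x (- \<Omega>)" if x: "x \<in> \<Omega>" for x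
    proof -
      \<comment> \<open>The first scale below \<open>\<delta> x\<close>: the coarser cutoffs vanish
        at \<open>x\<close>, and the others contribute at most the geometric tail
        \<open>2 * t J\<close>.\<close>
      define J where "J = (LEAST j. t j < \<delta> x)"
      have J: "t J < \<delta> x" "\<And>j. j < J \<Longrightarrow> \<delta> x \<le> t j"
        unfolding J_def using tsmall[OF \<delta>pos[OF x]] not_less_Least by (auto intro: LeastI_ex simp: not_less[symmetric])
      have "d x = (\<Sum>j. t (j + J) * X (j + J) x) + (\<Sum>j<J. t j * X j x)"
        unfolding d_def by (rule suminf_split_initial_segment[OF sm])
      also have "(\<Sum>j<J. t j * X j x) = 0"
        using J(2) X(5) by (intro sum.neutral) auto
      also have "(\<Sum>j. t (j + J) * X (j + J) x) \<le> (\<Sum>j. t (j + J))"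
      proof (rule suminf_le)
        show "t (n + J) * X (n + J) x \<le> t (n + J)" for n
          using X(4) t[of "n + J"] by (simp add: mult_left_le)
        show "summable (\<lambda>j. t (j + J) * X (j + J) x)"
          using sm by (rule summable_ignore_initial_segment)
      qed (use tsums in \<open>simp add: sums_iff\<close>)
      also have "\<dots> = 2 * t J"
        using tsums by (simp add: sums_iff)
      finally show ?thesis using J(1) by (simp add: \<delta>_def)
    qed
    show "infdist x (- \<Omega>) / 4 \<le> d x" if x: "x \<in> \<Omega>" "infdist x (- \<Omega>) \<le> 1" for x
    proof -
      \<comment> \<open>The first scale from which on all cutoffs are 1 at \<open>x\<close>, so the
        full tail \<open>2 * t J\<close> is present. Minimality bounds \<open>\<delta> x\<close> by
        \<open>4 * t J\<close>; the predecessor of \<open>J\<close> exists because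
        \<open>\<delta> x \<le> 1 < 2 * t 0\<close>.\<close>
      define J where "J = (LEAST j. 2 * t j \<le> \<delta> x)"
      have "\<exists>j. 2 * t j \<le> \<delta> x"
        using ex[OF x(1)] less_imp_le by blast
      then have J: "2 * t J \<le> \<delta> x" "\<And>j. j < J \<Longrightarrow> \<delta> x < 2 * t j"
        unfolding J_def by (rule LeastI_ex) (use not_less_Least in \<open>force simp: not_le[symmetric]\<close>)
      have "J \<noteq> 0"
        using J(1) x by (auto simp: t_def \<delta>_def intro!: Nat.gr0I)
      then obtain i where i: "J = Suc i" using not0_implies_Suc by blast
      then have "\<delta> x \<le> 4 * t J"
        using J(2)[of i] tSuc[of i] by simp
      moreover have "2 * t J \<le> d x"
        unfolding dJ[OF J(1)] using X(3) t by (simp add: sum_nonneg less_imp_le)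
      ultimately show ?thesis using t[of J] by (simp add: \<delta>_def)
    qed
  qed
qed

section \<open>Averaging along affine maps\<close>

text \<open>\<open>H x\<close> is \<open>w (x, y)\<close> after the substitution
  \<open>z = a x + b x *\<^sub>R y\<close> at fixed \<open>x\<close>, whose Jacobian is a power of
  \<open>b x\<close>; from the dependence on \<open>x\<close> only measurability is asked. Each
  slice \<open>H x\<close> has L^1 norm at most \<open>m x\<close>, so \<open>H\<close> is
  integrable on the product by Tonelli, and the rest is Fubini.\<close>

lemma affine_kernel_operator:
  fixes a :: "'a::euclidean_space \<Rightarrow> 'a" and b m :: "'a \<Rightarrow> real" and w :: "'a \<times> 'a \<Rightarrow> 'a"
  assumes [measurable]: "a \<in> borel_measurable borel" "b \<in> borel_measurable borel"
      "w \<in> borel_measurable (borel \<Otimes>\<^sub>M borel)"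
    and b: "\<And>x. b x > 0"
    and w: "\<And>x y. norm (w (x, y)) \<le> indicator (cbox 0 One) y * m x"
    and m: "integrable lborel m"
  defines "H \<equiv> \<lambda>x z. (1 / b x) ^ DIM('a) *\<^sub>R w (x, (z - a x) /\<^sub>R b x)"
  shows "AE z in lborel. integrable lborel (\<lambda>x. H x z)"
    and "integrable lborel (\<lambda>z. LINT x|lborel. H x z)"
    and "(LINT z|lborel. norm (LINT x|lborel. H x z)) \<le> (LINT x|lborel. m x)"
    and "\<And>F C. F \<in> borel_measurable borel \<Longrightarrow> (\<And>z. norm (F z) \<le> C) \<Longrightarrow>
      (LINT z|lborel. (LINT x|lborel. H x z) \<bullet> F z) =
      (LINT x|lborel. LINT y|lborel. w (x, y) \<bullet> F (a x + b x *\<^sub>R y))"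
proof -
  have vol: "emeasure lborel (cbox 0 One :: 'a set) = 1"
    by (subst emeasure_lborel_cbox) auto
  have m0: "0 \<le> m x" for x
    using order_trans[OF norm_ge_zero w[of x 0]] by (simp add: mem_box)
  have [measurable]: "m \<in> borel_measurable borel"
    using m by simp
  have Hm[measurable]: "case_prod H \<in> borel_measurable (lborel \<Otimes>\<^sub>M lborel)"
    unfolding H_def split_beta' by measurable
  have Hm2[measurable]: "H x \<in> borel_measurable borel" for x
    unfolding H_def by measurable
  have Hab: "\<bar>b x\<bar> ^ DIM('a) *\<^sub>R H x (a x + b x *\<^sub>R y) = w (x, y)" for x y
    using b[of x] by (simp add: H_def power_one_over)
  have wint: "integrable lborel (\<lambda>y. w (x, y))" for x
  proof (rule Bochner_Integration.integrable_bound)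
    show "integrable lborel (\<lambda>y::'a. indicator (cbox 0 One) y * m x)"
      using vol by (intro integrable_mult_left) (auto intro!: integrable_real_indicator)
    show "AE y in lborel. norm (w (x, y)) \<le> norm (indicator (cbox 0 One) y * m x)"
      using w by (auto intro: order_trans[OF _ abs_ge_self])
  qed measurable
  have ind: "(LINT y|lborel. indicator (cbox 0 One) (y::'a) * m x) = m x" for x
    using vol by (simp add: measure_def)
  have Hx: "(\<integral>\<^sup>+z. norm (H x z) \<partial>lborel) \<le> ennreal (m x)" for x
  proof -
    have "(\<integral>\<^sup>+z. norm (H x z) \<partial>lborel) = ennreal (\<bar>b x\<bar> ^ DIM('a)) * (\<integral>\<^sup>+y. norm (H x (a x + b x *\<^sub>R y)) \<partial>lborel)"
      using b[of x] by (intro nn_integral_lborel_affine) auto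
    also have "\<dots> = (\<integral>\<^sup>+y. ennreal (\<bar>b x\<bar> ^ DIM('a)) * norm (H x (a x + b x *\<^sub>R y)) \<partial>lborel)"
      by (rule nn_integral_cmult[symmetric]) measurable
    also have "\<dots> = (\<integral>\<^sup>+y. norm (w (x, y)) \<partial>lborel)"
      unfolding Hab[symmetric] by (intro nn_integral_cong) (simp add: ennreal_mult)
    also have "\<dots> \<le> (\<integral>\<^sup>+y. ennreal (m x) * indicator (cbox 0 (One :: 'a)) y \<partial>lborel)"
    proof (intro nn_integral_mono)
      fix y
      have "ennreal (norm (w (x, y))) \<le> ennreal (indicator (cbox 0 One) y * m x)"
        by (intro ennreal_leI w)
      then show "ennreal (norm (w (x, y))) \<le> ennreal (m x) * indicator (cbox 0 One) y"
        by (auto simp: indicator_def split: if_splits)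
    qed
    also have "\<dots> = ennreal (m x)"
      using vol by (subst nn_integral_cmult_indicator) auto
    finally show ?thesis .
  qed
  have Hint: "integrable (lborel \<Otimes>\<^sub>M lborel) (case_prod H)"
  proof (rule integrableI_bounded[OF Hm])
    have "(\<integral>\<^sup>+p. norm (case_prod H p) \<partial>(lborel \<Otimes>\<^sub>M lborel)) = (\<integral>\<^sup>+x. \<integral>\<^sup>+z. norm (H x z) \<partial>lborel \<partial>lborel)"
      by (subst lborel.nn_integral_fst[symmetric]) auto
    also have "\<dots> \<le> (\<integral>\<^sup>+x. ennreal (m x) \<partial>lborel)"
      by (intro nn_integral_mono Hx)
    also have "\<dots> < \<infinity>"
      using m m0 by (simp add: nn_integral_eq_integral)
    finally show "(\<integral>\<^sup>+p. norm (case_prod H p) \<partial>(lborel \<Otimes>\<^sub>M lborel)) < \<infinity>" .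
  qed
  show AE: "AE z in lborel. integrable lborel (\<lambda>x. H x z)"
    by (rule lborel_pair.AE_integrable_snd[OF Hint])
  show int: "integrable lborel (\<lambda>z. LINT x|lborel. H x z)"
    by (rule lborel_pair.integrable_snd[OF Hint])
  have Nint: "integrable (lborel \<Otimes>\<^sub>M lborel) (\<lambda>(x, z). norm (H x z))"
    using integrable_norm[OF Hint] by (simp add: split_beta')
  have Hxz: "(LINT z|lborel. norm (H x z)) \<le> m x" for x
  proof -
    have "(LINT z|lborel. norm (H x z)) = (LINT y|lborel. norm (w (x, y)))"
      using b[of x]
      by (subst lborel_integral_affine[of "b x" _ "a x"])
         (simp_all add: Hab[symmetric] flip: integral_mult_right_zero)
    also have "\<dots> \<le> (LINT y|lborel. indicator (cbox 0 One) (y::'a) * m x)"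
    proof (rule integral_mono[OF _ _ w])
      show "integrable lborel (\<lambda>y::'a. indicator (cbox 0 One) y * m x)"
        using vol by (intro integrable_mult_left) (auto intro!: integrable_real_indicator)
    qed (use wint in auto)
    finally show ?thesis using ind by simp
  qed
  have "(LINT z|lborel. norm (LINT x|lborel. H x z)) \<le> (LINT z|lborel. LINT x|lborel. norm (H x z))"
    using lborel_pair.integrable_snd[OF Nint] int
    by (intro integral_mono) auto
  also have "\<dots> = (LINT x|lborel. LINT z|lborel. norm (H x z))"
    by (rule lborel_pair.Fubini_integral[OF Nint])
  also have "\<dots> \<le> (LINT x|lborel. m x)"
    using lborel_pair.integrable_fst[OF Nint] by (intro integral_mono m Hxz) auto
  finally show "(LINT z|lborel. norm (LINT x|lborel. H x z)) \<le> (LINT x|lborel. m x)" .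
  fix F :: "'a \<Rightarrow> 'a" and C
  assume [measurable]: "F \<in> borel_measurable borel" and C: "\<And>z. norm (F z) \<le> C"
  have Fint: "integrable (lborel \<Otimes>\<^sub>M lborel) (\<lambda>(x, z). H x z \<bullet> F z)"
  proof -
    have "integrable (lborel \<Otimes>\<^sub>M lborel) (\<lambda>p. case_prod H p \<bullet> F (snd p))"
      by (rule integrable_inner_bounded[OF Hint _ C]) measurable
    then show ?thesis by (simp add: split_beta')
  qed
  have [measurable]: "(\<lambda>z. LINT x|lborel. H x z) \<in> borel_measurable borel"
    using borel_measurable_integrable[OF int] by simp
  \<comment> \<open>The inner product moves under the integral only where
    \<open>x \<mapsto> H x z\<close> is integrable, that is, for almost every
    \<open>z\<close>.\<close>
  have "(LINT z|lborel. (LINT x|lborel. H x z) \<bullet> F z) = (LINT z|lborel. LINT x|lborel. H x z \<bullet> F z)"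
  proof (rule integral_cong_AE)
    show "(\<lambda>z. LINT x|lborel. H x z \<bullet> F z) \<in> borel_measurable lborel"
      using borel_measurable_integrable[OF lborel_pair.integrable_snd[OF Fint]] by simp
    show "AE z in lborel. (LINT x|lborel. H x z) \<bullet> F z = (LINT x|lborel. H x z \<bullet> F z)"
      using AE by eventually_elim (rule integral_inner_left[symmetric], simp)
  qed measurable
  also have "\<dots> = (LINT x|lborel. LINT z|lborel. H x z \<bullet> F z)"
    by (rule lborel_pair.Fubini_integral[OF Fint])
  also have "\<dots> = (LINT x|lborel. LINT y|lborel. w (x, y) \<bullet> F (a x + b x *\<^sub>R y))"
  proof (rule Bochner_Integration.integral_cong[OF refl])
    fix x
    show "(LINT z|lborel. H x z \<bullet> F z) = (LINT y|lborel. w (x, y) \<bullet> F (a x + b x *\<^sub>R y))"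
      using b[of x]
      by (subst lborel_integral_affine[of "b x" _ "a x"])
         (simp_all add: Hab[symmetric] flip: integral_mult_right_zero)
  qed
  finally show "(LINT z|lborel. (LINT x|lborel. H x z) \<bullet> F z) =
      (LINT x|lborel. LINT y|lborel. w (x, y) \<bullet> F (a x + b x *\<^sub>R y))" .
qed

section \<open>Borel representatives, averages over the cube and their adjoint\<close>

lemma integrable_lebesgue_borel_representative:
  fixes u :: "'a::euclidean_space \<Rightarrow> 'b::euclidean_space"
  assumes "integrable lebesgue u"
  obtains v where "integrable lborel v" "AE x in lebesgue. u x = v x"
proof -
  have u: "u \<in> borel_measurable lebesgue" using assms by simp
  have "\<exists>g\<in>borel_measurable lborel. (AE x in lborel. u x \<bullet> b = g x)" for b
    by (rule completion_ex_borel_measurable_real) (use u in measurable)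
  then obtain g where g: "\<And>b. g b \<in> borel_measurable lborel" "\<And>b. AE x in lborel. u x \<bullet> b = g b x"
    by metis
  define v where "v = (\<lambda>x. \<Sum>b\<in>Basis. g b x *\<^sub>R b)"
  have [measurable]: "v \<in> borel_measurable lborel"
    unfolding v_def using g(1) by measurable
  have "AE x in lborel. \<forall>b\<in>Basis. u x \<bullet> b = g b x"
    by (rule AE_finite_allI) (use g in auto)
  then have "AE x in lborel. u x = v x"
  proof eventually_elim
    case (elim x)
    have "v x = (\<Sum>b\<in>Basis. (u x \<bullet> b) *\<^sub>R b)"
      unfolding v_def using elim by (intro sum.cong) auto
    then show ?case by (simp add: euclidean_representation)
  qed
  then have AE: "AE x in lebesgue. u x = v x"
    by (rule AE_completion)
  have "integrable lebesgue v"
    by (rule integrable_cong_AE_imp[OF assms]) (use AE in \<open>auto intro: measurable_completion\<close>)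
  then have "integrable lborel v"
    by (simp add: integrable_completion)
  then show ?thesis using that AE by blast
qed

text \<open>The expression bounded by \<open>C\<close> is the derivative in \<open>x\<close> of
  \<open>Y(x, y) = a x + b x *\<^sub>R y\<close>, applied to \<open>h\<close>. The single constant
  governs both the gradients of averages and the L^1 norm of the adjoint.\<close>

locale averaged_map =
  fixes U :: "'a::euclidean_space set" and a :: "'a \<Rightarrow> 'a" and a' :: "'a \<Rightarrow> 'a \<Rightarrow> 'a"
    and b :: "'a \<Rightarrow> real" and b' :: "'a \<Rightarrow> 'a" and C :: real
  assumes U: "open U"
    and a: "\<And>x. x \<in> U \<Longrightarrow> (a has_derivative a' x) (at x)" "\<And>h. continuous_on U (\<lambda>x. a' x h)"
    and b: "\<And>x. x \<in> U \<Longrightarrow> (b has_derivative (\<lambda>h. b' x \<bullet> h)) (at x)" "continuous_on U b'"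
    and bpos: "\<And>x. x \<in> U \<Longrightarrow> b x > 0"
    and C: "0 \<le> C" "\<And>x y h. x \<in> U \<Longrightarrow> y \<in> cbox 0 One \<Longrightarrow> norm (a' x h + (b' x \<bullet> h) *\<^sub>R y) \<le> C * norm h"
begin

text \<open>The adjoint of \<open>F \<mapsto> (x \<mapsto> \<integral>\<^sub>Q DY(x, y)\<^sup>T F(Y(x, y)) dy)\<close> for \<open>Y(x, y) = a x + b x y\<close>, obtained by
  substituting \<open>z = Y(x, y)\<close> for \<open>y\<close>. The fields \<open>v\<close> are Borel measurable, as Fubini's theorem is
  applied to the kernel on \<open>borel \<Otimes>\<^sub>M borel\<close>.\<close>

definition smear :: "('a \<Rightarrow> 'a) \<Rightarrow> 'a \<Rightarrow> 'a" where
  "smear v z = (LINT x|lborel. indicator U x *\<^sub>R (1 / b x) ^ DIM('a) *\<^sub>R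
     indicator (cbox 0 One) ((z - a x) /\<^sub>R b x) *\<^sub>R (a' x (v x) + (b' x \<bullet> v x) *\<^sub>R ((z - a x) /\<^sub>R b x)))"

text \<open>Borel data on the whole space for the kernel calculus: outside \<open>U\<close>, where
  nothing is assumed, the shift is 0 and the scale is 1, so that the scale is positive
  everywhere.\<close>

definition a0 where "a0 x = indicator U x *\<^sub>R a x"
definition b0 where "b0 x = indicator U x *\<^sub>R b x + (1 - indicator U x)"
text \<open>The derivative of \<open>Y\<close> in the direction \<open>v x\<close> is expanded in
  the basis because \<open>a' x h\<close> is known to be continuous in \<open>x\<close> only for
  fixed \<open>h\<close>; measurability then follows coordinate by coordinate.\<close>

definition w where "w v p = indicator (cbox 0 One) (snd p) *\<^sub>R
  ((\<Sum>i\<in>Basis. (v (fst p) \<bullet> i) *\<^sub>R indicator U (fst p) *\<^sub>R a' (fst p) i)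
    + ((indicator U (fst p) *\<^sub>R b' (fst p)) \<bullet> v (fst p)) *\<^sub>R snd p)"
definition H where "H v x z = (1 / b0 x) ^ DIM('a) *\<^sub>R w v (x, (z - a0 x) /\<^sub>R b0 x)"

lemma continuous_ab: "continuous_on U a" "continuous_on U b"
  using a(1) b(1) by (meson continuous_at_imp_continuous_on has_derivative_continuous)+

lemma a'_sum: "x \<in> U \<Longrightarrow> a' x h = (\<Sum>i\<in>Basis. (h \<bullet> i) *\<^sub>R a' x i)"
  using has_derivative_linear[OF a(1), of x]
  by (subst euclidean_representation[of h, symmetric]) (simp add: linear_sum linear_scale)

lemma smear_eq: "smear v z = (LINT x|lborel. H v x z)"
  unfolding smear_def
  by (intro Bochner_Integration.integral_cong refl)
     (auto simp: H_def a0_def b0_def w_def indicator_def a'_sum[symmetric])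

lemma w_measurable [measurable]:
  assumes [measurable]: "v \<in> borel_measurable borel"
  shows "w v \<in> borel_measurable (borel \<Otimes>\<^sub>M borel)"
proof -
  have [measurable]: "(\<lambda>x. indicator U x *\<^sub>R a' x i) \<in> borel_measurable borel" for i
    by (rule borel_measurable_continuous_on_indicator) (use U a in auto)
  have [measurable]: "(\<lambda>x. indicator U x *\<^sub>R b' x) \<in> borel_measurable borel"
    by (rule borel_measurable_continuous_on_indicator) (use U b in auto)
  show ?thesis
    unfolding w_def by measurable
qed

lemma a0_measurable [measurable]: "a0 \<in> borel_measurable borel"
  unfolding a0_def using U continuous_ab
  by (intro borel_measurable_continuous_on_indicator) auto

lemma b0_measurable [measurable]: "b0 \<in> borel_measurable borel"
proof -
  have "(\<lambda>x. indicator U x *\<^sub>R b x) \<in> borel_measurable borel"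
    using U continuous_ab by (intro borel_measurable_continuous_on_indicator) auto
  then show ?thesis
    unfolding b0_def using U by (intro borel_measurable_add borel_measurable_diff) auto
qed

lemma w_eq: "w v (x, y) = indicator (cbox 0 One) y *\<^sub>R indicator U x *\<^sub>R (a' x (v x) + (b' x \<bullet> v x) *\<^sub>R y)"
  by (auto simp: w_def a'_sum[symmetric] indicator_def)

lemma w_bound: "norm (w v (x, y)) \<le> indicator (cbox 0 One) y * (C * norm (v x))"
  using C by (auto simp: w_eq indicator_def)

lemma smear_properties:
  assumes v: "integrable lborel v"
  shows smear_AE_integrable: "AE z in lborel. integrable lborel (\<lambda>x. H v x z)"
    and smear_integrable: "integrable lborel (smear v)"
    and smear_norm: "(LINT z|lborel. norm (smear v z)) \<le> C * (LINT x|lborel. norm (v x))"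
    and smear_inner: "\<And>F B. F \<in> borel_measurable borel \<Longrightarrow> (\<And>z. norm (F z) \<le> B) \<Longrightarrow>
      (LINT z|lborel. smear v z \<bullet> F z) =
      (LINT x|lborel. LINT y|lborel. w v (x, y) \<bullet> F (a0 x + b0 x *\<^sub>R y))"
proof -
  have [measurable]: "v \<in> borel_measurable borel"
    using v by simp
  have b0: "b0 x > 0" for x
    using bpos by (auto simp: b0_def indicator_def)
  have m: "integrable lborel (\<lambda>x. C * norm (v x))"
    using v by simp
  have sm: "smear v = (\<lambda>z. LINT x|lborel. H v x z)"
    by (simp add: smear_eq fun_eq_iff)
  note * = affine_kernel_operator[OF a0_measurable b0_measurable w_measurable b0 w_bound m, folded H_def, folded sm]
  show "AE z in lborel. integrable lborel (\<lambda>x. H v x z)" "integrable lborel (smear v)"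
    by (rule *(1), measurable) (rule *(2), measurable)
  show "(LINT z|lborel. norm (smear v z)) \<le> C * (LINT x|lborel. norm (v x))"
    using *(3) by (simp add: smear_eq)
  show "(LINT z|lborel. smear v z \<bullet> F z) =
      (LINT x|lborel. LINT y|lborel. w v (x, y) \<bullet> F (a0 x + b0 x *\<^sub>R y))"
    if "F \<in> borel_measurable borel" "\<And>z. norm (F z) \<le> B" for F B
    unfolding smear_eq by (rule *(4)[OF _ that]) measurable
qed

text \<open>The field enters only under an integral over \<open>x\<close>, so a change on a null set
  leaves every value unaltered, not merely almost every one.\<close>

lemma smear_cong_AE:
  assumes [measurable]: "v \<in> borel_measurable borel" "v' \<in> borel_measurable borel"
    and "AE x in lborel. v x = v' x"
  shows "smear v z = smear v' z"
  unfolding smear_eq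
proof (rule integral_cong_AE)
  show "AE x in lborel. H v x z = H v' x z"
    using assms(3) by eventually_elim (simp add: H_def w_eq)
qed (unfold H_def, measurable)

text \<open>Splitting the integral requires both parts to converge, which is known for almost every
  \<open>z\<close>.\<close>

lemma smear_linear:
  assumes v: "integrable lborel v" "integrable lborel v'"
  shows "AE z in lborel. smear (\<lambda>x. \<alpha> *\<^sub>R v x + \<beta> *\<^sub>R v' x) z = \<alpha> *\<^sub>R smear v z + \<beta> *\<^sub>R smear v' z"
  using smear_AE_integrable[OF v(1)] smear_AE_integrable[OF v(2)]
proof eventually_elim
  case (elim z)
  have "H (\<lambda>x. \<alpha> *\<^sub>R v x + \<beta> *\<^sub>R v' x) x z = \<alpha> *\<^sub>R H v x z + \<beta> *\<^sub>R H v' x z" for x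
  proof (cases "x \<in> U")
    case True
    have "linear (a' x)"
      using has_derivative_linear[OF a(1)[OF True]] .
    then show ?thesis
      by (simp add: H_def w_eq linear_add linear_scale inner_add_right algebra_simps)
  qed (simp add: H_def w_eq)
  then show ?case
    unfolding smear_eq using elim by simp
qed

lemma smear_eq_0:
  assumes "\<And>x y. x \<in> U \<Longrightarrow> y \<in> cbox 0 One \<Longrightarrow> a x + b x *\<^sub>R y \<noteq> z"
  shows "smear v z = 0"
proof -
  have "H v x z = 0" for x
  proof (cases "x \<in> U \<and> (z - a x) /\<^sub>R b x \<in> cbox 0 One")
    case True
    then have "a x + b x *\<^sub>R ((z - a x) /\<^sub>R b x) \<noteq> z"
      using assms by blast
    then show ?thesis
      using bpos[of x] True by simp
  qed (auto simp: H_def w_eq a0_def b0_def indicator_def)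
  then show ?thesis by (simp add: smear_eq)
qed

text \<open>The transpose of the \<open>x\<close>-derivative of \<open>Y\<close>, applied to
  \<open>g\<close> at \<open>Y(x, y)\<close> and averaged over \<open>y\<close>; the transpose is
  written out in coordinates. If \<open>g\<close> is the gradient of \<open>\<phi>\<close>, the
  chain rule makes this the gradient of the average of \<open>\<phi>\<close>.\<close>

definition avg_grad where
  "avg_grad g x = integral (cbox 0 One) (\<lambda>y. \<Sum>i\<in>Basis. (g (a x + b x *\<^sub>R y) \<bullet> (a' x i + (b' x \<bullet> i) *\<^sub>R y)) *\<^sub>R i)"

context
  fixes \<phi> :: "'a \<Rightarrow> real" and g :: "'a \<Rightarrow> 'a" and B :: real
  assumes \<phi>: "\<And>x. (\<phi> has_derivative (\<lambda>h. g x \<bullet> h)) (at x)"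
    and g: "continuous_on UNIV g" "\<And>x. norm (g x) \<le> B"
begin

definition G where
  "G x y = (\<Sum>i\<in>Basis. (g (a x + b x *\<^sub>R y) \<bullet> (a' x i + (b' x \<bullet> i) *\<^sub>R y)) *\<^sub>R i)"

lemma G_inner:
  assumes "x \<in> U"
  shows "G x y \<bullet> h = g (a x + b x *\<^sub>R y) \<bullet> (a' x h + (b' x \<bullet> h) *\<^sub>R y)"
proof -
  have "a' x h + (b' x \<bullet> h) *\<^sub>R y = (\<Sum>i\<in>Basis. (h \<bullet> i) *\<^sub>R (a' x i + (b' x \<bullet> i) *\<^sub>R y))"
    by (subst a'_sum[OF assms], subst (2) euclidean_representation[of h, symmetric])
       (simp add: inner_sum_right scaleR_sum_left scaleR_add_right sum.distrib)
  then show ?thesis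
    by (simp add: G_def inner_sum_right inner_sum_left inner_commute mult.commute)
qed

lemma G_continuous: "continuous_on (U \<times> cbox 0 One) (\<lambda>(x, y). G x y)"
  unfolding G_def split_beta'
  by (intro continuous_intros continuous_on_compose2[OF g(1)] continuous_on_compose2[OF continuous_ab(1)]
      continuous_on_compose2[OF continuous_ab(2)] continuous_on_compose2[OF a(2)] continuous_on_compose2[OF b(2)]; auto)

lemma G_continuous': "x \<in> U \<Longrightarrow> continuous_on (cbox 0 One) (G x)"
  using continuous_on_compose2[OF G_continuous, of "cbox 0 One" "\<lambda>t. (x, t)"]
  by (simp add: continuous_on_Pair image_subset_iff)

lemma avg_grad_eq: "avg_grad g x = integral (cbox 0 One) (G x)"
  by (simp add: avg_grad_def G_def[abs_def])

lemma average_has_derivative: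
  assumes "x \<in> U"
  shows "((\<lambda>x. integral (cbox 0 One) (\<lambda>y. \<phi> (a x + b x *\<^sub>R y))) has_derivative (\<lambda>h. avg_grad g x \<bullet> h)) (at x)"
  unfolding avg_grad_eq
proof (rule has_derivative_integral_cbox[OF U _ _ G_continuous assms])
  fix x y assume x: "x \<in> U"
  have "((\<lambda>x. a x + b x *\<^sub>R y) has_derivative (\<lambda>h. a' x h + (b' x \<bullet> h) *\<^sub>R y)) (at x)"
    by (intro has_derivative_add has_derivative_scaleR_left a b x)
  from has_derivative_compose[OF this \<phi>]
  show "((\<lambda>x. \<phi> (a x + b x *\<^sub>R y)) has_derivative (\<lambda>h. G x y \<bullet> h)) (at x)"
    by (simp add: G_inner[OF x])
next
  fix x assume x: "x \<in> U"
  have c: "continuous_on UNIV \<phi>"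
    using \<phi> by (meson continuous_at_imp_continuous_on has_derivative_continuous)
  show "(\<lambda>y. \<phi> (a x + b x *\<^sub>R y)) integrable_on cbox 0 One"
    by (intro integrable_continuous continuous_on_compose2[OF c] continuous_intros) auto
qed

lemma avg_grad_continuous: "continuous_on U (avg_grad g)"
  unfolding avg_grad_eq[abs_def] by (rule integral_continuous_on_param[OF G_continuous])

lemma avg_grad_inner:
  assumes "x \<in> U"
  shows "avg_grad g x \<bullet> h = integral (cbox 0 One) (\<lambda>y. g (a x + b x *\<^sub>R y) \<bullet> (a' x h + (b' x \<bullet> h) *\<^sub>R y))"
    and "(\<lambda>y. g (a x + b x *\<^sub>R y) \<bullet> (a' x h + (b' x \<bullet> h) *\<^sub>R y)) integrable_on cbox 0 One"
  using integral_linear[OF integrable_continuous[OF G_continuous'[OF assms]] bounded_linear_inner_left[of h]]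
    integrable_linear[OF integrable_continuous[OF G_continuous'[OF assms]] bounded_linear_inner_left[of h]]
  by (simp_all add: avg_grad_eq o_def G_inner[OF assms])

text \<open>The estimate of the inner product with \<open>h\<close> is applied to \<open>h\<close>
  equal to the averaged gradient itself; the cube has volume 1.\<close>

lemma avg_grad_bound:
  assumes "x \<in> U"
  shows "norm (avg_grad g x) \<le> B * C"
proof -
  have B: "B \<ge> 0" using g(2)[of 0] norm_ge_zero order_trans by blast
  define h where "h = avg_grad g x"
  have "norm (avg_grad g x \<bullet> h) \<le> (B * (C * norm h)) * measure lborel (cbox 0 (One::'a))"
    unfolding avg_grad_inner(1)[OF assms]
  proof (rule integrable_bound[OF _ avg_grad_inner(2)[OF assms]])
    fix y :: 'a assume "y \<in> cbox 0 One"
    then have "norm (g (a x + b x *\<^sub>R y)) * norm (a' x h + (b' x \<bullet> h) *\<^sub>R y) \<le> B * (C * norm h)"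
      using C assms g B by (intro mult_mono) auto
    then show "norm (g (a x + b x *\<^sub>R y) \<bullet> (a' x h + (b' x \<bullet> h) *\<^sub>R y)) \<le> B * (C * norm h)"
      using Cauchy_Schwarz_ineq2 order_trans by (metis real_norm_def)
  qed (use B C in auto)
  then have "norm h * norm h \<le> (B * C) * norm h"
    by (simp add: h_def content_cbox_if dot_square_norm power2_eq_square)
  then show ?thesis
    using B C by (cases "norm h = 0") (auto simp: h_def)
qed

text \<open>This is the adjoint relation for which \<open>smear\<close> is made: the integral over
  \<open>y\<close> pairs \<open>g\<close> at \<open>Y(x, y)\<close> with the derivative of
  \<open>Y\<close> in the direction \<open>v x\<close>, and the transpose moves that derivative onto
  \<open>g\<close>.\<close>

lemma smear_inner_gradient:
  assumes v: "integrable lborel v"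
  shows "(LINT z|lborel. smear v z \<bullet> g z) = (LINT x|lborel. indicator U x *\<^sub>R (v x \<bullet> avg_grad g x))"
proof -
  have "(LINT z|lborel. smear v z \<bullet> g z) = (LINT x|lborel. LINT y|lborel. w v (x, y) \<bullet> g (a0 x + b0 x *\<^sub>R y))"
    by (rule smear_inner[OF v _ g(2)]) (intro borel_measurable_continuous_onI g)
  also have "\<dots> = (LINT x|lborel. indicator U x *\<^sub>R (v x \<bullet> avg_grad g x))"
  proof (rule Bochner_Integration.integral_cong[OF refl])
    fix x
    show "(LINT y|lborel. w v (x, y) \<bullet> g (a0 x + b0 x *\<^sub>R y)) = indicator U x *\<^sub>R (v x \<bullet> avg_grad g x)"
    proof (cases "x \<in> U")
      case True
      define f where "f = (\<lambda>y. g (a x + b x *\<^sub>R y) \<bullet> (a' x (v x) + (b' x \<bullet> v x) *\<^sub>R y))"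
      have "continuous_on (cbox 0 One) f"
        unfolding f_def G_inner[OF True, symmetric] by (intro continuous_intros G_continuous' True)
      then have "set_integrable lborel (cbox 0 One) f"
        unfolding set_integrable_def by (intro borel_integrable_compact) auto
      then have "(LINT y:cbox 0 One|lborel. f y) = integral (cbox 0 One) f"
        by (rule set_borel_integral_eq_integral)
      also have "\<dots> = v x \<bullet> avg_grad g x"
        unfolding inner_commute[of "v x"] avg_grad_inner(1)[OF True] f_def ..
      finally show ?thesis
        using True by (simp add: set_lebesgue_integral_def f_def w_eq a0_def b0_def inner_commute)
    qed (simp add: w_eq)
  qed
  finally show ?thesis .
qed

end

end

section \<open>The extension operator\<close>

lemma measure_unit_cbox: "measure lborel (cbox 0 (One :: 'a::euclidean_space)) = 1"
  by (simp add: content_cbox_if)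

lemma AE_lebesgue_on:
  assumes "S \<in> sets lebesgue" "AE x in lebesgue. P x"
  shows "AE x in lebesgue_on S. P x"
  using assms by (auto simp: AE_restrict_space_iff elim: eventually_mono)

lemma integrable_lebesgue_on:
  fixes f :: "'a::euclidean_space \<Rightarrow> 'b::euclidean_space"
  assumes "S \<in> sets lebesgue" "integrable lebesgue f"
  shows "integrable (lebesgue_on S) f"
  using assms by (simp add: integrable_restrict_space integrable_mult_indicator)

lemma test_fun_gradient:
  assumes "test_fun S \<phi>"
  obtains B where "\<And>x. (\<phi> has_derivative (\<lambda>h. grad \<phi> x \<bullet> h)) (at x)" "continuous_on UNIV (grad \<phi>)"
    "\<And>x. norm (grad \<phi> x) \<le> B" "\<And>x. \<bar>\<phi> x\<bar> \<le> B"
    "\<And>x. x \<notin> S \<Longrightarrow> \<phi> x = 0" "\<And>x. x \<notin> S \<Longrightarrow> grad \<phi> x = 0"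
proof -
  define K where "K = closure {x. \<phi> x \<noteq> 0}"
  have K: "compact K" "K \<subseteq> S"
    using assms by (auto simp: test_fun_def K_def)
  have "Ck_fun (Suc 0) \<phi>"
    using assms unfolding test_fun_def smooth_fun_def by blast
  note d = Ck_fun_has_gradient[OF this] and c = Ck_fun_grad_continuous[OF this] and c\<phi> = Ck_fun_continuous[OF this]
  have \<phi>0: "\<phi> x = 0" if "x \<notin> K" for x
    using that closure_subset[of "{x. \<phi> x \<noteq> 0}"] by (auto simp: K_def)
  have g0: "grad \<phi> x = 0" if "x \<notin> K" for x
  proof -
    have "norm (grad \<phi> x) \<le> 0"
      by (rule norm_gradient_le[OF d, of "- K"])
         (use that \<phi>0 compact_imp_closed[OF K(1)] in \<open>simp_all add: open_Compl\<close>)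
    then show ?thesis by simp
  qed
  have "bounded (grad \<phi> ` K)" "bounded (\<phi> ` K)"
    by (intro compact_imp_bounded compact_continuous_image continuous_on_subset[OF c] continuous_on_subset[OF c\<phi>] K subset_UNIV)+
  then obtain B1 B2 where B12: "\<forall>y\<in>grad \<phi> ` K. norm y \<le> B1" "\<forall>y\<in>\<phi> ` K. norm y \<le> B2"
    unfolding bounded_iff by blast
  define B where "B = \<bar>B1\<bar> + \<bar>B2\<bar>"
  have B: "norm (grad \<phi> x) \<le> B" "\<bar>\<phi> x\<bar> \<le> B" for x
  proof -
    have "norm (grad \<phi> x) \<le> B \<and> \<bar>\<phi> x\<bar> \<le> B"
    proof (cases "x \<in> K")
      case True
      then have "norm (grad \<phi> x) \<le> B1" "\<bar>\<phi> x\<bar> \<le> B2"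
        using B12 by auto
      then show ?thesis unfolding B_def by linarith
    qed (simp add: g0 \<phi>0 B_def)
    then show "norm (grad \<phi> x) \<le> B" "\<bar>\<phi> x\<bar> \<le> B" by auto
  qed
  show ?thesis
  proof (rule that[OF d c B])
    show "\<phi> x = 0" "grad \<phi> x = 0" if "x \<notin> S" for x
      using g0 \<phi>0 K(2) that by blast+
  qed
qed

lemma lipschitz_gradient_bound:
  fixes \<phi> :: "'a::euclidean_space \<Rightarrow> real"
  assumes "\<And>x. (\<phi> has_derivative (\<lambda>h. g x \<bullet> h)) (at x)" "\<And>x. norm (g x) \<le> B"
  shows "\<bar>\<phi> x - \<phi> y\<bar> \<le> B * norm (x - y)"
proof -
  have "norm (\<phi> x - \<phi> y) \<le> B * norm (x - y)"
  proof (rule differentiable_bound[of UNIV])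
    show "onorm (\<lambda>h. g z \<bullet> h) \<le> B" for z
    proof (rule onorm_le)
      show "norm (g z \<bullet> h) \<le> B * norm h" for h
        using Cauchy_Schwarz_ineq2[of "g z" h] mult_right_mono[OF assms(2)[of z] norm_ge_zero[of h]] by simp
    qed
  qed (use assms in auto)
  then show ?thesis by simp
qed

text \<open>The given fields are Lebesgue measurable, the kernel calculus asks for Borel ones. The
  choice is additive and compatible with almost everywhere equality only up to null sets, and those
  are invisible to \<open>smear\<close>.\<close>

definition borel_rep :: "('a::euclidean_space \<Rightarrow> 'b::euclidean_space) \<Rightarrow> 'a \<Rightarrow> 'b" where
  "borel_rep u = (SOME v. integrable lborel v \<and> (AE x in lebesgue. u x = v x))"

lemma borel_rep:
  assumes "integrable lebesgue u"
  shows "integrable lborel (borel_rep u)" "AE x in lebesgue. u x = borel_rep u x"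
proof -
  have "\<exists>v. integrable lborel v \<and> (AE x in lebesgue. u x = v x)"
    using integrable_lebesgue_borel_representative[OF assms] by blast
  from someI_ex[OF this] show "integrable lborel (borel_rep u)" "AE x in lebesgue. u x = borel_rep u x"
    by (simp_all add: borel_rep_def)
qed

text \<open>The strip \<open>U\<close> of width \<open>r\<close> is thrown across the boundary. The
  condition \<open>far\<close> has two uses: the images keep away from \<open>\<Omega>\<close>, and
  the average of a function supported in the \<open>r / 2\<close>-neighbourhood vanishes before the
  strip ends. The condition \<open>near\<close> makes the average agree with the function up to a
  multiple of the boundary distance.\<close>

locale boundary_reflection = averaged_map U a a' b b' C
  for U :: "'a::euclidean_space set" and a a' b b' C +
  fixes \<Omega> :: "'a set" and r M :: real
  assumes \<Omega>: "open \<Omega>" "bounded \<Omega>" and r: "0 < r" and M: "0 \<le> M"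
    and U_eq: "U = {x \<in> \<Omega>. infdist x (- \<Omega>) < r}"
    and far: "\<And>x y. x \<in> U \<Longrightarrow> y \<in> cbox 0 One \<Longrightarrow> infdist x (- \<Omega>) \<le> infdist (a x + b x *\<^sub>R y) \<Omega>"
    and near: "\<And>x y. x \<in> U \<Longrightarrow> y \<in> cbox 0 One \<Longrightarrow> norm (x - (a x + b x *\<^sub>R y)) \<le> M * infdist x (- \<Omega>)"
begin

definition ext0 :: "('a \<Rightarrow> 'a) \<Rightarrow> 'a \<Rightarrow> 'a" where
  "ext0 u x = indicator \<Omega> x *\<^sub>R u x"

text \<open>The minus sign is that of \<open>\<phi> - A \<phi>\<close>. The second term compensates
  the divergence that the extension by zero may create on the boundary.\<close>

definition ext :: "('a \<Rightarrow> 'a) \<Rightarrow> 'a \<Rightarrow> 'a" where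
  "ext u z = ext0 u z - smear (borel_rep (ext0 u)) z"

lemma infdist_pos: "x \<in> \<Omega> \<Longrightarrow> infdist x (- \<Omega>) > 0"
proof -
  assume "x \<in> \<Omega>"
  have "\<Omega> \<noteq> UNIV"
    using \<Omega> not_bounded_UNIV by blast
  then show ?thesis
    using \<open>x \<in> \<Omega>\<close> \<Omega> by (intro infdist_pos_not_in_closed) auto
qed

lemma open_nbhd: "open (nbhd \<Omega> e)"
  unfolding nbhd_def by (intro open_Collect_less continuous_intros)

lemma ext0_integrable: "integrable (lebesgue_on \<Omega>) u \<Longrightarrow> integrable lebesgue (ext0 u)"
  using \<Omega> by (simp add: integrable_restrict_space ext0_def[abs_def])

lemma ext0_integral:
  fixes f :: "'a \<Rightarrow> 'b::euclidean_space"
  shows "integral\<^sup>L (lebesgue_on \<Omega>) f = (LINT x|lebesgue. indicator \<Omega> x *\<^sub>R f x)"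
  using \<Omega> by (simp add: integral_restrict_space)

lemma borel_rep_norm:
  assumes "integrable (lebesgue_on \<Omega>) u"
  shows "(LINT x|lborel. norm (borel_rep (ext0 u) x)) = (LINT x|lebesgue_on \<Omega>. norm (u x))"
proof -
  note v = borel_rep[OF ext0_integrable[OF assms]]
  have [measurable]: "borel_rep (ext0 u) \<in> borel_measurable lborel"
    using v(1) by simp
  have [measurable]: "ext0 u \<in> borel_measurable lebesgue"
    using ext0_integrable[OF assms] by simp
  have "(LINT x|lborel. norm (borel_rep (ext0 u) x)) = (LINT x|lebesgue. norm (borel_rep (ext0 u) x))"
    by (rule integral_completion[symmetric]) measurable
  also have "\<dots> = (LINT x|lebesgue. norm (ext0 u x))"
    by (rule integral_cong_AE) (use v(2) in \<open>auto intro!: measurable_completion borel_measurable_norm\<close>)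
  also have "\<dots> = (LINT x|lebesgue_on \<Omega>. norm (u x))"
    unfolding ext0_integral by (simp add: ext0_def)
  finally show ?thesis .
qed

lemma smear_lebesgue:
  assumes "integrable lborel v"
  shows "integrable lebesgue (smear v)"
  using smear_integrable[OF assms] by (subst integrable_completion) auto

lemma ext_integrable:
  assumes "integrable (lebesgue_on \<Omega>) u"
  shows "integrable lebesgue (ext u)"
  unfolding ext_def[abs_def]
  by (intro Bochner_Integration.integrable_diff ext0_integrable smear_lebesgue borel_rep assms)

text \<open>By \<open>far\<close> the images of the strip have positive distance from
  \<open>\<Omega>\<close>, so the correction is 0 at every point of \<open>\<Omega>\<close>.\<close>

lemma ext_eq: "x \<in> \<Omega> \<Longrightarrow> ext u x = u x"
proof -
  assume x: "x \<in> \<Omega>"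
  have "smear (borel_rep (ext0 u)) x = 0"
  proof (rule smear_eq_0)
    fix x' y assume "x' \<in> U" "y \<in> cbox 0 (One::'a)"
    then show "a x' + b x' *\<^sub>R y \<noteq> x"
      using far[of x' y] infdist_pos[of x'] x U_eq by (auto simp: infdist_zero)
  qed
  then show ?thesis
    using x by (simp add: ext_def ext0_def)
qed

lemma ext_cong_AE:
  assumes u: "integrable (lebesgue_on \<Omega>) u" "integrable (lebesgue_on \<Omega>) v"
    and "AE x in lebesgue_on \<Omega>. u x = v x"
  shows "AE x in lebesgue. ext u x = ext v x"
proof -
  note R = borel_rep[OF ext0_integrable[OF u(1)]] borel_rep[OF ext0_integrable[OF u(2)]]
  have eq: "AE x in lebesgue. ext0 u x = ext0 v x"
    using assms(3) \<Omega> by (auto simp: AE_restrict_space_iff ext0_def elim: eventually_mono)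
  then have "AE x in lebesgue. borel_rep (ext0 u) x = borel_rep (ext0 v) x"
    using R(2,4) by eventually_elim simp
  then have "AE x in lborel. borel_rep (ext0 u) x = borel_rep (ext0 v) x"
    by (simp add: AE_completion_iff)
  then have "smear (borel_rep (ext0 u)) z = smear (borel_rep (ext0 v)) z" for z
    using R by (intro smear_cong_AE) auto
  then show ?thesis
    using eq by (auto simp: ext_def elim: eventually_mono)
qed

lemma ext_linear:
  assumes u: "integrable (lebesgue_on \<Omega>) u" "integrable (lebesgue_on \<Omega>) v"
  shows "AE x in lebesgue. ext (\<lambda>y. \<alpha> *\<^sub>R u y + \<beta> *\<^sub>R v y) x = \<alpha> *\<^sub>R ext u x + \<beta> *\<^sub>R ext v x"
proof -
  define f where "f = (\<lambda>y. \<alpha> *\<^sub>R u y + \<beta> *\<^sub>R v y)"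
  have f: "integrable (lebesgue_on \<Omega>) f"
    unfolding f_def using u by (intro Bochner_Integration.integrable_add integrable_scaleR_right) auto
  note R = borel_rep[OF ext0_integrable[OF u(1)]] borel_rep[OF ext0_integrable[OF u(2)]]
    borel_rep[OF ext0_integrable[OF f]]
  have f0: "ext0 f x = \<alpha> *\<^sub>R ext0 u x + \<beta> *\<^sub>R ext0 v x" for x
    by (simp add: f_def ext0_def scaleR_add_right mult.commute)
  have "AE x in lebesgue. borel_rep (ext0 f) x = \<alpha> *\<^sub>R borel_rep (ext0 u) x + \<beta> *\<^sub>R borel_rep (ext0 v) x"
    using R(2,4,6) by eventually_elim (use f0 in metis)
  then have "AE x in lborel. borel_rep (ext0 f) x = \<alpha> *\<^sub>R borel_rep (ext0 u) x + \<beta> *\<^sub>R borel_rep (ext0 v) x"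
    by (simp add: AE_completion_iff)
  then have "smear (borel_rep (ext0 f)) z
      = smear (\<lambda>x. \<alpha> *\<^sub>R borel_rep (ext0 u) x + \<beta> *\<^sub>R borel_rep (ext0 v) x) z" for z
    using R(1,3,5)[THEN borel_measurable_integrable] by (intro smear_cong_AE) auto
  moreover have "AE z in lebesgue. smear (\<lambda>x. \<alpha> *\<^sub>R borel_rep (ext0 u) x + \<beta> *\<^sub>R borel_rep (ext0 v) x) z
      = \<alpha> *\<^sub>R smear (borel_rep (ext0 u)) z + \<beta> *\<^sub>R smear (borel_rep (ext0 v)) z"
    by (intro AE_completion smear_linear R)
  ultimately show ?thesis
    unfolding f_def[symmetric]
    by (auto simp: ext_def f0 algebra_simps elim: eventually_mono)
qed

lemma ext_norm:
  assumes u: "integrable (lebesgue_on \<Omega>) u" and S: "S \<in> sets lebesgue"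
  shows "(LINT x|lebesgue_on S. norm (ext u x)) \<le> (1 + C) * (LINT x|lebesgue_on \<Omega>. norm (u x))"
proof -
  note v = borel_rep[OF ext0_integrable[OF u]]
  have "(LINT x|lebesgue_on S. norm (ext u x)) = (LINT x|lebesgue. indicator S x *\<^sub>R norm (ext u x))"
    using S by (simp add: integral_restrict_space)
  also have "\<dots> \<le> (LINT x|lebesgue. norm (ext0 u x) + norm (smear (borel_rep (ext0 u)) x))"
  proof (rule integral_mono)
    show "indicator S x *\<^sub>R norm (ext u x) \<le> norm (ext0 u x) + norm (smear (borel_rep (ext0 u)) x)" for x
      unfolding ext_def using norm_triangle_ineq4[of "ext0 u x" "smear (borel_rep (ext0 u)) x"]
      by (auto simp: indicator_def)
  qed (use S ext_integrable[OF u] ext0_integrable[OF u] smear_lebesgue[OF v(1)] in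
      \<open>auto intro!: integrable_mult_indicator[where f = "\<lambda>x. norm (ext u x)", simplified]\<close>)
  also have "\<dots> = (LINT x|lebesgue. norm (ext0 u x)) + (LINT x|lebesgue. norm (smear (borel_rep (ext0 u)) x))"
    by (intro Bochner_Integration.integral_add integrable_norm ext0_integrable[OF u] smear_lebesgue v)
  also have "(LINT x|lebesgue. norm (smear (borel_rep (ext0 u)) x)) = (LINT x|lborel. norm (smear (borel_rep (ext0 u)) x))"
    using smear_integrable[OF v(1)] by (intro integral_completion) auto
  also have "\<dots> \<le> C * (LINT x|lborel. norm (borel_rep (ext0 u) x))"
    by (rule smear_norm[OF v(1)])
  also have "(LINT x|lebesgue. norm (ext0 u x)) = (LINT x|lebesgue_on \<Omega>. norm (u x))"
    unfolding ext0_integral by (simp add: ext0_def)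
  finally show ?thesis
    by (simp add: borel_rep_norm[OF u] algebra_simps)
qed

text \<open>Moving the correction to the other side of the pairing leaves \<open>u\<close> tested
  against the gradient of \<open>\<phi> - A\<close>, where \<open>A\<close> is the average continued
  by 0. This difference is controlled by the boundary distance, so the criterion for functions
  vanishing at the boundary applies.\<close>

lemma ext_div_free:
  assumes u: "integrable (lebesgue_on \<Omega>) u" "div_free \<Omega> u"
  shows "div_free (nbhd \<Omega> (r / 2)) (ext u)"
  unfolding div_free_def
proof (intro allI impI)
  fix \<phi> assume "test_fun (nbhd \<Omega> (r / 2)) \<phi>"
  then obtain B where \<phi>: "\<And>x. (\<phi> has_derivative (\<lambda>h. grad \<phi> x \<bullet> h)) (at x)"
    and g: "continuous_on UNIV (grad \<phi>)" "\<And>x. norm (grad \<phi> x) \<le> B" and \<phi>B: "\<And>x. \<bar>\<phi> x\<bar> \<le> B"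
    and zero: "\<And>x. x \<notin> nbhd \<Omega> (r / 2) \<Longrightarrow> \<phi> x = 0" "\<And>x. x \<notin> nbhd \<Omega> (r / 2) \<Longrightarrow> grad \<phi> x = 0"
    by (rule test_fun_gradient) blast
  define v where "v = borel_rep (ext0 u)"
  have v: "integrable lborel v" "AE x in lebesgue. ext0 u x = v x"
    unfolding v_def using borel_rep[OF ext0_integrable[OF u(1)]] by auto
  have [measurable]: "v \<in> borel_measurable borel" using v by simp
  define A where "A = (\<lambda>x. if x \<in> U then integral (cbox 0 One) (\<lambda>y. \<phi> (a x + b x *\<^sub>R y)) else 0)"
  define A' where "A' = (\<lambda>x. indicator U x *\<^sub>R avg_grad (grad \<phi>) x)"
  \<comment> \<open>\<open>U\<close> and \<open>V\<close> overlap where the boundary distance is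
    between \<open>r / 2\<close> and \<open>r\<close>. On the overlap the average vanishes, hence
    its continuation by 0 is C^1 on all of \<open>\<Omega>\<close>.\<close>
  define V where "V = {x \<in> \<Omega>. r / 2 < infdist x (- \<Omega>)}"
  have V: "open V" "V \<subseteq> \<Omega>" "\<Omega> = U \<union> V"
    using \<Omega> r by (auto simp: V_def U_eq open_Collect_conj open_Collect_less continuous_on_infdist
        intro!: open_Collect_conj open_Collect_less continuous_intros)
  have AV: "A x = 0" "A' x = 0" if "x \<in> V" for x
  proof -
    have "a x + b x *\<^sub>R y \<notin> nbhd \<Omega> (r / 2)" if "x \<in> U" "y \<in> cbox 0 One" for y
      using far[OF that] \<open>x \<in> V\<close> by (auto simp: nbhd_def V_def)
    then have *: "\<phi> (a x + b x *\<^sub>R y) = 0" "grad \<phi> (a x + b x *\<^sub>R y) = 0" if "x \<in> U" "y \<in> cbox 0 One" for y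
      using zero that by auto
    have "integral (cbox 0 One) (\<lambda>y. \<phi> (a x + b x *\<^sub>R y)) = 0" if "x \<in> U"
      using integral_cong[OF *(1)[OF that]] by simp
    moreover have "avg_grad (grad \<phi>) x = 0" if "x \<in> U"
    proof -
      have "avg_grad (grad \<phi>) x = integral (cbox 0 (One :: 'a)) (\<lambda>y. 0 :: 'a)"
        unfolding avg_grad_def by (rule integral_cong) (simp add: *(2)[OF that])
      then show ?thesis by simp
    qed
    ultimately show "A x = 0" "A' x = 0"
      by (auto simp: A_def A'_def indicator_def)
  qed
  have B: "B \<ge> 0" using g(2)[of 0] norm_ge_zero order_trans by blast
  have A'c: "continuous_on U A'"
    by (rule continuous_on_eq[OF avg_grad_continuous[OF \<phi> g]]) (auto simp: A'_def)
  have A'B: "norm (A' x) \<le> B * C" for x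
    using avg_grad_bound[OF \<phi> g, of x] B C by (cases "x \<in> U") (auto simp: A'_def)
  have [measurable]: "A' \<in> borel_measurable borel"
    unfolding A'_def using U avg_grad_continuous[OF \<phi> g] by (intro borel_measurable_continuous_on_indicator) auto
  have vanish: "(LINT x|lebesgue_on \<Omega>. u x \<bullet> (grad \<phi> x - A' x)) = 0"
  \<comment> \<open>\<open>B + B * C\<close> bounds the gradient, \<open>B * M\<close> the decay on
    the strip by \<open>near\<close>. The term \<open>B / r\<close> serves the points outside the
    strip: their boundary distance is at least \<open>r\<close>, and \<open>\<phi>\<close> is at
    most \<open>B\<close>.\<close>
  proof (rule div_free_boundary_vanishing[OF \<Omega> u, where \<psi> = "\<lambda>x. \<phi> x - A x" and C = "B + B * C + B * M + B / r"])
    fix x assume x: "x \<in> \<Omega>"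
    show "((\<lambda>x. \<phi> x - A x) has_derivative (\<lambda>h. (grad \<phi> x - A' x) \<bullet> h)) (at x)"
      unfolding inner_diff_left
    proof (intro has_derivative_diff \<phi>)
      show "(A has_derivative (\<lambda>h. A' x \<bullet> h)) (at x)"
      proof (cases "x \<in> V")
        case True
        have "((\<lambda>x. 0) has_derivative (\<lambda>h. A' x \<bullet> h)) (at x)"
          using AV(2)[OF True] by simp
        then show ?thesis
          by (rule has_derivative_transform_within_open[OF _ V(1) True]) (simp add: AV)
      next
        case False
        then have xU: "x \<in> U" using x V by blast
        have "((\<lambda>x. integral (cbox 0 One) (\<lambda>y. \<phi> (a x + b x *\<^sub>R y))) has_derivative (\<lambda>h. A' x \<bullet> h)) (at x)"
          using average_has_derivative[OF \<phi> g xU] xU by (simp add: A'_def)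
        then show ?thesis
          by (rule has_derivative_transform_within_open[OF _ U xU]) (simp add: A_def)
      qed
    qed
    have nn: "B * C \<ge> 0" "B * M \<ge> 0" "B / r \<ge> 0"
      using B C M r by auto
    show "norm (grad \<phi> x - A' x) \<le> B + B * C + B * M + B / r"
      using norm_triangle_ineq4[of "grad \<phi> x" "A' x"] g(2)[of x] A'B[of x] nn by linarith
    have \<delta>: "infdist x (- \<Omega>) > 0" by (rule infdist_pos[OF x])
    have "\<bar>\<phi> x - A x\<bar> \<le> (B * M + B / r) * infdist x (- \<Omega>)"
    proof (cases "x \<in> U")
      case True
      have c: "continuous_on UNIV \<phi>"
        using \<phi> by (meson continuous_at_imp_continuous_on has_derivative_continuous)
      have i: "(\<lambda>y. \<phi> (a x + b x *\<^sub>R y)) integrable_on cbox 0 One"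
        by (intro integrable_continuous continuous_on_compose2[OF c] continuous_intros) auto
      have "\<phi> x - A x = integral (cbox 0 One) (\<lambda>y. \<phi> x - \<phi> (a x + b x *\<^sub>R y))"
        using True by (subst integral_diff[OF _ i]) (auto simp: A_def measure_unit_cbox)
      also have "norm \<dots> \<le> (B * (M * infdist x (- \<Omega>))) * measure lborel (cbox 0 (One :: 'a))"
      proof (rule integrable_bound)
        show "(\<lambda>y. \<phi> x - \<phi> (a x + b x *\<^sub>R y)) integrable_on cbox 0 One"
          using i by (intro integrable_diff) auto
        fix y :: 'a assume y: "y \<in> cbox 0 One"
        have "\<bar>\<phi> x - \<phi> (a x + b x *\<^sub>R y)\<bar> \<le> B * norm (x - (a x + b x *\<^sub>R y))"
          by (rule lipschitz_gradient_bound[OF \<phi> g(2)])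
        also have "\<dots> \<le> B * (M * infdist x (- \<Omega>))"
          by (intro mult_left_mono near True y B)
        finally show "norm (\<phi> x - \<phi> (a x + b x *\<^sub>R y)) \<le> B * (M * infdist x (- \<Omega>))" by simp
      qed (use B M \<delta> in auto)
      also have "\<dots> \<le> (B * M + B / r) * infdist x (- \<Omega>)"
        using mult_nonneg_nonneg[OF nn(3) less_imp_le[OF \<delta>]]
        by (simp add: measure_unit_cbox distrib_right mult.assoc)
      finally show ?thesis by simp
    next
      case False
      then have "r \<le> infdist x (- \<Omega>)" using x by (auto simp: U_eq)
      then have "B / r * r \<le> B / r * infdist x (- \<Omega>)"
        using nn by (intro mult_left_mono) auto
      then have "B \<le> B / r * infdist x (- \<Omega>)" using r by simp
      also have "\<dots> \<le> (B * M + B / r) * infdist x (- \<Omega>)"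
        using nn \<delta> by (intro mult_right_mono) auto
      finally show ?thesis
        using False \<phi>B[of x] by (simp add: A_def)
    qed
    also have "\<dots> \<le> (B + B * C + B * M + B / r) * infdist x (- \<Omega>)"
      using nn \<delta> B by (intro mult_right_mono) auto
    finally show "\<bar>\<phi> x - A x\<bar> \<le> (B + B * C + B * M + B / r) * infdist x (- \<Omega>)" .
  next
    have "continuous_on U (\<lambda>x. grad \<phi> x - A' x)"
      by (intro continuous_intros continuous_on_subset[OF g(1)] A'c) auto
    moreover have "continuous_on V (\<lambda>x. grad \<phi> x - A' x)"
      by (rule continuous_on_eq[OF continuous_on_subset[OF g(1)]]) (auto simp: AV)
    ultimately show "continuous_on \<Omega> (\<lambda>x. grad \<phi> x - A' x)"
      unfolding V(3) by (rule continuous_on_open_Un[OF U V(1)])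
  qed
  have gm[measurable]: "grad \<phi> \<in> borel_measurable borel"
    by (intro borel_measurable_continuous_onI g)
  have gl: "grad \<phi> \<in> borel_measurable lebesgue" "A' \<in> borel_measurable lebesgue"
    by (auto intro: measurable_completion)
  have "(LINT x|lebesgue_on (nbhd \<Omega> (r / 2)). ext u x \<bullet> grad \<phi> x)
      = (LINT x|lebesgue. indicator (nbhd \<Omega> (r / 2)) x *\<^sub>R (ext u x \<bullet> grad \<phi> x))"
    using open_nbhd by (intro integral_restrict_space) auto
  also have "\<dots> = (LINT x|lebesgue. ext0 u x \<bullet> grad \<phi> x - smear v x \<bullet> grad \<phi> x)"
    by (rule Bochner_Integration.integral_cong) (auto simp: indicator_def zero ext_def v_def inner_diff_left)
  also have "\<dots> = (LINT x|lebesgue. ext0 u x \<bullet> grad \<phi> x) - (LINT x|lebesgue. smear v x \<bullet> grad \<phi> x)"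
    by (intro Bochner_Integration.integral_diff integrable_inner_bounded[OF _ gl(1) g(2)] ext0_integrable u smear_lebesgue v)
  also have "(LINT x|lebesgue. smear v x \<bullet> grad \<phi> x) = (LINT x|lborel. smear v x \<bullet> grad \<phi> x)"
    using smear_integrable[OF v(1)] gm by (intro integral_completion borel_measurable_inner) auto
  also have "\<dots> = (LINT x|lborel. indicator U x *\<^sub>R (v x \<bullet> avg_grad (grad \<phi>) x))"
    by (rule smear_inner_gradient[OF \<phi> g v(1)])
  also have "\<dots> = (LINT x|lborel. v x \<bullet> A' x)"
    by (simp add: A'_def)
  also have "\<dots> = (LINT x|lebesgue. v x \<bullet> A' x)"
    by (rule integral_completion[symmetric]) measurable
  also have "\<dots> = (LINT x|lebesgue. ext0 u x \<bullet> A' x)"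
  proof (rule integral_cong_AE)
    show "AE x in lebesgue. v x \<bullet> A' x = ext0 u x \<bullet> A' x"
      using v(2) by eventually_elim simp
    show "(\<lambda>x. v x \<bullet> A' x) \<in> borel_measurable lebesgue"
      by (rule measurable_completion) measurable
    show "(\<lambda>x. ext0 u x \<bullet> A' x) \<in> borel_measurable lebesgue"
      using ext0_integrable[OF u(1)] gl by (intro borel_measurable_inner) auto
  qed
  also have "(LINT x|lebesgue. ext0 u x \<bullet> grad \<phi> x) - (LINT x|lebesgue. ext0 u x \<bullet> A' x)
      = (LINT x|lebesgue. ext0 u x \<bullet> grad \<phi> x - ext0 u x \<bullet> A' x)"
    by (intro Bochner_Integration.integral_diff[symmetric] integrable_inner_bounded[OF _ gl(1) g(2)]
        integrable_inner_bounded[OF _ gl(2) A'B] ext0_integrable u)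
  also have "\<dots> = (LINT x|lebesgue_on \<Omega>. u x \<bullet> (grad \<phi> x - A' x))"
    unfolding ext0_integral by (simp add: ext0_def inner_diff_right right_diff_distrib)
  finally show "(LINT x|lebesgue_on (nbhd \<Omega> (r / 2)). ext u x \<bullet> grad \<phi> x) = 0"
    using vanish by simp
qed

end

section \<open>The reflection at a Lipschitz boundary\<close>

lemma norm_unit_cbox_le:
  assumes "y \<in> cbox 0 (One :: 'a::euclidean_space)"
  shows "norm y \<le> DIM('a)"
proof -
  have "norm y \<le> (\<Sum>i\<in>Basis. \<bar>y \<bullet> i\<bar>)"
    by (rule norm_le_l1)
  also have "\<dots> \<le> (\<Sum>i\<in>(Basis :: 'a set). 1)"
    using assms by (intro sum_mono) (auto simp: mem_box)
  finally show ?thesis by simp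
qed

lemma bounded_on_compact:
  fixes f :: "'a::topological_space \<Rightarrow> 'b::real_normed_vector"
  assumes "compact S" "continuous_on S f"
  obtains N where "0 \<le> N" "\<And>x. x \<in> S \<Longrightarrow> norm (f x) \<le> N"
proof -
  have "bounded (f ` S)"
    by (intro compact_imp_bounded compact_continuous_image assms)
  then obtain N where "\<forall>y\<in>f ` S. norm y \<le> N"
    unfolding bounded_iff by blast
  then show ?thesis
    using that[of "\<bar>N\<bar>"] by fastforce
qed

lemma boundary_reflection_exists:
  fixes \<Omega> :: "'a::euclidean_space set"
  assumes lb: "lipschitz_boundary \<Omega>" and \<Omega>: "open \<Omega>" "bounded \<Omega>"
  shows "\<exists>U a a' b b' C r M. boundary_reflection U a a' b b' C \<Omega> r M"
proof (rule exit_field[OF lb \<Omega>], rule regularized_distance[OF \<Omega>])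
  fix \<nu> :: "'a \<Rightarrow> 'a" and \<nu>' c r and d :: "'a \<Rightarrow> real" and d'
  assume \<nu>: "\<And>x. (\<nu> has_derivative \<nu>' x) (at x)" "\<And>h. continuous_on UNIV (\<lambda>x. \<nu>' x h)"
    and c: "0 < c" "c \<le> 1" and r: "0 < r" "r \<le> 1"
    and exits: "\<And>x q s y. x \<in> \<Omega> \<Longrightarrow> infdist x (- \<Omega>) < r \<Longrightarrow> q \<notin> \<Omega> \<Longrightarrow> norm (q - x) < r \<Longrightarrow>
       0 \<le> s \<Longrightarrow> s < r \<Longrightarrow> norm y \<le> c \<Longrightarrow> q + s *\<^sub>R (\<nu> x + y) \<notin> \<Omega>"
    and d: "\<And>x. x \<in> \<Omega> \<Longrightarrow> (d has_derivative (\<lambda>h. d' x \<bullet> h)) (at x)" "continuous_on \<Omega> d'"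
      "\<And>x. x \<in> \<Omega> \<Longrightarrow> norm (d' x) \<le> 4"
      "\<And>x. x \<in> \<Omega> \<Longrightarrow> d x \<le> 2 * infdist x (- \<Omega>)"
      "\<And>x. x \<in> \<Omega> \<Longrightarrow> infdist x (- \<Omega>) \<le> 1 \<Longrightarrow> infdist x (- \<Omega>) / 4 \<le> d x"
  define \<delta> where "\<delta> = (\<lambda>x. infdist x (- \<Omega>))"
  have "\<Omega> \<noteq> UNIV"
    using \<Omega> not_bounded_UNIV by blast
  then have \<delta>pos: "\<delta> x > 0" if "x \<in> \<Omega>" for x
    unfolding \<delta>_def using that \<Omega> by (intro infdist_pos_not_in_closed) auto
  have cl: "compact (closure \<Omega>)"
    using \<Omega> by simp
  have \<nu>c: "continuous_on UNIV \<nu>"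
    using \<nu>(1) by (meson continuous_at_imp_continuous_on has_derivative_continuous)
  obtain N where N: "0 \<le> N" "\<And>x. x \<in> closure \<Omega> \<Longrightarrow> norm (\<nu> x) \<le> N"
    using bounded_on_compact[OF cl continuous_on_subset[OF \<nu>c]] by blast
  have "continuous_on (closure \<Omega>) (\<lambda>x. \<Sum>i\<in>Basis. norm (\<nu>' x i))"
    by (intro continuous_intros continuous_on_subset[OF \<nu>(2)]) auto
  then obtain N' where N': "0 \<le> N'" "\<And>x. x \<in> closure \<Omega> \<Longrightarrow> norm (\<Sum>i\<in>Basis. norm (\<nu>' x i)) \<le> N'"
    using bounded_on_compact[OF cl] by blast
  have \<nu>'bound: "norm (\<nu>' x h) \<le> N' * norm h" if "x \<in> \<Omega>" for x h
  proof -
    have "linear (\<nu>' x)"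
      by (rule has_derivative_linear[OF \<nu>(1)])
    then have "\<nu>' x h = (\<Sum>i\<in>Basis. (h \<bullet> i) *\<^sub>R \<nu>' x i)"
      by (subst euclidean_representation[of h, symmetric]) (simp add: linear_sum linear_scale)
    also have "norm \<dots> \<le> (\<Sum>i\<in>Basis. norm h * norm (\<nu>' x i))"
      by (intro sum_norm_le) (auto intro!: mult_right_mono Basis_le_norm)
    also have "\<dots> = norm h * (\<Sum>i\<in>Basis. norm (\<nu>' x i))"
      by (simp add: sum_distrib_left)
    also have "\<dots> \<le> norm h * N'"
      using N'(2)[of x] that closure_subset[of \<Omega>] by (intro mult_left_mono) auto
    finally show ?thesis by (simp add: mult.commute)
  qed
  \<comment> \<open>Since \<open>d\<close> is at least a quarter of \<open>\<delta>\<close> on the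
    strip, the factor 16 gives \<open>4 * \<delta> x \<le> c * s x\<close>; a displacement of size
    \<open>2 * \<delta> x\<close> is then at most \<open>c / 2\<close> in units of the step
    \<open>s x\<close>.\<close>
  define \<Lambda> where "\<Lambda> = 16 / c"
  have \<Lambda>: "\<Lambda> \<ge> 16" "\<Lambda> * c = 16"
    using c by (auto simp: \<Lambda>_def field_simps)
  \<comment> \<open>On the unit cube \<open>norm y\<close> is at most the dimension, so averaging
    uses up only a quarter of the opening \<open>c\<close>.\<close>
  define \<kappa> where "\<kappa> = c / (4 * DIM('a))"
  have \<kappa>: "\<kappa> > 0" "\<kappa> * DIM('a) = c / 4"
    using c by (auto simp: \<kappa>_def)
  \<comment> \<open>The step is at most \<open>2 * \<Lambda> * \<delta> x\<close>, which on a strip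
    of this width stays below the length \<open>r\<close> allowed by the exit field.\<close>
  define r1 where "r1 = r / (2 * \<Lambda>)"
  have r1: "0 < r1" "r1 \<le> r" "2 * \<Lambda> * r1 = r"
    using r \<Lambda> by (auto simp: r1_def field_simps)
  define U where "U = {x \<in> \<Omega>. \<delta> x < r1}"
  define s where "s = (\<lambda>x. \<Lambda> * d x)"
  have U: "x \<in> \<Omega>" "\<delta> x > 0" "\<delta> x < r1" "\<delta> x \<le> c * s x / 4" "s x \<le> 2 * \<Lambda> * \<delta> x" "0 < s x" "s x < r" if "x \<in> U" for x
  proof -
    show x: "x \<in> \<Omega>" "\<delta> x > 0" and x1: "\<delta> x < r1" using that \<delta>pos by (auto simp: U_def)
    have "\<delta> x / 4 \<le> d x"
      using d(5)[OF x(1)] x1 r1 r by (simp add: \<delta>_def)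
    then have "\<Lambda> * (\<delta> x / 4) \<le> s x"
      using \<Lambda> unfolding s_def by (intro mult_left_mono) auto
    then have "c * (\<Lambda> * (\<delta> x / 4)) \<le> c * s x"
      using c by (intro mult_left_mono) auto
    moreover have "c * (\<Lambda> * (\<delta> x / 4)) = (\<Lambda> * c) * (\<delta> x / 4)"
      by (simp only: mult.assoc mult.left_commute)
    ultimately show le: "\<delta> x \<le> c * s x / 4"
      unfolding \<Lambda>(2) by linarith
    then have "0 < c * s x" using x(2) by linarith
    then show "0 < s x" using c by (simp add: zero_less_mult_iff)
    have "\<Lambda> * d x \<le> \<Lambda> * (2 * \<delta> x)"
      using d(4)[OF x(1)] \<Lambda> unfolding \<delta>_def by (intro mult_left_mono) auto
    then show sle: "s x \<le> 2 * \<Lambda> * \<delta> x" by (simp add: s_def)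
    have "2 * \<Lambda> * \<delta> x < 2 * \<Lambda> * r1"
      using x1 \<Lambda> by (intro mult_strict_left_mono) auto
    then show "s x < r" using sle r1 by simp
  qed
  define a where "a = (\<lambda>x. x + s x *\<^sub>R \<nu> x)"
  define a' where "a' = (\<lambda>x h. h + (s x *\<^sub>R \<nu>' x h + (\<Lambda> * (d' x \<bullet> h)) *\<^sub>R \<nu> x))"
  define b where "b = (\<lambda>x. \<kappa> * s x)"
  define b' where "b' = (\<lambda>x. (\<kappa> * \<Lambda>) *\<^sub>R d' x)"
  have Y: "a x + b x *\<^sub>R y = x + s x *\<^sub>R (\<nu> x + \<kappa> *\<^sub>R y)" for x y
    by (simp add: a_def b_def algebra_simps)
  have \<kappa>y: "norm (\<kappa> *\<^sub>R y) \<le> c / 4" if "y \<in> cbox 0 One" for y :: 'a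
    using mult_left_mono[OF norm_unit_cbox_le[OF that], of \<kappa>] \<kappa> by simp
  have sd: "(s has_derivative (\<lambda>h. \<Lambda> * (d' x \<bullet> h))) (at x)" if "x \<in> \<Omega>" for x
    unfolding s_def by (intro has_derivative_mult_right d that)
  have U\<Omega>: "U \<subseteq> \<Omega>" by (auto simp: U_def)
  have sc: "continuous_on U s"
    using sd U\<Omega> by (meson continuous_at_imp_continuous_on has_derivative_continuous subsetD)
  have oU: "open U"
    unfolding U_def \<delta>_def using \<Omega>
    by (intro open_Collect_conj open_Collect_less continuous_intros) auto
  \<comment> \<open>The constant adds up the identity, the derivative of \<open>\<nu>\<close> (with
    \<open>s x < r \<le> 1\<close>), the derivative of \<open>s\<close> times \<open>\<nu>\<close>,
    and the derivative of the scale times \<open>y\<close> (with the norm of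
    \<open>\<kappa> *\<^sub>R y\<close> at most 1). The two terms with 4 come from the gradient
    bound for \<open>d\<close>.\<close>
  have "averaged_map U a a' b b' (1 + N' + 4 * \<Lambda> * N + 4 * \<Lambda>)"
  proof
    show "(a has_derivative a' x) (at x)" if "x \<in> U" for x
      unfolding a_def a'_def
      by (intro has_derivative_add has_derivative_ident has_derivative_scaleR sd \<nu>) (use that U\<Omega> in auto)
    show "continuous_on U (\<lambda>x. a' x h)" for h
      unfolding a'_def
      by (intro continuous_intros sc continuous_on_subset[OF \<nu>(2)] continuous_on_subset[OF \<nu>c] continuous_on_subset[OF d(2) U\<Omega>]) auto
    show "(b has_derivative (\<lambda>h. b' x \<bullet> h)) (at x)" if "x \<in> U" for x
    proof -
      have "(b has_derivative (\<lambda>h. \<kappa> * (\<Lambda> * (d' x \<bullet> h)))) (at x)"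
        unfolding b_def by (intro has_derivative_mult_right sd) (use that U\<Omega> in auto)
      then show ?thesis by (simp add: b'_def mult.assoc)
    qed
    show "continuous_on U b'"
      unfolding b'_def by (intro continuous_intros continuous_on_subset[OF d(2) U\<Omega>])
    show "0 < b x" if "x \<in> U" for x
      using U(6)[OF that] \<kappa> by (simp add: b_def)
    show "0 \<le> 1 + N' + 4 * \<Lambda> * N + 4 * \<Lambda>"
      using N N' \<Lambda> by simp
    show "norm (a' x h + (b' x \<bullet> h) *\<^sub>R y) \<le> (1 + N' + 4 * \<Lambda> * N + 4 * \<Lambda>) * norm h"
      if x: "x \<in> U" and y: "y \<in> cbox 0 One" for x y h
    proof -
      have x\<Omega>: "x \<in> \<Omega>" using x U\<Omega> by blast
      have dh: "\<bar>d' x \<bullet> h\<bar> \<le> 4 * norm h"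
        using Cauchy_Schwarz_ineq2[of "d' x" h] mult_right_mono[OF d(3)[OF x\<Omega>] norm_ge_zero[of h]] by linarith
      have 1: "norm (s x *\<^sub>R \<nu>' x h) \<le> 1 * (N' * norm h)"
        unfolding norm_scaleR using U(6,7)[OF x] r \<nu>'bound[OF x\<Omega>] by (intro mult_mono) auto
      have 2: "norm ((\<Lambda> * (d' x \<bullet> h)) *\<^sub>R \<nu> x) \<le> (\<Lambda> * (4 * norm h)) * N"
        unfolding norm_scaleR
      proof (rule mult_mono)
        show "\<bar>\<Lambda> * (d' x \<bullet> h)\<bar> \<le> \<Lambda> * (4 * norm h)"
          using dh \<Lambda> by (simp add: abs_mult)
        show "norm (\<nu> x) \<le> N"
          using N(2) x\<Omega> closure_subset by blast
      qed (use \<Lambda> in auto)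
      have 3: "norm ((b' x \<bullet> h) *\<^sub>R y) \<le> \<Lambda> * (4 * norm h)"
      proof -
        have "norm ((b' x \<bullet> h) *\<^sub>R y) = \<Lambda> * \<bar>d' x \<bullet> h\<bar> * norm (\<kappa> *\<^sub>R y)"
          using \<Lambda> \<kappa> by (simp add: b'_def abs_mult)
        also have "\<dots> \<le> (\<Lambda> * (4 * norm h)) * 1"
          using dh \<Lambda> \<kappa>y[OF y] c by (intro mult_mono mult_left_mono) auto
        finally show ?thesis by simp
      qed
      have "norm (a' x h + (b' x \<bullet> h) *\<^sub>R y) \<le> norm h + (norm (s x *\<^sub>R \<nu>' x h) + norm ((\<Lambda> * (d' x \<bullet> h)) *\<^sub>R \<nu> x))
          + norm ((b' x \<bullet> h) *\<^sub>R y)"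
        unfolding a'_def by (intro norm_triangle_mono order_refl)
      also have "\<dots> \<le> norm h + (1 * (N' * norm h) + (\<Lambda> * (4 * norm h)) * N) + \<Lambda> * (4 * norm h)"
        using 1 2 3 by linarith
      also have "\<dots> = (1 + N' + 4 * \<Lambda> * N + 4 * \<Lambda>) * norm h"
        by (simp add: algebra_simps)
      finally show ?thesis .
    qed
  qed (rule oU)
  moreover have "boundary_reflection_axioms U a b \<Omega> r1 (2 * \<Lambda> * (N + 1))"
  proof
    show "U = {x \<in> \<Omega>. infdist x (- \<Omega>) < r1}"
      by (simp add: U_def \<delta>_def)
    show "0 \<le> 2 * \<Lambda> * (N + 1)" using \<Lambda> N by simp
    fix x y :: 'a assume x: "x \<in> U" and y: "y \<in> cbox 0 One"
    note Ux = U[OF x]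
    have "norm (x - (a x + b x *\<^sub>R y)) = s x * norm (\<nu> x + \<kappa> *\<^sub>R y)"
      unfolding Y using Ux(6) by simp
    also have "\<dots> \<le> (2 * \<Lambda> * \<delta> x) * (N + 1)"
    proof (rule mult_mono[OF Ux(5)])
      have "norm (\<nu> x) \<le> N"
        using N(2) Ux(1) closure_subset by blast
      then show "norm (\<nu> x + \<kappa> *\<^sub>R y) \<le> N + 1"
        using norm_triangle_ineq[of "\<nu> x" "\<kappa> *\<^sub>R y"] \<kappa>y[OF y] c by linarith
    qed (use Ux \<Lambda> in auto)
    finally show "norm (x - (a x + b x *\<^sub>R y)) \<le> 2 * \<Lambda> * (N + 1) * infdist x (- \<Omega>)"
      by (simp add: \<delta>_def algebra_simps)
    define z where "z = a x + b x *\<^sub>R y"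
    \<comment> \<open>A point \<open>w\<close> closer to \<open>z\<close> than
      \<open>\<delta> x\<close> can be reached from the nearest complement point \<open>q\<close> by
      an admissible exit step of the same length \<open>s x\<close>, so it is not in
      \<open>\<Omega>\<close>.\<close>
    have "\<delta> x \<le> dist z w" if w: "w \<in> \<Omega>" for w
    proof (rule ccontr)
      assume "\<not> \<delta> x \<le> dist z w"
      then have zw: "norm (w - z) < \<delta> x" by (simp add: dist_norm norm_minus_commute)
      obtain q where q: "q \<notin> \<Omega>" "dist x q = \<delta> x"
        using infdist_compl_frontier[OF \<Omega> Ux(1)] unfolding \<delta>_def by metis
      \<comment> \<open>Starting in \<open>q\<close> instead of \<open>x\<close> and ending in
        \<open>w\<close> instead of \<open>z\<close> changes the step by
        \<open>(x - q) + (w - z)\<close>, of norm at most \<open>2 * \<delta> x\<close>. In units of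
        \<open>s x\<close> this is at most \<open>c / 2\<close>, and together with
        \<open>c / 4\<close> from the cube it remains below \<open>c\<close>.\<close>
      define y' where "y' = \<kappa> *\<^sub>R y + ((x - q) + (w - z)) /\<^sub>R s x"
      have "norm (((x - q) + (w - z)) /\<^sub>R s x) \<le> c / 2"
      proof -
        have "norm ((x - q) + (w - z)) \<le> 2 * \<delta> x"
          using norm_triangle_ineq[of "x - q" "w - z"] q(2) zw by (simp add: dist_norm)
        then have "norm ((x - q) + (w - z)) \<le> c / 2 * s x"
          using Ux(4) by simp
        then have "norm ((x - q) + (w - z)) / s x \<le> c / 2"
          by (rule pos_divide_le_eq[OF Ux(6), THEN iffD2])
        moreover have "norm (p /\<^sub>R s x) = norm p / s x" for p :: 'a
          unfolding norm_scaleR divide_inverse using Ux(6) by (simp add: abs_of_pos mult.commute)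
        ultimately show ?thesis by presburger
      qed
      then have y': "norm y' \<le> c"
        using norm_triangle_ineq[of "\<kappa> *\<^sub>R y" "((x - q) + (w - z)) /\<^sub>R s x"] \<kappa>y[OF y] c
        unfolding y'_def by linarith
      have "q + s x *\<^sub>R (\<nu> x + y') \<notin> \<Omega>"
      proof (rule exits[OF Ux(1) _ q(1) _ _ Ux(7) y'])
        show "infdist x (- \<Omega>) < r" using Ux(3) r1 by (simp add: \<delta>_def)
        show "norm (q - x) < r" using q(2) Ux(3) r1 by (simp add: dist_norm norm_minus_commute)
      qed (use Ux in simp)
      moreover have "q + s x *\<^sub>R (\<nu> x + y') = w"
      proof -
        have "s x *\<^sub>R (\<nu> x + y') = s x *\<^sub>R (\<nu> x + \<kappa> *\<^sub>R y) + ((x - q) + (w - z))"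
          using Ux(6) by (simp add: y'_def scaleR_add_right)
        then show ?thesis
          unfolding z_def Y by simp
      qed
      ultimately show False using w by simp
    qed
    moreover have ne: "\<Omega> \<noteq> {}"
      using Ux(1) by blast
    ultimately show "infdist x (- \<Omega>) \<le> infdist (a x + b x *\<^sub>R y) \<Omega>"
      unfolding z_def[symmetric] infdist_notempty[OF ne]
      by (intro cINF_greatest ne) (simp add: \<delta>_def)
  qed (use \<Omega> r1 in auto)
  ultimately show ?thesis
    unfolding boundary_reflection_def by blast
qed

theorem theorem6p1:
  fixes \<Omega> :: "'a::euclidean_space set"
  assumes "domain \<Omega>" and "bounded \<Omega>" and "lipschitz_boundary \<Omega>"
  shows "\<exists>\<epsilon>>0. \<exists>(E :: ('a \<Rightarrow> 'a) \<Rightarrow> ('a \<Rightarrow> 'a)) (C::real).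
    (\<forall>u. integrable (lebesgue_on \<Omega>) u \<longrightarrow> integrable (lebesgue_on (nbhd \<Omega> \<epsilon>)) (E u)) \<and>
    (\<forall>u v. integrable (lebesgue_on \<Omega>) u \<and> integrable (lebesgue_on \<Omega>) v \<and>
        (AE x in lebesgue_on \<Omega>. u x = v x) \<longrightarrow>
        (AE x in lebesgue_on (nbhd \<Omega> \<epsilon>). E u x = E v x)) \<and>
    (\<forall>u v a b. integrable (lebesgue_on \<Omega>) u \<and> integrable (lebesgue_on \<Omega>) v \<longrightarrow>
        (AE x in lebesgue_on (nbhd \<Omega> \<epsilon>).
           E (\<lambda>y. a *\<^sub>R u y + b *\<^sub>R v y) x = a *\<^sub>R E u x + b *\<^sub>R E v x)) \<and>
    (\<forall>u. integrable (lebesgue_on \<Omega>) u \<longrightarrow>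
        integral\<^sup>L (lebesgue_on (nbhd \<Omega> \<epsilon>)) (\<lambda>x. norm (E u x))
          \<le> C * integral\<^sup>L (lebesgue_on \<Omega>) (\<lambda>x. norm (u x))) \<and>
    (\<forall>u. integrable (lebesgue_on \<Omega>) u \<longrightarrow> (AE x in lebesgue_on \<Omega>. E u x = u x)) \<and>
    (\<forall>u. integrable (lebesgue_on \<Omega>) u \<and> div_free \<Omega> u \<longrightarrow> div_free (nbhd \<Omega> \<epsilon>) (E u))"
proof -
  have "open \<Omega>" using assms(1) by (simp add: domain_def)
  then obtain U a a' b b' C r M where "boundary_reflection U a a' b b' C \<Omega> r M"
    using boundary_reflection_exists assms by blast
  then interpret boundary_reflection U a a' b b' C \<Omega> r M .
  have S: "nbhd \<Omega> (r / 2) \<in> sets lebesgue"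
    using open_nbhd by auto
  show ?thesis
  \<comment> \<open>With half the strip width as \<open>\<epsilon>\<close>, averages of test
    functions vanish before the strip ends. In the norm bound the 1 belongs to the extension by zero
    and \<open>C\<close> to the correction.\<close>
  proof (rule exI[of _ "r / 2"], intro conjI exI[of _ ext] exI[of _ "1 + C"] allI impI)
    show "0 < r / 2" using r by simp
  next
    fix u :: "'a \<Rightarrow> 'a" assume "integrable (lebesgue_on \<Omega>) u"
    then show "integrable (lebesgue_on (nbhd \<Omega> (r / 2))) (ext u)"
      by (rule integrable_lebesgue_on[OF S ext_integrable])
  next
    fix u v :: "'a \<Rightarrow> 'a"
    assume "integrable (lebesgue_on \<Omega>) u \<and> integrable (lebesgue_on \<Omega>) v \<and> (AE x in lebesgue_on \<Omega>. u x = v x)"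
    then show "AE x in lebesgue_on (nbhd \<Omega> (r / 2)). ext u x = ext v x"
      by (intro AE_lebesgue_on[OF S ext_cong_AE]) auto
  next
    fix u v :: "'a \<Rightarrow> 'a" and \<alpha> \<beta> :: real
    assume "integrable (lebesgue_on \<Omega>) u \<and> integrable (lebesgue_on \<Omega>) v"
    then show "AE x in lebesgue_on (nbhd \<Omega> (r / 2)).
        ext (\<lambda>y. \<alpha> *\<^sub>R u y + \<beta> *\<^sub>R v y) x = \<alpha> *\<^sub>R ext u x + \<beta> *\<^sub>R ext v x"
      by (intro AE_lebesgue_on[OF S ext_linear]) auto
  next
    fix u :: "'a \<Rightarrow> 'a" assume "integrable (lebesgue_on \<Omega>) u"
    then show "(LINT x|lebesgue_on (nbhd \<Omega> (r / 2)). norm (ext u x)) \<le> (1 + C) * (LINT x|lebesgue_on \<Omega>. norm (u x))"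
      by (rule ext_norm[OF _ S])
  next
    fix u :: "'a \<Rightarrow> 'a"
    show "AE x in lebesgue_on \<Omega>. ext u x = u x"
      by (rule AE_I2) (simp add: ext_eq)
  next
    fix u :: "'a \<Rightarrow> 'a" assume "integrable (lebesgue_on \<Omega>) u \<and> div_free \<Omega> u"
    then show "div_free (nbhd \<Omega> (r / 2)) (ext u)"
      using ext_div_free by blast
  qed
qed

end
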